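(* Consider either of the following two cases, with a convex compact set $\mathcal K\subseteq[0,1]^d$ and objective functions $f_{t,i}:[0,1]^d\to\mathbb R$ ($t\in[T]$, $i\in[N]$): (Case A.2) $\mathbf 0\in\mathcal K$, the $f_{t,i}$ are non-negative, monotone and $\gamma$-weakly up-concave for some $0<\gamma\le1$, and $\alpha=1-e^{-\gamma}$; (Case A.3) the $f_{t,i}$ are non-negative and up-concave (not necessarily monotone), $\underline{\mathbf u}\in\mathcal K$ is a fixed point, and $\alpha=\frac{1-\|\underline{\mathbf u}\|_\infty}{4}$. Suppose the $f_{t,i}$ are continuous, differentiable, Lipschitz continuous and smooth (with common constants), that the zeroth-order query oracle is bounded, and that the weight matrix $A$ is symmetric and doubly stochastic with second largest eigenvalue $\lambda_2<1$. Run the zeroth-order full-information algorithm described in the context with block size $K$, step size $\eta$, smoothing parameter $\delta$ and error tolerance $\epsilon=K^2\eta^2\delta^{-2}$. Then for every agent $i$ $$\mathbb E[\mathcal R_\alpha^i]=O\left(\frac1\eta+\eta TK\delta^{-2}+\delta T\right),$$ with at most $O\left(\frac{T}{\epsilon K}\right)$ linear optimization oracle (LOO) calls and $O(T/K)$ communication complexity. In particular, for $0\le\theta\le1$, if $K=T^{1-\theta}$, $\delta=T^{-\theta/4}$ and $\eta=\frac\delta{\sqrt{KT}}$, then $\mathbb E[\mathcal R_\alpha^i]=O(T^{1-\theta/4})$ with at most $O(T^{2\theta})$ LOO calls and $O(T^\theta)$ communication complexity.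
   Context: **Functions.** Inequalities between vectors are coordinatewise. A differentiable $f$ is $\gamma$-weakly up-concave if for all $\mathbf x\le\mathbf y$: $\gamma\langle\nabla f(\mathbf y),\mathbf y-\mathbf x\rangle\le f(\mathbf y)-f(\mathbf x)\le\frac1\gamma\langle\nabla f(\mathbf x),\mathbf y-\mathbf x\rangle$; up-concave means $\gamma=1$. Monotone means $\mathbf x\le\mathbf y$ implies $f(\mathbf x)\le f(\mathbf y)$. **Network.** $N$ agents are the nodes of an undirected graph $([N],E)$; $\mathcal N_i=\{j:(i,j)\in E\}\cup\{i\}$. $A=[a_{ij}]\in\mathbb R_+^{N\times N}$ has $a_{ij}>0$ only if $(i,j)\in E$ or $i=j$; its largest eigenvalue is $1$ and $\lambda_2$ is its second largest eigenvalue ($\lambda_2=1$ corresponds to a disconnected network). In one communication, agent $i$ receives $\sum_{j\in\mathcal N_i}a_{ij}\mathbf s^j$ from its neighbors' state vectors $\mathbf s^j$. Communication complexity is the total number of communications over the horizon. **Problem.** An adversary chooses the sequence $f_{t,i}$. At round $t$ agent $i$ plays $\hat{\mathbf x}_t^i\in\mathcal K$ and queries a zeroth-order oracle $\mathcal Q$ at a point $\mathbf w$ of its choice (full-information feedback); the response is a random number with mean $f_{t,i}(\mathbf w)$, bounded in absolute value by a constant $B_0$. The $\alpha$-regret is $$\mathcal R_\alpha^i=\alpha\max_{\mathbf u\in\mathcal K}\frac1N\sum_{t=1}^T\sum_{j=1}^Nf_{t,j}(\mathbf u)-\frac1N\sum_{t=1}^T\sum_{j=1}^Nf_{t,j}(\hat{\mathbf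 x}_t^i).$$ **LOO and infeasible projection oracle.** Let $R=\max_{\mathbf x\in\mathcal K}\|\mathbf x\|$. For a convex compact $\mathcal K'\subseteq\mathcal K$, an LOO returns $\arg\max_{\mathbf u\in\mathcal K'}\langle\mathbf x,\mathbf u\rangle$. The infeasible projection oracle $\mathcal O_{IP}(\mathcal K',\mathbf x_0,\mathbf y_0,\epsilon)$ takes $\mathbf x_0\in\mathcal K'$, $\mathbf y_0\in\mathbb R^d$ and returns $(\mathbf x,\tilde{\mathbf y})$ with $\mathbf x\in\mathcal K'$, $\|\tilde{\mathbf y}\|\le R$, $\|\mathbf x-\tilde{\mathbf y}\|^2\le3\epsilon$ and $\|\tilde{\mathbf y}-\mathbf z\|^2\le\|\mathbf y_0-\mathbf z\|^2$ for all $\mathbf z\in\mathcal K'$. It is a known fact (used as given) that it can be implemented with at most $\lceil27R^2/\epsilon-2\rceil\max\big(1,\frac{\|\mathbf x_0-\mathbf y_0\|^2(\|\mathbf x_0-\mathbf y_0\|^2-\epsilon)}{4\epsilon^2}+1\big)$ LOO calls; this implementation is used. **Shrunk set.** Fix $\mathbf c\in\mathrm{relint}(\mathcal K)$ and $r>0$ such that $\mathrm{aff}(\mathcal K)\cap\mathbb B_r(\mathbf c)\subseteq\mathcal K$, where $\mathbb B_r(\mathbf c)$ is the ball of radius $r$ around $\mathbf c$. For $0<\delta<r$ let $\hat{\mathcal K}_\delta=(1-\frac\delta r)\mathcal K+\frac\delta r\mathbf c$. Let $\mathcal L_0=\mathrm{aff}(\mathcal K)-\mathbf x$ (any $\mathbf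 x\in\mathcal K$), $k=\dim\mathcal L_0$, and $\mathbb S^1$ the unit sphere centered at the origin of $\mathbb R^d$. **Case-dependent maps.** Case A.2: $h(\mathbf x)=\mathbf x$; the random $z\in[0,1]$ has law $\mathbb P(z\le s)=\int_0^s\frac{\gamma e^{\gamma(u-1)}}{1-e^{-\gamma}}du$; $\mathbf w(\mathbf x,z)=z\mathbf x$. Case A.3: $h(\mathbf x)=\frac{\mathbf x+\underline{\mathbf u}}2$; $z\in[0,1]$ has law $\mathbb P(z\le s)=\int_0^s\frac{du}{3(1-u/2)^3}$; $\mathbf w(\mathbf x,z)=\frac z2(\mathbf x-\underline{\mathbf u})+\underline{\mathbf u}$. **Algorithm.** Set $\mathbf x_1^i=\tilde{\mathbf y}_1^i=\mathbf c$ for all $i$. For $m=1,\dots,T/K$, with $\mathcal T_m=\{(m-1)K+1,\dots,mK\}$, each agent $i$ in parallel: for $t\in\mathcal T_m$, plays $\hat{\mathbf x}_t^i=h(\mathbf x_m^i)$, samples $\mathbf v_t^i$ uniformly from $\mathbb S^1\cap\mathcal L_0$ and $z$ from its law, lets $\mathbf w_t^i=\mathbf w(\mathbf x_m^i,z)$, queries $\mathcal Q$ at $\mathbf w_t^i+\delta\mathbf v_t^i$ receiving $o_t^i$, and sets $\mathbf o_t^i=\frac k\delta o_t^i\mathbf v_t^i$; then communicates $(\mathbf x_m^i,\tilde{\mathbf y}_m^i)$ with its neighbors (once per block); then sets $$\mathbf y_{m+1}^i=\sum_{j\in\mathcal N_i}a_{ij}\tilde{\mathbf y}_m^j+\eta\sum_{t\in\mathcal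 T_m}\mathbf o_t^i,\qquad(\mathbf x_{m+1}^i,\tilde{\mathbf y}_{m+1}^i)=\mathcal O_{IP}\Big(\hat{\mathcal K}_\delta,\sum_{j\in\mathcal N_i}a_{ij}\mathbf x_m^j,\mathbf y_{m+1}^i,\epsilon\Big).$$ **Conventions.** $K$ is a positive integer dividing $T$ and $0<\delta<r$. Constants implied by $O(\cdot)$ may depend on the fixed problem parameters ($\gamma,d,k,R,r,N,\lambda_2$, the Lipschitz and smoothness constants, $B_0$) but not on $T,K,\eta,\epsilon,\delta$. LOO calls are counted per agent over the whole horizon.
   Formalization: Second largest eigenvalue is taken in modulus (swapping two agents breaks the signed claim); f is assumed smooth and Lipschitz on a convex set containing the cube and all query points, as queries leave the cube; the constant is stated per sample space type. *)

theory Defs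
  imports "HOL-Probability.Probability"
begin

section \<open>Objective functions\<close>

abbreviation unit_cube :: "(real^'d) set" where
  "unit_cube \<equiv> cbox 0 1"

definition gradient_on :: "(real^'d) set \<Rightarrow> (real^'d \<Rightarrow> real) \<Rightarrow> real^'d \<Rightarrow> real^'d" where
  "gradient_on S f x = (\<chi> i. frechet_derivative f (at x within S) (axis i 1))"

definition weakly_up_concave :: "real \<Rightarrow> (real^'d \<Rightarrow> real) \<Rightarrow> bool" where
  "weakly_up_concave \<gamma> f \<longleftrightarrow>
     f differentiable_on unit_cube \<and>
     (\<forall>x\<in>unit_cube. \<forall>y\<in>unit_cube. x \<le> y \<longrightarrow>
        \<gamma> * (gradient_on unit_cube f y \<bullet> (y - x)) \<le> f y - f x \<and>
        f y - f x \<le> 1 / \<gamma> * (gradient_on unit_cube f x \<bullet> (y - x)))"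

text \<open>The perturbed query points of the algorithm may leave the unit cube (in the monotone case
  they do so with positive probability, since \<open>z x\<close> can be arbitrarily close to the origin).
  The objective functions must have values there for the oracle to answer, so the regularity
  assumptions are stated on a convex set \<open>D\<close> that contains the cube and, below, all possible query
  points; \<open>D\<close> may be the cube itself whenever the queries stay inside. All order-related
  assumptions (sign, monotonicity, up-concavity) concern the cube only.\<close>

definition regular_objectives ::
    "(real^'d) set \<Rightarrow> real \<Rightarrow> real \<Rightarrow> nat \<Rightarrow> (nat \<Rightarrow> 'n \<Rightarrow> real^'d \<Rightarrow> real) \<Rightarrow> bool" where
  "regular_objectives D L1 L2 T f \<longleftrightarrow>
     convex D \<and> unit_cube \<subseteq> D \<and>
     (\<forall>t\<in>{1..T}. \<forall>i.
        continuous_on D (f t i) \<and> f t i differentiable_on D \<and>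
        L1-lipschitz_on D (f t i) \<and> L2-lipschitz_on D (gradient_on D (f t i)))"


section \<open>The two cases\<close>

text \<open>Here \<open>h\<close> maps an iterate to the action that is played, \<open>p\<close> is the density of \<open>z\<close> on
  \<open>[0,1]\<close>, and \<open>w x z\<close> is the unperturbed query point.\<close>

definition monotone_case ::
    "real \<Rightarrow> (real^'d) set \<Rightarrow> nat \<Rightarrow> (nat \<Rightarrow> 'n \<Rightarrow> real^'d \<Rightarrow> real) \<Rightarrow> real \<Rightarrow>
     (real^'d \<Rightarrow> real^'d) \<Rightarrow> (real \<Rightarrow> real) \<Rightarrow> (real^'d \<Rightarrow> real \<Rightarrow> real^'d) \<Rightarrow> bool" where
  "monotone_case \<gamma> K T f \<alpha> h p w \<longleftrightarrow>
     0 < \<gamma> \<and> \<gamma> \<le> 1 \<and> 0 \<in> K \<and>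
     (\<forall>t\<in>{1..T}. \<forall>i. (\<forall>x\<in>unit_cube. 0 \<le> f t i x) \<and> mono_on unit_cube (f t i) \<and>
        weakly_up_concave \<gamma> (f t i)) \<and>
     \<alpha> = 1 - exp (- \<gamma>) \<and>
     h = (\<lambda>x. x) \<and>
     p = (\<lambda>s. \<gamma> * exp (\<gamma> * (s - 1)) / (1 - exp (- \<gamma>))) \<and>
     w = (\<lambda>x z. z *\<^sub>R x)"

definition nonmonotone_case ::
    "real^'d \<Rightarrow> (real^'d) set \<Rightarrow> nat \<Rightarrow> (nat \<Rightarrow> 'n \<Rightarrow> real^'d \<Rightarrow> real) \<Rightarrow> real \<Rightarrow>
     (real^'d \<Rightarrow> real^'d) \<Rightarrow> (real \<Rightarrow> real) \<Rightarrow> (real^'d \<Rightarrow> real \<Rightarrow> real^'d) \<Rightarrow> bool" where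
  "nonmonotone_case u K T f \<alpha> h p w \<longleftrightarrow>
     u \<in> K \<and>
     (\<forall>t\<in>{1..T}. \<forall>i. (\<forall>x\<in>unit_cube. 0 \<le> f t i x) \<and> weakly_up_concave 1 (f t i)) \<and>
     \<alpha> = (1 - infnorm u) / 4 \<and>
     h = (\<lambda>x. (1/2) *\<^sub>R (x + u)) \<and>
     p = (\<lambda>s. 1 / (3 * (1 - s / 2) ^ 3)) \<and>
     w = (\<lambda>x z. (z / 2) *\<^sub>R (x - u) + u)"


section \<open>Feasible set\<close>

definition direction_space :: "(real^'d) set \<Rightarrow> (real^'d) set" where
  "direction_space K = {y - x |y x. y \<in> affine hull K \<and> x \<in> K}"

definition shrunk :: "(real^'d) set \<Rightarrow> real^'d \<Rightarrow> real \<Rightarrow> real \<Rightarrow> (real^'d) set" where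
  "shrunk K c r \<delta> = (\<lambda>x. (1 - \<delta> / r) *\<^sub>R x + (\<delta> / r) *\<^sub>R c) ` K"

definition feasible_set :: "(real^'d) set \<Rightarrow> real^'d \<Rightarrow> real \<Rightarrow> real \<Rightarrow> nat \<Rightarrow> bool" where
  "feasible_set K c r R k \<longleftrightarrow>
     convex K \<and> compact K \<and> K \<subseteq> unit_cube \<and>
     c \<in> rel_interior K \<and> 0 < r \<and> affine hull K \<inter> cball c r \<subseteq> K \<and>
     R = (SUP x\<in>K. norm x) \<and> k = dim (direction_space K)"


section \<open>Network\<close>

definition neighbors :: "('n \<times> 'n) set \<Rightarrow> 'n \<Rightarrow> 'n set" where
  "neighbors E i = {j. (i, j) \<in> E} \<union> {i}"

definition eigenspace :: "real^'n^'n \<Rightarrow> real \<Rightarrow> (real^'n) set" where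
  "eigenspace A l = {x. A *v x = l *\<^sub>R x}"

definition eigenvalues :: "real^'n^'n \<Rightarrow> real multiset" where
  "eigenvalues A =
     (\<Sum>l\<in>{l. eigenspace A l \<noteq> {0}}. replicate_mset (dim (eigenspace A l)) l)"

text \<open>Eigenvalues are ranked by modulus, as usual for gossip matrices: one copy of the top
  eigenvalue \<open>1\<close> is removed and the largest remaining modulus is taken. The signed ranking would
  admit the swap matrix of two agents (eigenvalues \<open>1\<close> and \<open>-1\<close>), under which the agents never
  reach consensus. With a single agent nothing remains and the value is \<open>0\<close>.\<close>

definition second_eigenvalue :: "real^'n^'n \<Rightarrow> real" where
  "second_eigenvalue A = Max (insert 0 (abs ` set_mset (eigenvalues A - {#1#})))"

definition network :: "('n \<times> 'n) set \<Rightarrow> real^'n^'n \<Rightarrow> real \<Rightarrow> bool" where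
  "network E A lam \<longleftrightarrow>
     sym E \<and>
     (\<forall>i j. 0 \<le> A $ i $ j) \<and>
     (\<forall>i j. 0 < A $ i $ j \<longrightarrow> (i, j) \<in> E \<or> i = j) \<and>
     transpose A = A \<and>
     (\<forall>i. (\<Sum>j\<in>UNIV. A $ i $ j) = 1) \<and> (\<forall>j. (\<Sum>i\<in>UNIV. A $ i $ j) = 1) \<and>
     second_eigenvalue A = lam"


section \<open>Linear optimization and infeasible projection oracles\<close>

definition is_LOO :: "(real^'d) set \<Rightarrow> (real^'d \<Rightarrow> real^'d) \<Rightarrow> bool" where
  "is_LOO S L \<longleftrightarrow> (\<forall>x. L x \<in> S \<and> (\<forall>u\<in>S. x \<bullet> u \<le> x \<bullet> L x))"

text \<open>A procedure with access to a linear optimization oracle, as a decision tree: it either stops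
  with a pair of points or calls the oracle and continues depending on the answer.\<close>

datatype 'v loo_proc = Return 'v 'v | Call 'v "'v \<Rightarrow> 'v loo_proc"

primrec result :: "('v \<Rightarrow> 'v) \<Rightarrow> 'v loo_proc \<Rightarrow> 'v \<times> 'v" where
  "result L (Return x y) = (x, y)"
| "result L (Call q g) = result L (g (L q))"

primrec calls :: "('v \<Rightarrow> 'v) \<Rightarrow> 'v loo_proc \<Rightarrow> nat" where
  "calls L (Return x y) = 0"
| "calls L (Call q g) = Suc (calls L (g (L q)))"

text \<open>The natural-number truncation \<open>nat\<close> matters only for large \<open>\<epsilon>\<close>, where the stated number
  of calls is negative (and no call is needed).\<close>

definition infeasible_projection ::
    "real \<Rightarrow> (real^'d) set \<Rightarrow> real \<Rightarrow> (real^'d \<Rightarrow> real^'d) \<Rightarrow>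
     (real^'d \<Rightarrow> real^'d \<Rightarrow> (real^'d) loo_proc) \<Rightarrow> bool" where
  "infeasible_projection R S \<epsilon> L P \<longleftrightarrow>
     (\<forall>x0\<in>S. \<forall>y0 x y. result L (P x0 y0) = (x, y) \<longrightarrow>
        x \<in> S \<and> norm y \<le> R \<and> (norm (x - y))\<^sup>2 \<le> 3 * \<epsilon> \<and>
        (\<forall>z\<in>S. (norm (y - z))\<^sup>2 \<le> (norm (y0 - z))\<^sup>2) \<and>
        real (calls L (P x0 y0)) \<le>
          real (nat \<lceil>27 * R\<^sup>2 / \<epsilon> - 2\<rceil>) *
          max 1 ((norm (x0 - y0))\<^sup>2 * ((norm (x0 - y0))\<^sup>2 - \<epsilon>) / (4 * \<epsilon>\<^sup>2) + 1))"


section \<open>Algorithm\<close>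

record 'v agent =
  iterate :: 'v
  aux :: 'v
  loo_count :: nat
  comm_count :: nat

text \<open>\<open>agents \<dots> v q m i\<close> is the state of agent \<open>i\<close> after \<open>m\<close> blocks (so \<open>iterate\<close> and \<open>aux\<close> are
  the points used in block \<open>m + 1\<close>) when the sampled directions are \<open>v t i\<close> and the oracle
  responses are \<open>q t i\<close>. The state also counts the oracle calls and communications made so far.\<close>

primrec agents ::
    "('n::finite \<times> 'n) set \<Rightarrow> real^'n^'n \<Rightarrow> real^'d \<Rightarrow> nat \<Rightarrow> nat \<Rightarrow> real \<Rightarrow> real \<Rightarrow>
     (real^'d \<Rightarrow> real^'d) \<Rightarrow> (real^'d \<Rightarrow> real^'d \<Rightarrow> (real^'d) loo_proc) \<Rightarrow>
     (nat \<Rightarrow> 'n \<Rightarrow> real^'d) \<Rightarrow> (nat \<Rightarrow> 'n \<Rightarrow> real) \<Rightarrow> nat \<Rightarrow> 'n \<Rightarrow> (real^'d) agent" where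
  "agents E A c k b \<eta> \<delta> L P v q 0 =
     (\<lambda>i. \<lparr>iterate = c, aux = c, loo_count = 0, comm_count = 0\<rparr>)"
| "agents E A c k b \<eta> \<delta> L P v q (Suc m) =
     (\<lambda>i. let s = agents E A c k b \<eta> \<delta> L P v q m;
              x0 = (\<Sum>j\<in>neighbors E i. A $ i $ j *\<^sub>R iterate (s j));
              y = (\<Sum>j\<in>neighbors E i. A $ i $ j *\<^sub>R aux (s j)) +
                  \<eta> *\<^sub>R (\<Sum>t\<in>{m * b + 1..Suc m * b}. (real k / \<delta> * q t i) *\<^sub>R v t i)
          in \<lparr>iterate = fst (result L (P x0 y)),
              aux = snd (result L (P x0 y)),
              loo_count = loo_count (s i) + calls L (P x0 y),
              comm_count = comm_count (s i) + 1\<rparr>)"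

definition regret ::
    "real \<Rightarrow> (real^'d) set \<Rightarrow> nat \<Rightarrow> (nat \<Rightarrow> 'n::finite \<Rightarrow> real^'d \<Rightarrow> real) \<Rightarrow>
     (nat \<Rightarrow> real^'d) \<Rightarrow> real" where
  "regret \<alpha> K T f a =
     \<alpha> * (SUP u\<in>K. 1 / real CARD('n) * (\<Sum>t=1..T. \<Sum>j\<in>UNIV. f t j u)) -
     1 / real CARD('n) * (\<Sum>t=1..T. \<Sum>j\<in>UNIV. f t j (a t))"


section \<open>Randomness\<close>

text \<open>The uniform distribution on the unit sphere of a subspace \<open>V\<close> is the unique probability
  measure on that sphere that is invariant under the isometries of \<open>V\<close> (each of which extends to an
  orthogonal transformation of the whole space).\<close>

definition uniform_on_sphere :: "(real^'d) set \<Rightarrow> (real^'d) measure \<Rightarrow> bool" where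
  "uniform_on_sphere V \<mu> \<longleftrightarrow>
     prob_space \<mu> \<and> sets \<mu> = sets borel \<and> (AE x in \<mu>. x \<in> sphere 0 1 \<inter> V) \<and>
     (\<forall>U. orthogonal_transformation U \<and> U ` V = V \<longrightarrow> distr \<mu> borel U = \<mu>)"

text \<open>\<open>F t\<close> is the information available after round \<open>t\<close>, and \<open>G t\<close> the information available in
  round \<open>t\<close> after the sampling and before the oracle responses; \<open>s m i \<omega>\<close> is the state of agent \<open>i\<close>
  after \<open>m\<close> blocks, so round \<open>t\<close> uses \<open>s ((t - 1) div b)\<close>. The samples of a round are fresh, and
  given everything that happened before, a response has the objective value at the query point as
  its mean.\<close>

definition stochastic_run ::
    "'w measure \<Rightarrow> (nat \<Rightarrow> 'w measure) \<Rightarrow> (nat \<Rightarrow> 'w measure) \<Rightarrow> nat \<Rightarrow> nat \<Rightarrow> real \<Rightarrow> real \<Rightarrow>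
     (real^'d) set \<Rightarrow> (real \<Rightarrow> real) \<Rightarrow> (real^'d \<Rightarrow> real \<Rightarrow> real^'d) \<Rightarrow>
     (nat \<Rightarrow> 'n::finite \<Rightarrow> real^'d \<Rightarrow> real) \<Rightarrow> (nat \<Rightarrow> 'n \<Rightarrow> 'w \<Rightarrow> (real^'d) agent) \<Rightarrow>
     (nat \<Rightarrow> 'n \<Rightarrow> 'w \<Rightarrow> real^'d) \<Rightarrow> (nat \<Rightarrow> 'n \<Rightarrow> 'w \<Rightarrow> real) \<Rightarrow>
     (nat \<Rightarrow> 'n \<Rightarrow> 'w \<Rightarrow> real) \<Rightarrow> bool" where
  "stochastic_run M F G T b \<delta> B0 V p w f s v z q \<longleftrightarrow>
     prob_space M \<and>
     (\<forall>t. subalgebra M (F t)) \<and>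
     (\<forall>t\<in>{1..T}. subalgebra (G t) (F (t - 1)) \<and> subalgebra (F t) (G t) \<and>
        prob_space.indep_sets M
          (case_option (sets (F (t - 1)))
             (\<lambda>i. {(\<lambda>\<omega>. (v t i \<omega>, z t i \<omega>)) -` B \<inter> space M |B. B \<in> sets borel}))
          UNIV) \<and>
     (\<forall>t\<in>{1..T}. \<forall>i.
        iterate \<circ> s ((t - 1) div b) i \<in> borel_measurable (F (t - 1)) \<and>
        aux \<circ> s ((t - 1) div b) i \<in> borel_measurable (F (t - 1)) \<and>
        v t i \<in> borel_measurable (G t) \<and>
        (\<forall>\<omega>\<in>space M. v t i \<omega> \<in> sphere 0 1 \<inter> V) \<and>
        uniform_on_sphere V (distr M borel (v t i)) \<and>
        z t i \<in> borel_measurable (G t) \<and>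
        (\<forall>\<omega>\<in>space M. z t i \<omega> \<in> {0..1}) \<and>
        distributed M lborel (z t i) (\<lambda>x. ennreal (p x * indicator {0..1} x)) \<and>
        prob_space.indep_set M {v t i -` B \<inter> space M |B. B \<in> sets borel}
          {z t i -` B \<inter> space M |B. B \<in> sets borel} \<and>
        q t i \<in> borel_measurable (F t) \<and>
        (\<forall>\<omega>\<in>space M. \<bar>q t i \<omega>\<bar> \<le> B0) \<and>
        (AE \<omega> in M. real_cond_exp M (G t) (q t i) \<omega> =
           f t i (w (iterate (s ((t - 1) div b) i \<omega>)) (z t i \<omega>) + \<delta> *\<^sub>R v t i \<omega>)))"

end

theory Submission
  imports Defs
begin

text \<open>
  Four observations give the bound.

  \<^item> \<^emph>\<open>It suffices to control a linear regret.\<close> In both cases the gap \<open>\<alpha> f u - f (h x)\<close> is at most a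
    constant times the expectation, over the auxiliary random number \<open>z\<close>, of the inner product of
    \<open>u - x\<close> with the gradient of \<open>f\<close> at \<open>w x z\<close>: for the given density of \<open>z\<close>, a pointwise lower bound
    of the integrand is a total derivative (\<open>monotone_linearization\<close>, \<open>nonmonotone_linearization\<close>).

  \<^item> \<^emph>\<open>The one-point estimate is the gradient up to an error \<open>O(\<delta>)\<close>.\<close> Expand \<open>f (w + \<delta> v)\<close> to first
    order at \<open>w\<close> and multiply by \<open>(k / \<delta>) v\<close>. The constant term has mean zero because \<open>v\<close> has; the
    linear term has as its mean the component of the gradient along the affine hull of \<open>K\<close>, because
    the covariance of \<open>v\<close> is \<open>1 / k\<close> times the projection onto the directions of that hull;
    smoothness bounds the remainder (\<open>sphere_second_moment\<close>, \<open>one_round_estimate\<close>).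

  \<^item> \<^emph>\<open>The iteration behaves like projected gradient descent on every sample path.\<close> The infeasible
    projection does not increase the distance to points of the shrunk set, and doubly stochastic
    averaging does not increase the sum of the squared distances, so these sums telescope. This
    leaves \<open>1 / \<eta>\<close> from the start and \<open>\<eta> T b / \<delta>\<^sup>2\<close> from the squared block gradients
    (\<open>energy_step\<close>, \<open>linear_regret\<close>).

  \<^item> \<^emph>\<open>All displacements in a block are of the order of the square root of \<open>\<epsilon>\<close>, which is \<open>b \<eta> / \<delta>\<close>.\<close> This is the
    length of a block gradient step, and also the accuracy of the projection. Averaging contracts
    deviations from the mean by the second eigenvalue, so the agents stay within this order of
    each other (\<open>gossip_contraction\<close>, \<open>consensus\<close>), and exchanging the iterate of one agent for that
    of another costs no more than the terms above. For the same reason the two arguments of the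
    projection are this close, so one block needs \<open>O(1 / \<epsilon>)\<close> calls (\<open>calls_bound\<close>).

  Finally the best fixed action is moved into the shrunk set, which costs \<open>O(\<delta>)\<close> in each round.
\<close>


section \<open>Gossip averaging contracts disagreement\<close>

lemma symmetric_matrix_inner:
  fixes A :: "real^'n^'n"
  assumes "transpose A = A"
  shows "(A *v x) \<bullet> y = x \<bullet> (A *v y)"
  using assms by (metis dot_lmul_matrix vector_transpose_matrix)

text \<open>A sum over an infinite set is \<open>0\<close>, so \<open>eigenvalues\<close> records multiplicities only because of this
  lemma. Eigenvectors of distinct eigenvalues of a symmetric matrix are orthogonal, hence finite in number.\<close>

lemma finite_real_eigenvalues:
  fixes A :: "real^'n^'n"
  assumes sym: "transpose A = A"
  shows "finite {l. eigenspace A l \<noteq> {0}}"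
proof -
  let ?S = "{l. eigenspace A l \<noteq> {0}}"
  have "\<exists>x. x \<noteq> 0 \<and> A *v x = l *\<^sub>R x" if "l \<in> ?S" for l
    using that unfolding eigenspace_def by (auto simp: set_eq_iff)
  then obtain g where g: "\<And>l. l \<in> ?S \<Longrightarrow> g l \<noteq> 0 \<and> A *v g l = l *\<^sub>R g l"
    by metis
  have orth: "g l \<bullet> g m = 0" if "l \<in> ?S" "m \<in> ?S" "l \<noteq> m" for l m
  proof -
    have "l * (g l \<bullet> g m) = m * (g l \<bullet> g m)"
      using symmetric_matrix_inner[OF sym, of "g l" "g m"] g[OF that(1)] g[OF that(2)] by simp
    then show ?thesis using that(3) by simp
  qed
  have "inj_on g ?S"
    using orth g by (intro inj_onI) (metis inner_eq_zero_iff)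
  moreover have "pairwise orthogonal (g ` ?S)"
    using orth by (auto simp: pairwise_def orthogonal_def)
  then have "finite (g ` ?S)"
    using pairwise_orthogonal_imp_finite by blast
  ultimately show ?thesis using finite_image_iff by blast
qed

lemma ones_eigenvector:
  fixes A :: "real^'n^'n"
  assumes "\<And>i. (\<Sum>j\<in>UNIV. A $ i $ j) = 1"
  shows "A *v 1 = 1"
  using assms by (simp add: vec_eq_iff matrix_vector_mult_def)

text \<open>The copy of the eigenvalue \<open>1\<close> that \<open>second_eigenvalue\<close> removes is accounted for by the vector of
  ones. An eigenvector orthogonal to it belongs to a copy that remains: for \<open>\<mu> = 1\<close> the eigenspace
  then has dimension at least two.\<close>

lemma eigenvalue_bound_orthogonal_ones:
  fixes A :: "real^'n^'n"
  assumes sym: "transpose A = A" and row: "\<And>i. (\<Sum>j\<in>UNIV. A $ i $ j) = 1"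
    and w: "w \<noteq> 0" "w \<bullet> 1 = 0" "A *v w = \<mu> *\<^sub>R w"
  shows "\<bar>\<mu>\<bar> \<le> second_eigenvalue A"
proof -
  let ?S = "{l. eigenspace A l \<noteq> {0}}"
  have fin: "finite ?S" by (rule finite_real_eigenvalues[OF sym])
  have cnt: "count (eigenvalues A) l = (if l \<in> ?S then dim (eigenspace A l) else 0)" for l
    unfolding eigenvalues_def count_sum count_replicate_mset
    using fin by (simp add: eq_commute[of l])
  have mem: "w \<in> eigenspace A \<mu>" using w(3) by (simp add: eigenspace_def)
  have inS: "\<mu> \<in> ?S" using mem w(1) by auto
  have sub: "subspace (eigenspace A l)" for l
    unfolding eigenspace_def subspace_def
    by (auto simp: matrix_vector_right_distrib scaleR_right_distrib matrix_vector_mult_scaleR)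
  have key: "\<mu> \<in># eigenvalues A - {#1#}"
  proof (cases "\<mu> = 1")
    case False
    have "dim (eigenspace A \<mu>) \<noteq> 0"
      using inS mem w(1) dim_eq_0 by auto
    then have "0 < dim (eigenspace A \<mu>)" by (rule neq0_conv[THEN iffD1])
    then show ?thesis
      using False inS cnt[of \<mu>] by (simp add: count_greater_zero_iff[symmetric] del: count_greater_zero_iff)
  next
    case True
    have "{1, w} \<subseteq> eigenspace A \<mu>"
      using mem ones_eigenvector[OF row] True by (auto simp: eigenspace_def)
    moreover have "independent {1, w}"
    proof (rule pairwise_orthogonal_independent)
      show "pairwise orthogonal {1, w}"
        using w(2) by (auto simp: pairwise_def orthogonal_def inner_commute)
      show "0 \<notin> {1, w}" using w(1) by (simp add: vec_eq_iff)
    qed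
    moreover have "card {1, w} = 2"
    proof -
      have "(1::real^'n) \<bullet> 1 \<noteq> 0" by (simp add: inner_eq_zero_iff vec_eq_iff)
      then have "1 \<noteq> w" using w(2) by auto
      then show ?thesis by simp
    qed
    ultimately have "dim (eigenspace A \<mu>) \<ge> 2"
      by (metis independent_card_le_dim)
    then show ?thesis
      using inS cnt[of \<mu>] True by (simp add: count_greater_zero_iff[symmetric] del: count_greater_zero_iff)
  qed
  then show ?thesis
    unfolding second_eigenvalue_def by (intro Max_ge) auto
qed

lemma second_eigenvalue_nonneg: "0 \<le> second_eigenvalue A"
  unfolding second_eigenvalue_def by (intro Max_ge) auto

lemma orthogonal_ones_iff: "(x::real^'n) \<bullet> 1 = (\<Sum>i\<in>UNIV. x $ i)"
  by (simp add: inner_vec_def)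

text \<open>A direct argument in place of diagonalization. Let \<open>\<sigma>\<close> be the maximum of \<open>norm (A *v x)\<close> over unit
  vectors orthogonal to the ones, attained at \<open>x\<close>. Then \<open>A\<^sup>2 x\<close> has norm at most \<open>\<sigma>\<^sup>2\<close> and inner
  product \<open>\<sigma>\<^sup>2\<close> with \<open>x\<close>, which forces \<open>A\<^sup>2 x = \<sigma>\<^sup>2 x\<close>. Hence \<open>A x + \<sigma> x\<close> is an eigenvector for \<open>\<sigma>\<close>, or it
  vanishes and \<open>x\<close> is one for \<open>-\<sigma>\<close>.\<close>

lemma gossip_contraction:
  fixes A :: "real^'n^'n"
  assumes sym: "transpose A = A" and row: "\<And>i. (\<Sum>j\<in>UNIV. A $ i $ j) = 1"
    and u: "u \<bullet> 1 = 0"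
  shows "norm (A *v u) \<le> second_eigenvalue A * norm u"
proof -
  let ?S = "{x::real^'n. x \<bullet> 1 = 0}"
  have Sinv: "A *v x \<in> ?S" if "x \<in> ?S" for x
    using that symmetric_matrix_inner[OF sym, of x 1] ones_eigenvector[OF row] by simp
  let ?B = "?S \<inter> sphere 0 1"
  show ?thesis
  proof (cases "u = 0")
    case True then show ?thesis by simp
  next
    case False
    have "(1 / norm u) *\<^sub>R u \<in> ?B" using False u by simp
    moreover have "compact ?B"
      using closed_hyperplane[of "1::real^'n" 0]
      by (intro closed_Int_compact compact_sphere) (simp add: inner_commute)
    moreover have "continuous_on ?B (\<lambda>x. norm (A *v x))"
      by (intro continuous_on_norm linear_continuous_on matrix_vector_mul_bounded_linear)
    ultimately have "\<exists>x\<in>?B. \<forall>y\<in>?B. norm (A *v y) \<le> norm (A *v x)"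
      by (intro continuous_attains_sup) blast+
    then obtain x where x: "x \<in> ?B" and max: "\<And>y. y \<in> ?B \<Longrightarrow> norm (A *v y) \<le> norm (A *v x)"
      by blast
    define \<sigma> where "\<sigma> = norm (A *v x)"
    have \<sigma>0: "0 \<le> \<sigma>" by (simp add: \<sigma>_def)
    (* By homogeneity the maximum over the unit sphere bounds the whole subspace. *)
    have bound: "norm (A *v y) \<le> \<sigma> * norm y" if "y \<in> ?S" for y
    proof (cases "y = 0")
      case False
      then have "norm (A *v ((1 / norm y) *\<^sub>R y)) \<le> \<sigma>"
        unfolding \<sigma>_def using that by (intro max) auto
      then show ?thesis using False by (simp add: matrix_vector_mult_scaleR field_simps)
    qed simp
    have xS: "x \<in> ?S" and nx: "norm x = 1" using x by auto
    have "norm (A *v (A *v x)) \<le> \<sigma>\<^sup>2"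
      using bound[OF Sinv[OF xS]] by (simp add: \<sigma>_def power2_eq_square)
    then have "(norm (A *v (A *v x)))\<^sup>2 \<le> \<sigma>^4"
      using power_mono[of "norm (A *v (A *v x))" "\<sigma>\<^sup>2" 2] by simp
    moreover have "(A *v (A *v x)) \<bullet> x = \<sigma>\<^sup>2"
      using symmetric_matrix_inner[OF sym, of "A *v x" x] by (simp add: \<sigma>_def power2_norm_eq_inner)
    moreover have "(norm (A *v (A *v x) - \<sigma>\<^sup>2 *\<^sub>R x))\<^sup>2 =
      (norm (A *v (A *v x)))\<^sup>2 - 2 * \<sigma>\<^sup>2 * ((A *v (A *v x)) \<bullet> x) + \<sigma>^4 * (norm x)\<^sup>2"
      unfolding power2_norm_eq_inner by (simp add: inner_diff inner_commute power2_eq_square power4_eq_xxxx)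
    ultimately have "(norm (A *v (A *v x) - \<sigma>\<^sup>2 *\<^sub>R x))\<^sup>2 \<le> 0"
      using nx by (simp add: power2_eq_square power4_eq_xxxx)
    then have AA: "A *v (A *v x) = \<sigma>\<^sup>2 *\<^sub>R x" by simp
    define w where "w = A *v x + \<sigma> *\<^sub>R x"
    have "\<sigma> \<le> second_eigenvalue A"
    proof (cases "w = 0")
      case True
      then have "A *v x = (-\<sigma>) *\<^sub>R x" by (simp add: w_def eq_neg_iff_add_eq_0)
      moreover have "x \<noteq> 0" using nx by auto
      ultimately show ?thesis
        using eigenvalue_bound_orthogonal_ones[OF sym row, of x "-\<sigma>"] xS \<sigma>0 by auto
    next
      case False
      have "A *v w = \<sigma> *\<^sub>R w"
        by (simp add: w_def AA matrix_vector_right_distrib matrix_vector_mult_scaleR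
             scaleR_right_distrib power2_eq_square)
      moreover have "w \<bullet> 1 = 0" using Sinv[OF xS] xS by (simp add: w_def inner_left_distrib)
      ultimately show ?thesis
        using eigenvalue_bound_orthogonal_ones[OF sym row False, of \<sigma>] by auto
    qed
    then show ?thesis
      using bound[of u] u by (metis (mono_tags, lifting) mem_Collect_eq mult_right_mono norm_ge_zero order_trans)
  qed
qed

text \<open>The norm of a family of vectors is the Frobenius norm, so the scalar contraction applies to each
  coordinate separately.\<close>

lemma gossip_contraction_vectors:
  fixes A :: "real^'n^'n" and X :: "(real^'d)^'n"
  assumes sym: "transpose A = A" and row: "\<And>i. (\<Sum>j\<in>UNIV. A $ i $ j) = 1"
    and X: "(\<Sum>i\<in>UNIV. X $ i) = 0"
  shows "norm (\<chi> i. \<Sum>j\<in>UNIV. A $ i $ j *\<^sub>R X $ j) \<le> second_eigenvalue A * norm X"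
proof -
  let ?l = "second_eigenvalue A"
  have frob: "(norm Y)\<^sup>2 = (\<Sum>l\<in>UNIV. (norm (\<chi> i. Y $ i $ l))\<^sup>2)" for Y :: "(real^'d)^'n"
    unfolding power2_norm_eq_inner inner_vec_def by (simp, rule sum.swap)
  let ?Y = "\<chi> i. \<Sum>j\<in>UNIV. A $ i $ j *\<^sub>R X $ j"
  have "(norm ?Y)\<^sup>2 = (\<Sum>l\<in>UNIV. (norm (A *v (\<chi> i. X $ i $ l)))\<^sup>2)"
    unfolding frob by (simp add: matrix_vector_mult_def)
  also have "\<dots> \<le> (\<Sum>l\<in>UNIV. (?l * norm (\<chi> i. X $ i $ l))\<^sup>2)"
  proof (intro sum_mono power_mono gossip_contraction[OF sym row] norm_ge_zero)
    fix l
    have "(\<Sum>i\<in>UNIV. X $ i) $ l = 0" by (simp add: X)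
    then show "(\<chi> i. X $ i $ l) \<bullet> 1 = 0" by (simp add: orthogonal_ones_iff)
  qed
  also have "\<dots> = (?l * norm X)\<^sup>2"
    by (simp add: frob power_mult_distrib sum_distrib_left)
  finally show ?thesis
    using second_eigenvalue_nonneg[of A] by (auto intro: power2_le_imp_le)
qed

text \<open>Subtracting the average commutes with doubly stochastic averaging and produces families with sum
  zero, on which averaging contracts by a factor \<open>l < 1\<close>. The deviation from the average thus starts
  at \<open>0\<close> and grows at most by \<open>d' \<le> l d + n e\<close>, so it never exceeds the fixed point \<open>n e / (1 - l)\<close>; the
  factor \<open>2\<close> comes from comparing two agents through the average.\<close>

lemma consensus:
  fixes A :: "real^'n^'n" and X :: "nat \<Rightarrow> 'n \<Rightarrow> real^'d"
  assumes sym: "transpose A = A" and row: "\<And>i. (\<Sum>j\<in>UNIV. A $ i $ j) = 1"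
    and l1: "second_eigenvalue A < 1"
    and X0: "\<And>i. X 0 i = c"
    and step: "\<And>m i. m < M \<Longrightarrow> norm (X (Suc m) i - (\<Sum>j\<in>UNIV. A $ i $ j *\<^sub>R X m j)) \<le> e"
    and m: "m \<le> M" and e: "0 \<le> e"
  shows "norm (X m i - X m j) \<le> 2 * real CARD('n) * e / (1 - second_eigenvalue A)"
proof -
  let ?l = "second_eigenvalue A"
  define dev :: "(real^'d)^'n \<Rightarrow> (real^'d)^'n" where
    "dev Y = (\<chi> i. Y $ i - (1 / real CARD('n)) *\<^sub>R (\<Sum>j\<in>UNIV. Y $ j))" for Y
  define g :: "(real^'d)^'n \<Rightarrow> (real^'d)^'n" where
    "g Y = (\<chi> i. \<Sum>j\<in>UNIV. A $ i $ j *\<^sub>R Y $ j)" for Y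
  define Z where "Z m = (\<chi> i. X m i)" for m
  have sum_dev: "(\<Sum>i\<in>UNIV. dev Y $ i) = 0" for Y
    by (simp add: dev_def sum_subtractf sum_constant_scaleR del: sum_constant)
  have col: "(\<Sum>i\<in>UNIV. A $ i $ j) = 1" for j
    using row[of j] sym by (metis (no_types, lifting) sum.cong transpose_def vec_lambda_beta)
  have sum_g: "(\<Sum>i\<in>UNIV. g Y $ i) = (\<Sum>i\<in>UNIV. Y $ i)" for Y
    by (simp add: g_def, subst sum.swap) (simp flip: scaleR_sum_left add: col)
  have dev_g: "dev (g Y) = g (dev Y)" for Y
  proof (rule vec_eq_iff[THEN iffD2], rule allI)
    fix i
    show "dev (g Y) $ i = g (dev Y) $ i"
      unfolding dev_def vec_lambda_beta sum_g
      by (simp add: g_def scaleR_diff_right sum_subtractf row flip: scaleR_sum_left sum_divide_distrib)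
  qed
  have dev_add: "dev (Y + Y') = dev Y + dev Y'" for Y Y'
    by (rule vec_eq_iff[THEN iffD2], rule allI) (simp add: dev_def sum.distrib scaleR_add_right)
  have dev_norm: "norm (dev Y) \<le> norm Y" for Y
  proof -
    have "(norm Y)\<^sup>2 = (norm (dev Y))\<^sup>2 + (norm (Y - dev Y))\<^sup>2"
    proof -
      have "dev Y \<bullet> (Y - dev Y) = 0"
      proof -
        let ?a = "(1 / real CARD('n)) *\<^sub>R (\<Sum>j\<in>UNIV. Y $ j)"
        have "dev Y \<bullet> (Y - dev Y) = (\<Sum>i\<in>UNIV. dev Y $ i \<bullet> ?a)"
          unfolding inner_vec_def[of "dev Y"] by (rule sum.cong) (simp_all add: dev_def)
        also have "\<dots> = (\<Sum>i\<in>UNIV. dev Y $ i) \<bullet> ?a" by (rule inner_sum_left[symmetric])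
        finally show ?thesis by (simp add: sum_dev)
      qed
      then show ?thesis
        using norm_add_Pythagorean[of "dev Y" "Y - dev Y"] by (simp add: orthogonal_def)
    qed
    then have "(norm (dev Y))\<^sup>2 \<le> (norm Y)\<^sup>2" by simp
    then show ?thesis by (rule power2_le_imp_le) simp
  qed
  have "norm (dev (Z m)) \<le> real CARD('n) * e / (1 - ?l)"
    using m
  proof (induction m)
    case 0
    have "dev (Z 0) = 0"
      by (rule vec_eq_iff[THEN iffD2], rule allI)
        (simp add: dev_def Z_def X0 sum_constant_scaleR del: sum_constant)
    then show ?case using l1 e by simp
  next
    case (Suc m)
    have "norm (Z (Suc m) - g (Z m)) \<le> (\<Sum>i\<in>UNIV. norm ((Z (Suc m) - g (Z m)) $ i))"
      by (simp add: norm_vec_def L2_set_le_sum)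
    also have "\<dots> \<le> (\<Sum>i::'n\<in>UNIV. e)"
      using step[of m] Suc.prems by (intro sum_mono) (simp add: Z_def g_def)
    finally have 1: "norm (Z (Suc m) - g (Z m)) \<le> real CARD('n) * e" by simp
    have "dev (Z (Suc m)) = g (dev (Z m)) + dev (Z (Suc m) - g (Z m))"
      unfolding dev_g[symmetric] dev_add[symmetric] by simp
    then have "norm (dev (Z (Suc m))) \<le> norm (g (dev (Z m))) + norm (Z (Suc m) - g (Z m))"
      using norm_triangle_ineq[of "g (dev (Z m))" "dev (Z (Suc m) - g (Z m))"]
        dev_norm[of "Z (Suc m) - g (Z m)"] by simp
    also have "norm (g (dev (Z m))) \<le> ?l * norm (dev (Z m))"
      unfolding g_def by (rule gossip_contraction_vectors[OF sym row sum_dev])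
    also have "\<dots> \<le> ?l * (real CARD('n) * e / (1 - ?l))"
      using Suc by (intro mult_left_mono second_eigenvalue_nonneg) auto
    finally have "norm (dev (Z (Suc m))) \<le> ?l * (real CARD('n) * e / (1 - ?l)) + real CARD('n) * e"
      using 1 by linarith
    also have "\<dots> = real CARD('n) * e / (1 - ?l)"
      using l1 by (simp add: field_simps)
    finally show ?case .
  qed
  moreover have "X m i - X m j = dev (Z m) $ i - dev (Z m) $ j"
    by (simp add: dev_def Z_def)
  moreover have "norm (dev (Z m) $ i - dev (Z m) $ j) \<le> norm (dev (Z m)) + norm (dev (Z m))"
    by (rule order_trans[OF norm_triangle_ineq4 add_mono[OF Finite_Cartesian_Product.norm_nth_le Finite_Cartesian_Product.norm_nth_le]])
  ultimately show ?thesis by simp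
qed

section \<open>Moments of the uniform distribution on a sphere\<close>

text \<open>Invariance under these reflections and under \<open>uminus\<close> is all that is used about the isometries of
  a uniform distribution on a sphere.\<close>

lemma reflection_on_subspace:
  fixes V :: "(real^'d) set" and n :: "real^'d"
  assumes V: "subspace V" and n: "n \<in> V"
  defines "U \<equiv> \<lambda>x. x - (2 * (x \<bullet> n) / (n \<bullet> n)) *\<^sub>R n"
  shows "orthogonal_transformation U" "U ` V = V"
proof -
  have lin: "linear U"
    by (rule linearI) (simp_all add: U_def inner_left_distrib algebra_simps add_divide_distrib)
  have "U x \<bullet> U y = x \<bullet> y" for x y
  proof (cases "n = 0")
    case False
    then have c: "n \<bullet> n \<noteq> 0" by simp
    have "U x \<bullet> U y = x \<bullet> y - 2 * (x \<bullet> n) / (n \<bullet> n) * (y \<bullet> n) - 2 * (y \<bullet> n) / (n \<bullet> n) * (x \<bullet> n)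
        + (2 * (x \<bullet> n) / (n \<bullet> n)) * ((2 * (y \<bullet> n) / (n \<bullet> n)) * (n \<bullet> n))"
      unfolding U_def inner_diff_left inner_diff_right inner_scaleR_left inner_scaleR_right
        inner_commute[of n y] by (simp only: right_diff_distrib) simp
    also have "(2 * (y \<bullet> n) / (n \<bullet> n)) * (n \<bullet> n) = 2 * (y \<bullet> n)" using c by simp
    finally show ?thesis by simp
  qed (simp add: U_def)
  with lin show "orthogonal_transformation U" by (simp add: orthogonal_transformation_def)
  have UU: "U (U x) = x" for x
  proof (cases "n = 0")
    case False
    then have "U x \<bullet> n = - (x \<bullet> n)" by (simp add: U_def inner_diff_left)
    moreover have "U (U x) = U x - (2 * (U x \<bullet> n) / (n \<bullet> n)) *\<^sub>R n" by (simp only: U_def)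
    ultimately show ?thesis by (simp add: U_def)
  qed (simp add: U_def)
  have UV: "U x \<in> V" if "x \<in> V" for x
    using that V n by (simp add: U_def subspace_diff subspace_scale)
  show "U ` V = V"
  proof (intro equalityI subsetI)
    show "x \<in> U ` V" if "x \<in> V" for x
      using UU[of x, symmetric] UV[OF that] by (rule image_eqI)
  qed (use UV in auto)
qed

context
  fixes V :: "(real^'d) set" and \<mu> :: "(real^'d) measure"
  assumes V: "subspace V" and \<mu>: "uniform_on_sphere V \<mu>"
begin

interpretation prob_space \<mu> using \<mu> by (simp add: uniform_on_sphere_def)

lemma sphere_sets [measurable_cong]: "sets \<mu> = sets borel"
  using \<mu> by (simp add: uniform_on_sphere_def)

lemma sphere_AE: "AE v in \<mu>. norm v = 1 \<and> v \<in> V"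
  using \<mu> by (auto simp: uniform_on_sphere_def)

lemma sphere_integral_invariant:
  fixes g :: "real^'d \<Rightarrow> real"
  assumes U: "orthogonal_transformation U" "U ` V = V" and [measurable]: "g \<in> borel_measurable borel"
  shows "(\<integral>v. g (U v) \<partial>\<mu>) = (\<integral>v. g v \<partial>\<mu>)"
proof -
  have [measurable]: "U \<in> borel_measurable borel"
    using U(1) by (intro borel_measurable_continuous_onI linear_continuous_on linear_conv_bounded_linear[THEN iffD1])
      (simp add: orthogonal_transformation_def)
  have "(\<integral>v. g v \<partial>\<mu>) = (\<integral>v. g v \<partial>distr \<mu> borel U)"
    using \<mu> U by (simp add: uniform_on_sphere_def)
  also have "\<dots> = (\<integral>v. g (U v) \<partial>\<mu>)"
    by (rule integral_distr) measurable
  finally show ?thesis by simp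
qed

lemma sphere_linear_integrable: "integrable \<mu> (\<lambda>v. a \<bullet> v)"
proof (rule integrable_const_bound[where B="norm a"])
  show "AE v in \<mu>. norm (a \<bullet> v) \<le> norm a"
    using sphere_AE
  proof eventually_elim
    case (elim v) then show ?case using Cauchy_Schwarz_ineq2[of a v] by simp
  qed
qed measurable

lemma sphere_quadratic_integrable: "integrable \<mu> (\<lambda>v. (a \<bullet> v) * (b \<bullet> v))"
proof (rule integrable_const_bound[where B="norm a * norm b"])
  show "AE v in \<mu>. norm (a \<bullet> v * (b \<bullet> v)) \<le> norm a * norm b"
    using sphere_AE
  proof eventually_elim
    case (elim v)
    then have "\<bar>a \<bullet> v\<bar> \<le> norm a" "\<bar>b \<bullet> v\<bar> \<le> norm b"
      using Cauchy_Schwarz_ineq2[of a v] Cauchy_Schwarz_ineq2[of b v] by simp_all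
    then show ?case by (simp add: abs_mult mult_mono)
  qed
qed measurable

lemma sphere_first_moment: "(\<integral>v. a \<bullet> v \<partial>\<mu>) = 0"
proof -
  have "uminus ` V = V"
  proof (intro equalityI subsetI)
    fix x assume "x \<in> V"
    then have "x = - (- x)" "- x \<in> V" using V by (simp_all add: subspace_neg)
    then show "x \<in> uminus ` V" by (rule image_eqI)
  qed (use V subspace_neg in auto)
  moreover have "orthogonal_transformation (uminus :: real^'d \<Rightarrow> _)"
    by (auto simp: orthogonal_transformation_def intro: linearI)
  ultimately have "(\<integral>v. a \<bullet> (- v) \<partial>\<mu>) = (\<integral>v. a \<bullet> v \<partial>\<mu>)"
    by (intro sphere_integral_invariant) measurable
  then show ?thesis by simp
qed

text \<open>The reflection along \<open>a - b\<close> exchanges \<open>a\<close> and \<open>b\<close>.\<close>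

lemma sphere_second_moment_eq:
  assumes a: "a \<in> V" "norm a = 1" and b: "b \<in> V" "norm b = 1"
  shows "(\<integral>v. (a \<bullet> v)\<^sup>2 \<partial>\<mu>) = (\<integral>v. (b \<bullet> v)\<^sup>2 \<partial>\<mu>)"
proof (cases "a = b")
  case False
  let ?n = "a - b"
  let ?U = "\<lambda>x. x - (2 * (x \<bullet> ?n) / (?n \<bullet> ?n)) *\<^sub>R ?n"
  have n: "?n \<in> V" using a b V by (simp add: subspace_diff)
  note U = reflection_on_subspace[OF V n]
  have "a \<bullet> a = 1" "b \<bullet> b = 1" using a b by (simp_all add: norm_eq_1)
  then have *: "2 * (b \<bullet> ?n) = - (?n \<bullet> ?n)" by (simp add: inner_diff inner_commute)
  have "?n \<bullet> ?n \<noteq> 0" using False by simp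
  then have Ub: "?U b = a" unfolding * by simp
  have "a \<bullet> ?U v = b \<bullet> v" for v
  proof -
    have "?U b \<bullet> ?U v = b \<bullet> v" using U(1) by (auto simp: orthogonal_transformation_def)
    then show ?thesis unfolding Ub .
  qed
  then show ?thesis
    using sphere_integral_invariant[OF U, of "\<lambda>v. (a \<bullet> v)\<^sup>2"] by simp
qed simp

text \<open>By symmetry all members of an orthonormal basis of \<open>V\<close> have the same second moment, and these
  moments add up to the mean of \<open>(norm v)\<^sup>2 = 1\<close>.\<close>

lemma sphere_second_moment_unit:
  assumes a: "a \<in> V" "norm a = 1"
  shows "real (dim V) * (\<integral>v. (a \<bullet> v)\<^sup>2 \<partial>\<mu>) = 1"
proof -
  obtain B where B: "B \<subseteq> V" "pairwise orthogonal B" "\<forall>x\<in>B. norm x = 1"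
    "independent B" "card B = dim V" "span B = V"
    by (rule orthonormal_basis_subspace[OF V]) blast
  have finB: "finite B" using B(4) independent_imp_finite by blast
  have parseval: "(\<Sum>e\<in>B. (e \<bullet> v)\<^sup>2) = (norm v)\<^sup>2" if "v \<in> V" for v
  proof -
    have v: "v \<in> span B" using that B by simp
    have "(norm v)\<^sup>2 = v \<bullet> (\<Sum>e\<in>B. (v \<bullet> e) *\<^sub>R e)"
      using orthonormal_basis_expand[OF B(2) _ v finB] B(3) by (simp add: power2_norm_eq_inner)
    also have "\<dots> = (\<Sum>e\<in>B. (e \<bullet> v)\<^sup>2)"
      by (simp add: inner_sum_right power2_eq_square inner_commute)
    finally show ?thesis by simp
  qed
  have *: "AE v in \<mu>. (\<Sum>e\<in>B. (e \<bullet> v)\<^sup>2) = 1"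
    using sphere_AE by eventually_elim (simp add: parseval)
  have "real (dim V) * (\<integral>v. (a \<bullet> v)\<^sup>2 \<partial>\<mu>) = (\<Sum>e\<in>B. \<integral>v. (e \<bullet> v)\<^sup>2 \<partial>\<mu>)"
  proof -
    have "(\<Sum>e\<in>B. \<integral>v. (e \<bullet> v)\<^sup>2 \<partial>\<mu>) = (\<Sum>e\<in>B. \<integral>v. (a \<bullet> v)\<^sup>2 \<partial>\<mu>)"
      using B(1,3) by (intro sum.cong refl sphere_second_moment_eq a) auto
    then show ?thesis using B(5) by simp
  qed
  also have "\<dots> = (\<integral>v. (\<Sum>e\<in>B. (e \<bullet> v)\<^sup>2) \<partial>\<mu>)"
    using sphere_quadratic_integrable by (intro Bochner_Integration.integral_sum[symmetric]) (simp add: power2_eq_square)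
  also have "\<dots> = (\<integral>v. 1 \<partial>\<mu>)"
    by (rule integral_cong_AE[OF _ _ *]) measurable
  finally show ?thesis by (simp add: prob_space)
qed

lemma sphere_second_moment_norm:
  assumes a: "a \<in> V"
  shows "real (dim V) * (\<integral>v. (a \<bullet> v)\<^sup>2 \<partial>\<mu>) = (norm a)\<^sup>2"
proof (cases "a = 0")
  case False
  let ?e = "(1 / norm a) *\<^sub>R a"
  have "real (dim V) * (\<integral>v. (?e \<bullet> v)\<^sup>2 \<partial>\<mu>) = 1"
    using False a V by (intro sphere_second_moment_unit) (auto simp: subspace_scale)
  moreover have "(?e \<bullet> v)\<^sup>2 = (a \<bullet> v)\<^sup>2 / (norm a)\<^sup>2" for v by (simp add: power_divide)
  ultimately show ?thesis using False by (simp add: field_simps)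
qed simp

text \<open>The covariance of the uniform distribution is \<open>1 / dim V\<close> times the orthogonal projection onto \<open>V\<close>:
  polarize the second moments, and note that \<open>v\<close> does not see the part of \<open>g\<close> orthogonal to \<open>V\<close>. This is
  what makes the one-point estimate an estimate of the gradient.\<close>

lemma sphere_second_moment:
  assumes a: "a \<in> V"
  shows "real (dim V) * (\<integral>v. (g \<bullet> v) * (a \<bullet> v) \<partial>\<mu>) = g \<bullet> a"
proof -
  obtain y z where y: "y \<in> V" and z: "\<And>w. w \<in> V \<Longrightarrow> orthogonal z w" and g: "g = y + z"
    using orthogonal_subspace_decomp_exists[of V g] unfolding span_eq_iff[THEN iffD2, OF V] by blast
  have zv: "z \<bullet> v = 0" if "v \<in> V" for v using z[OF that] by (simp add: orthogonal_def)
  have I: "integrable \<mu> (\<lambda>v. (c \<bullet> v)\<^sup>2)" for c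
    using sphere_quadratic_integrable[of c c] by (simp add: power2_eq_square)
  have "(\<integral>v. (g \<bullet> v) * (a \<bullet> v) \<partial>\<mu>) =
      (\<integral>v. (((y + a) \<bullet> v)\<^sup>2 - (y \<bullet> v)\<^sup>2 - (a \<bullet> v)\<^sup>2) / 2 \<partial>\<mu>)"
  proof (rule integral_cong_AE)
    show "AE v in \<mu>. g \<bullet> v * (a \<bullet> v) = (((y + a) \<bullet> v)\<^sup>2 - (y \<bullet> v)\<^sup>2 - (a \<bullet> v)\<^sup>2) / 2"
      using sphere_AE
    proof eventually_elim
      case (elim v)
      then show ?case by (simp add: g inner_left_distrib zv power2_sum)
    qed
  qed measurable
  also have "\<dots> = ((\<integral>v. ((y + a) \<bullet> v)\<^sup>2 \<partial>\<mu>) - (\<integral>v. (y \<bullet> v)\<^sup>2 \<partial>\<mu>) - (\<integral>v. (a \<bullet> v)\<^sup>2 \<partial>\<mu>)) / 2"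
    using I by simp
  finally have "real (dim V) * (\<integral>v. (g \<bullet> v) * (a \<bullet> v) \<partial>\<mu>) =
      (real (dim V) * (\<integral>v. ((y + a) \<bullet> v)\<^sup>2 \<partial>\<mu>) - real (dim V) * (\<integral>v. (y \<bullet> v)\<^sup>2 \<partial>\<mu>)
        - real (dim V) * (\<integral>v. (a \<bullet> v)\<^sup>2 \<partial>\<mu>)) / 2"
    by (simp only: right_diff_distrib times_divide_eq_right)
  also have "\<dots> = ((norm (y + a))\<^sup>2 - (norm y)\<^sup>2 - (norm a)\<^sup>2) / 2"
    using y a V by (simp add: sphere_second_moment_norm subspace_add)
  also have "\<dots> = y \<bullet> a" by (simp add: power2_norm_eq_inner inner_add inner_commute)
  also have "\<dots> = g \<bullet> a" by (simp add: g inner_left_distrib zv a)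
  finally show ?thesis .
qed

end

section \<open>Gradients relative to convex sets\<close>

lemma gradient_on_derivative:
  fixes f :: "real^'d \<Rightarrow> real"
  assumes "f differentiable (at x within S)"
  shows "(f has_derivative (\<lambda>h. gradient_on S f x \<bullet> h)) (at x within S)"
proof -
  let ?F = "frechet_derivative f (at x within S)"
  have der: "(f has_derivative ?F) (at x within S)"
    using assms frechet_derivative_works by blast
  then have lin: "linear ?F" by (rule has_derivative_linear)
  have "?F h = gradient_on S f x \<bullet> h" for h
  proof -
    have "?F h = ?F (\<Sum>i\<in>UNIV. h $ i *\<^sub>R axis i 1)"
      by (simp flip: scalar_mult_eq_scaleR add: basis_expansion)
    also have "\<dots> = gradient_on S f x \<bullet> h"
      by (simp add: linear_sum[OF lin] linear_scale[OF lin] gradient_on_def inner_vec_def mult.commute)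
    finally show ?thesis .
  qed
  then have "?F = (\<lambda>h. gradient_on S f x \<bullet> h)" by (rule ext)
  with der show ?thesis by simp
qed

text \<open>At every point of the cube each coordinate direction, or its opposite, can be followed inside the
  cube. So the derivative within the cube is unique, and the derivative within a larger set is one.\<close>

lemma gradient_on_cube:
  fixes f :: "real^'d \<Rightarrow> real"
  assumes "f differentiable_on D" "unit_cube \<subseteq> D" "x \<in> unit_cube"
  shows "gradient_on unit_cube f x = gradient_on D f x"
proof -
  have dD: "f differentiable (at x within D)"
    using assms by (auto simp: differentiable_on_def)
  then have dC: "f differentiable (at x within unit_cube)"
    using assms(2) differentiable_within_subset by blast
  have "(\<lambda>h. gradient_on unit_cube f x \<bullet> h) = (\<lambda>h. gradient_on D f x \<bullet> h)"
  proof (rule frechet_derivative_unique_within_closed_interval)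
    show "x \<in> cbox 0 1" by fact
    show "(f has_derivative (\<lambda>h. gradient_on unit_cube f x \<bullet> h)) (at x within cbox 0 1)"
      using gradient_on_derivative[OF dC] .
    show "(f has_derivative (\<lambda>h. gradient_on D f x \<bullet> h)) (at x within cbox 0 1)"
      using has_derivative_subset[OF gradient_on_derivative[OF dD] assms(2)] .
  qed (auto simp: Basis_vec_def inner_axis)
  then show ?thesis by (metis vector_eq_rdot)
qed

lemma derivative_along_line:
  fixes f :: "real^'d \<Rightarrow> real"
  assumes f: "f differentiable_on S" and S: "\<And>s. s \<in> I \<Longrightarrow> a + s *\<^sub>R b \<in> S" and z: "z \<in> I"
  shows "((\<lambda>s. f (a + s *\<^sub>R b)) has_real_derivative gradient_on S f (a + z *\<^sub>R b) \<bullet> b) (at z within I)"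
proof -
  let ?p = "\<lambda>s. a + s *\<^sub>R b"
  have "(?p has_derivative (\<lambda>s. s *\<^sub>R b)) (at z within I)"
    by (auto intro!: derivative_eq_intros)
  moreover have "(f has_derivative (\<lambda>h. gradient_on S f (?p z) \<bullet> h)) (at (?p z) within ?p ` I)"
    using f S z by (intro has_derivative_subset[OF gradient_on_derivative]) (auto simp: differentiable_on_def)
  ultimately have "((f \<circ> ?p) has_derivative ((\<lambda>h. gradient_on S f (?p z) \<bullet> h) \<circ> (\<lambda>s. s *\<^sub>R b))) (at z within I)"
    by (rule diff_chain_within)
  then show ?thesis
    by (simp add: has_field_derivative_def o_def mult_commute_abs)
qed

lemma lipschitz_gradient_taylor:
  fixes f :: "real^'d \<Rightarrow> real"
  assumes D: "convex D" and f: "f differentiable_on D" and L: "L-lipschitz_on D (gradient_on D f)"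
    and xy: "x \<in> D" "y \<in> D"
  shows "\<bar>f y - f x - gradient_on D f x \<bullet> (y - x)\<bar> \<le> L * (norm (y - x))\<^sup>2"
proof -
  let ?p = "\<lambda>s. x + s *\<^sub>R (y - x)"
  have pD: "?p s \<in> D" if "s \<in> {0..1}" for s
    using convexD_alt[OF D xy, of s] that by (simp add: algebra_simps)
  have "\<exists>s\<in>{0..1}. f (?p 1) - f (?p 0) = gradient_on D f (?p s) \<bullet> (y - x) * (1 - 0)"
    using derivative_along_line[OF f pD, where I="{0..1}"]
    by (intro mvt_very_simple) (simp_all add: has_field_derivative_def)
  then obtain s where s: "s \<in> {0..1}" and eq: "f y - f x = gradient_on D f (?p s) \<bullet> (y - x)"
    by auto
  have "\<bar>f y - f x - gradient_on D f x \<bullet> (y - x)\<bar> = \<bar>(gradient_on D f (?p s) - gradient_on D f x) \<bullet> (y - x)\<bar>"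
    by (simp add: eq inner_diff_left)
  also have "\<dots> \<le> norm (gradient_on D f (?p s) - gradient_on D f x) * norm (y - x)"
    by (rule Cauchy_Schwarz_ineq2)
  also have "\<dots> \<le> (L * norm (y - x)) * norm (y - x)"
  proof (rule mult_right_mono)
    have L0: "0 \<le> L" using L by (rule lipschitz_on_nonneg)
    have "norm (gradient_on D f (?p s) - gradient_on D f x) \<le> L * norm (?p s - x)"
      using lipschitz_onD[OF L pD[OF s] xy(1)] by (simp add: dist_norm)
    also have "\<dots> \<le> L * norm (y - x)"
      using s L0 by (intro mult_left_mono) (auto simp: mult_left_le_one_le)
    finally show "norm (gradient_on D f (?p s) - gradient_on D f x) \<le> L * norm (y - x)" .
  qed simp
  finally show ?thesis by (simp add: power2_eq_square)
qed

lemma unit_cube_iff: "x \<in> unit_cube \<longleftrightarrow> (\<forall>i. 0 \<le> x $ i \<and> x $ i \<le> 1)"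
  by (auto simp: mem_box_cart)

text \<open>Below the face \<open>x $ i = 1\<close> there is room to increase the coordinate, and up-concavity bounds the
  increase by the partial derivative. On the face itself the sign is inherited from points below it,
  since the gradient is Lipschitz continuous.\<close>

lemma monotone_gradient_nonneg:
  fixes f :: "real^'d \<Rightarrow> real"
  assumes mono: "mono_on unit_cube f" and uc: "weakly_up_concave \<gamma> f" and \<gamma>: "0 < \<gamma>"
    and L: "L-lipschitz_on unit_cube (gradient_on unit_cube f)" and x: "x \<in> unit_cube"
  shows "0 \<le> gradient_on unit_cube f x $ i"
proof -
  let ?G = "gradient_on unit_cube f"
  have interior: "0 \<le> ?G y $ i" if y: "y \<in> unit_cube" "y $ i < 1" for y
  proof -
    let ?y = "y + (1 - y $ i) *\<^sub>R axis i 1"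
    have y': "?y \<in> unit_cube" using y by (auto simp: unit_cube_iff axis_def)
    have le: "y \<le> ?y" using y by (auto simp: less_eq_vec_def axis_def)
    have "0 \<le> f ?y - f y" using mono_onD[OF mono y(1) y' le] by simp
    also have "\<dots> \<le> 1 / \<gamma> * (?G y \<bullet> (?y - y))"
      using uc y(1) y' le unfolding weakly_up_concave_def by blast
    also have "\<dots> = (1 - y $ i) / \<gamma> * (?G y $ i)"
      by (simp add: inner_axis)
    finally show ?thesis using y(2) \<gamma> by (simp add: zero_le_mult_iff zero_le_divide_iff)
  qed
  show ?thesis
  proof (cases "x $ i < 1")
    case False
    then have xi: "x $ i = 1" using x by (simp add: unit_cube_iff) (metis order_antisym_conv not_less)
    have "- e \<le> ?G x $ i" if e: "0 < e" for e
    proof -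
      have L0: "0 \<le> L" using L by (rule lipschitz_on_nonneg)
      (* A step so short that the gradient changes by at most e; L + 1 avoids a division by zero. *)
      define s where "s = min 1 (e / (L + 1))"
      have s: "0 < s" "s \<le> 1" "L * s \<le> e"
      proof -
        show "0 < s" "s \<le> 1" using e L0 by (auto simp: s_def)
        have "L * s \<le> L * (e / (L + 1))" using L0 by (intro mult_left_mono) (auto simp: s_def)
        also have "\<dots> \<le> e" using L0 e by (simp add: field_simps)
        finally show "L * s \<le> e" .
      qed
      let ?y = "x - s *\<^sub>R axis i 1"
      have y: "?y \<in> unit_cube" using x s xi by (auto simp: unit_cube_iff axis_def)
      have "\<bar>?G x $ i - ?G ?y $ i\<bar> \<le> norm (?G x - ?G ?y)"
        using component_le_norm_cart[of "?G x - ?G ?y" i] by simp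
      also have "\<dots> \<le> L * s"
        using lipschitz_onD[OF L x y] s by (simp add: dist_norm)
      finally show ?thesis
        using interior[OF y] s xi by simp
    qed
    from this[of "- (?G x $ i) / 2"] show ?thesis by (cases "0 \<le> ?G x $ i") auto
  qed (rule interior[OF x])
qed

section \<open>Linearizing the gap to the comparator\<close>

text \<open>The device behind both linearizations: once a lower bound of the integrand is recognized as a
  derivative, the integral is bounded by boundary values.\<close>

lemma integral_density_ge:
  fixes p g Q Q' :: "real \<Rightarrow> real"
  assumes p: "continuous_on {0..1} p" and g: "continuous_on {0..1} g"
    and Q: "\<And>z. z \<in> {0..1} \<Longrightarrow> (Q has_real_derivative Q' z) (at z within {0..1})"
    and le: "\<And>z. z \<in> {0..1} \<Longrightarrow> Q' z \<le> p z * g z"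
  shows "Q 1 - Q 0 \<le> (\<integral>z. (p z * indicator {0..1} z) * g z \<partial>lborel)"
proof -
  have "continuous_on {0..1} (\<lambda>z. p z * g z)" using p g by (rule continuous_on_mult)
  then have int: "set_integrable lborel {0..1} (\<lambda>z. p z * g z)"
    by (rule borel_integrable_atLeastAtMost')
  have "(Q' has_integral Q 1 - Q 0) {0..1}"
    using Q by (intro fundamental_theorem_of_calculus)
      (auto simp: has_real_derivative_iff_has_vector_derivative)
  moreover have "((\<lambda>z. p z * g z) has_integral (LINT z:{0..1}|lborel. p z * g z)) {0..1}"
    using integrable_integral set_borel_integral_eq_integral[OF int] by metis
  ultimately have "Q 1 - Q 0 \<le> (LINT z:{0..1}|lborel. p z * g z)"
    using le by (rule has_integral_le)
  then show ?thesis
    by (simp add: set_lebesgue_integral_def mult.assoc mult.left_commute)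
qed

definition vec_max :: "real^'d \<Rightarrow> real^'d \<Rightarrow> real^'d" where
  "vec_max x y = (\<chi> i. max (x $ i) (y $ i))"

definition vec_min :: "real^'d \<Rightarrow> real^'d \<Rightarrow> real^'d" where
  "vec_min x y = (\<chi> i. min (x $ i) (y $ i))"

lemma vec_max_min:
  "x \<le> vec_max x y" "y \<le> vec_max x y" "vec_min x y \<le> x"
  "x \<in> unit_cube \<Longrightarrow> y \<in> unit_cube \<Longrightarrow> vec_max x y \<in> unit_cube"
  "x \<in> unit_cube \<Longrightarrow> y \<in> unit_cube \<Longrightarrow> vec_min x y \<in> unit_cube"
  by (auto simp: vec_max_def vec_min_def less_eq_vec_def unit_cube_iff vec_eq_iff max_def min_def)

text \<open>Put \<open>y = z x\<close>. Up-concavity from \<open>y\<close> up to the maximum of \<open>y\<close> and \<open>u\<close>, together with monotonicity,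
  shows that the gradient at \<open>y\<close> has inner product at least \<open>\<gamma> (f u - f y)\<close> with \<open>u\<close>; its inner product
  with \<open>x\<close> is the derivative of \<open>f (z x)\<close> in \<open>z\<close>. The factor \<open>exp (\<gamma> (z - 1))\<close> of the density is the
  integrating factor: it makes the difference the total derivative of
  \<open>exp (\<gamma> (z - 1)) (f u - f (z x))\<close>.\<close>

lemma monotone_linearization:
  fixes f :: "real^'d \<Rightarrow> real"
  assumes \<gamma>: "0 < \<gamma>" and nonneg: "\<And>x. x \<in> unit_cube \<Longrightarrow> 0 \<le> f x"
    and mono: "mono_on unit_cube f" and uc: "weakly_up_concave \<gamma> f"
    and L: "L-lipschitz_on unit_cube (gradient_on unit_cube f)"
    and x: "x \<in> unit_cube" and u: "u \<in> unit_cube"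
  shows "(1 - exp (- \<gamma>)) * f u - f x \<le> (1 - exp (- \<gamma>)) / \<gamma> *
    (\<integral>z. (\<gamma> * exp (\<gamma> * (z - 1)) / (1 - exp (- \<gamma>)) * indicator {0..1} z) *
       (gradient_on unit_cube f (z *\<^sub>R x) \<bullet> (u - x)) \<partial>lborel)"
proof -
  let ?G = "gradient_on unit_cube f" and ?c = "\<gamma> / (1 - exp (- \<gamma>))"
  have c: "0 < ?c" using \<gamma> by simp
  have fd: "f differentiable_on unit_cube" using uc by (simp add: weakly_up_concave_def)
  have zx: "z *\<^sub>R x \<in> unit_cube" if "z \<in> {0..1}" for z
    using that x by (auto simp: unit_cube_iff mult_le_one)
  have lower: "\<gamma> * (f u - f y) \<le> ?G y \<bullet> u" if y: "y \<in> unit_cube" for y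
  proof -
    have "f u \<le> f (vec_max y u)"
      by (rule mono_onD[OF mono u vec_max_min(4)[OF y u] vec_max_min(2)])
    moreover have "f (vec_max y u) - f y \<le> 1 / \<gamma> * (?G y \<bullet> (vec_max y u - y))"
      using uc y vec_max_min(4)[OF y u] vec_max_min(1)[of y u] unfolding weakly_up_concave_def by blast
    ultimately have "f u - f y \<le> 1 / \<gamma> * (?G y \<bullet> (vec_max y u - y))" by linarith
    then have "\<gamma> * (f u - f y) \<le> ?G y \<bullet> (vec_max y u - y)"
      using \<gamma> by (simp add: field_simps)
    also have "\<dots> \<le> ?G y \<bullet> u"
      unfolding inner_vec_def
    proof (rule sum_mono)
      fix i
      have "(vec_max y u - y) $ i \<le> u $ i"
        using y u by (auto simp: vec_max_def unit_cube_iff max_def)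
      then show "?G y $ i \<bullet> (vec_max y u - y) $ i \<le> ?G y $ i \<bullet> u $ i"
        using monotone_gradient_nonneg[OF mono uc \<gamma> L y, of i] by (simp add: mult_left_mono)
    qed
    finally show ?thesis .
  qed
  (* The summand 0 gives the path the shape a + s *R b of derivative_along_line. *)
  define Q where "Q z = ?c * (exp (\<gamma> * (z - 1)) * (f u - f (0 + z *\<^sub>R x)))" for z
  define Q' where "Q' z = ?c * (exp (\<gamma> * (z - 1)) * (\<gamma> * (f u - f (z *\<^sub>R x)) - ?G (z *\<^sub>R x) \<bullet> x))" for z
  have "Q 1 - Q 0 \<le> (\<integral>z. (\<gamma> * exp (\<gamma> * (z - 1)) / (1 - exp (- \<gamma>)) * indicator {0..1} z) *
       (?G (z *\<^sub>R x) \<bullet> (u - x)) \<partial>lborel)"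
  proof (rule integral_density_ge)
    show "continuous_on {0..1} (\<lambda>z. \<gamma> * exp (\<gamma> * (z - 1)) / (1 - exp (- \<gamma>)))"
      using \<gamma> by (intro continuous_intros) auto
    have "continuous_on {0..1} (?G \<circ> (\<lambda>z. z *\<^sub>R x))"
      using zx by (intro continuous_on_compose continuous_intros
        continuous_on_subset[OF lipschitz_on_continuous_on[OF L]]) auto
    then show "continuous_on {0..1} (\<lambda>z. ?G (z *\<^sub>R x) \<bullet> (u - x))"
      by (intro continuous_intros) (simp add: o_def)
  next
    fix z :: real assume z: "z \<in> {0..1}"
    have "((\<lambda>s. f (0 + s *\<^sub>R x)) has_real_derivative ?G (0 + z *\<^sub>R x) \<bullet> x) (at z within {0..1})"
      by (rule derivative_along_line[OF fd _ z]) (use zx in simp)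
    then have dF: "((\<lambda>s. f u - f (0 + s *\<^sub>R x)) has_real_derivative 0 - ?G (z *\<^sub>R x) \<bullet> x) (at z within {0..1})"
      by (intro derivative_intros) simp_all
    have "((\<lambda>s. exp (\<gamma> * (s - 1))) has_real_derivative exp (\<gamma> * (z - 1)) * \<gamma>) (at z within {0..1})"
      by (auto intro!: derivative_eq_intros)
    from DERIV_cmult[OF DERIV_mult[OF this dF], of ?c]
    show "(Q has_real_derivative Q' z) (at z within {0..1})"
      by (simp add: Q_def[abs_def] Q'_def right_diff_distrib mult_ac)
    have "?c * exp (\<gamma> * (z - 1)) * (\<gamma> * (f u - f (z *\<^sub>R x)) - ?G (z *\<^sub>R x) \<bullet> x)
        \<le> ?c * exp (\<gamma> * (z - 1)) * (?G (z *\<^sub>R x) \<bullet> (u - x))"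
    proof (rule mult_left_mono)
      show "0 \<le> ?c * exp (\<gamma> * (z - 1))"
        by (intro mult_nonneg_nonneg less_imp_le[OF c] exp_ge_zero)
    qed (use lower[OF zx[OF z]] in \<open>simp add: inner_diff_right\<close>)
    then show "Q' z \<le> \<gamma> * exp (\<gamma> * (z - 1)) / (1 - exp (- \<gamma>)) * (?G (z *\<^sub>R x) \<bullet> (u - x))"
      by (simp add: Q'_def mult.assoc)
  qed
  moreover have "Q 1 - Q 0 \<ge> ?c * ((1 - exp (- \<gamma>)) * f u - f x)"
  proof -
    have "0 \<le> exp (- \<gamma>) * f 0" using nonneg[of 0] by (simp add: unit_cube_iff)
    then have "(1 - exp (- \<gamma>)) * f u - f x \<le> (f u - f x) - exp (- \<gamma>) * (f u - f 0)"
      by (simp add: algebra_simps)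
    then show ?thesis
      using c unfolding Q_def right_diff_distrib[symmetric] by (intro mult_left_mono) auto
  qed
  ultimately have "?c * ((1 - exp (- \<gamma>)) * f u - f x) \<le> (\<integral>z. (\<gamma> * exp (\<gamma> * (z - 1)) / (1 - exp (- \<gamma>)) * indicator {0..1} z) *
       (?G (z *\<^sub>R x) \<bullet> (u - x)) \<partial>lborel)" (is "_ \<le> ?I")
    by linarith
  moreover have "0 \<le> 1 / ?c" by (rule divide_nonneg_nonneg[OF zero_le_one less_imp_le[OF c]])
  ultimately have "(1 / ?c) * (?c * ((1 - exp (- \<gamma>)) * f u - f x)) \<le> (1 / ?c) * ?I"
    by (rule mult_left_mono)
  moreover have "(1 / ?c) * (?c * a) = a" for a using \<gamma> by simp
  moreover have "1 / ?c = (1 - exp (- \<gamma>)) / \<gamma>" by simp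
  ultimately show ?thesis by simp
qed

text \<open>Prolong the segment from \<open>u\<close> to the maximum of \<open>w\<close> and \<open>u\<close> by the factor \<open>1 / \<theta>\<close>. The new endpoint \<open>p\<close> is
  still in the cube because the coordinates of \<open>w\<close> are at most \<open>\<theta>\<close>. The maximum is \<open>(1 - \<theta>) u + \<theta> p\<close>, the
  segment has a nonnegative direction, along which \<open>f\<close> is concave, and \<open>f p\<close> is nonnegative.\<close>

lemma up_concave_max_ge:
  fixes f :: "real^'d \<Rightarrow> real"
  assumes nonneg: "\<And>x. x \<in> unit_cube \<Longrightarrow> 0 \<le> f x" and uc: "weakly_up_concave 1 f"
    and w: "w \<in> unit_cube" and u: "u \<in> unit_cube"
    and \<theta>: "\<And>i. w $ i \<le> \<theta>" "0 \<le> \<theta>" "\<theta> \<le> 1"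
  shows "(1 - \<theta>) * f u \<le> f (vec_max w u)"
proof -
  let ?y = "vec_max w u"
  have y: "?y \<in> unit_cube" and uy: "u \<le> ?y" using vec_max_min w u by blast+
  consider "\<theta> = 0" | "\<theta> = 1" | "0 < \<theta>" "\<theta> < 1" using \<theta> by linarith
  then show ?thesis
  proof cases
    case 1
    have "max (w $ i) (u $ i) = u $ i" for i
      using \<theta>(1)[of i] u 1 by (auto simp: unit_cube_iff max_def) (metis order_antisym order_trans)
    then have "?y = u" by (simp add: vec_max_def vec_eq_iff)
    then show ?thesis using 1 by simp
  next
    case 2 then show ?thesis using nonneg[OF y] by simp
  next
    case 3
    define p where "p = u + (1 / \<theta>) *\<^sub>R (?y - u)"
    have p_le: "u $ i + (max (w $ i) (u $ i) - u $ i) / \<theta> \<le> 1"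
        and p_ge: "u $ i \<le> u $ i + (max (w $ i) (u $ i) - u $ i) / \<theta>"
        and y_le: "max (w $ i) (u $ i) - u $ i \<le> (max (w $ i) (u $ i) - u $ i) / \<theta>" for i
    proof -
      have ui: "0 \<le> u $ i" "u $ i \<le> 1" using u by (auto simp: unit_cube_iff)
      have "u $ i * \<theta> + (max (w $ i) (u $ i) - u $ i) \<le> \<theta>"
      proof (cases "w $ i \<le> u $ i")
        case True then show ?thesis using ui 3 by (simp add: mult_left_le_one_le)
      next
        case False
        then show ?thesis using ui 3 \<theta>(1)[of i] mult_left_mono[of \<theta> 1 "u $ i"] by simp
      qed
      then show "u $ i + (max (w $ i) (u $ i) - u $ i) / \<theta> \<le> 1"
        using 3 by (simp add: field_simps)
      show "u $ i \<le> u $ i + (max (w $ i) (u $ i) - u $ i) / \<theta>" using 3 by simp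
      show "max (w $ i) (u $ i) - u $ i \<le> (max (w $ i) (u $ i) - u $ i) / \<theta>"
        using 3 mult_left_mono[of \<theta> 1 "max (w $ i) (u $ i) - u $ i"] by (simp add: pos_le_divide_eq)
    qed
    have p: "p \<in> unit_cube"
      using p_le p_ge u by (auto simp: p_def unit_cube_iff vec_max_def intro: order_trans)
    have yp: "?y \<le> p"
      using y_le by (simp add: p_def less_eq_vec_def vec_max_def le_diff_eq[symmetric] add.commute diff_le_eq)
    let ?D = "gradient_on unit_cube f ?y \<bullet> (?y - u)"
    have "f p - f ?y \<le> 1 / 1 * (gradient_on unit_cube f ?y \<bullet> (p - ?y))"
      using uc y p yp unfolding weakly_up_concave_def by blast
    also have "p - ?y = (1 / \<theta> - 1) *\<^sub>R (?y - u)"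
      by (simp add: p_def scaleR_left_diff_distrib)
    finally have "0 \<le> f ?y + (1 / \<theta> - 1) * ?D" using nonneg[OF p] by simp
    also have "\<dots> \<le> f ?y + (1 / \<theta> - 1) * (f ?y - f u)"
    proof -
      have "1 * ?D \<le> f ?y - f u"
        using uc y u uy unfolding weakly_up_concave_def by blast
      then show ?thesis using 3 by (intro add_left_mono mult_left_mono) auto
    qed
    finally have "0 \<le> \<theta> * (f ?y + (1 / \<theta> - 1) * (f ?y - f u))" using 3 by simp
    also have "\<dots> = f ?y - (1 - \<theta>) * f u" using 3 by (simp add: field_simps)
    finally show ?thesis by simp
  qed
qed

text \<open>Let \<open>w\<close> be the query point. Up-concavity from \<open>w\<close> up to its maximum with \<open>u\<close> and down to its minimum
  with \<open>u\<close> bounds the inner product of the gradient at \<open>w\<close> with \<open>u - w\<close> from below by the sum of \<open>f\<close> at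
  these two points minus \<open>2 f w\<close>; the value at the minimum is nonnegative and \<open>up_concave_max_ge\<close>
  handles the maximum. Moreover \<open>x - w\<close> is \<open>2 q\<close> times the derivative of \<open>w\<close> in \<open>z\<close>, where
  \<open>q = 1 - z / 2\<close>. The density \<open>1 / (3 q\<^sup>3)\<close> turns \<open>-2 f w - 2 q (d / dz) f w\<close> into the total
  derivative of \<open>-(2 / 3) f w / q\<^sup>2\<close>.\<close>

lemma nonmonotone_linearization:
  fixes f :: "real^'d \<Rightarrow> real"
  assumes nonneg: "\<And>x. x \<in> unit_cube \<Longrightarrow> 0 \<le> f x" and uc: "weakly_up_concave 1 f"
    and L: "L-lipschitz_on unit_cube (gradient_on unit_cube f)"
    and x: "x \<in> unit_cube" and u: "u \<in> unit_cube" and a: "a \<in> unit_cube"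
  shows "(1 - infnorm a) / 4 * f u - f ((1/2) *\<^sub>R (x + a)) \<le> 3 / 8 *
    (\<integral>z. (1 / (3 * (1 - z / 2) ^ 3) * indicator {0..1} z) *
       (gradient_on unit_cube f ((z / 2) *\<^sub>R (x - a) + a) \<bullet> (u - x)) \<partial>lborel)"
proof -
  let ?G = "gradient_on unit_cube f" and ?A = "infnorm a"
  define b where "b = (1/2) *\<^sub>R (x - a)"
  define w where "w z = a + z *\<^sub>R b" for z
  have w_eq: "(z / 2) *\<^sub>R (x - a) + a = w z" for z by (simp add: w_def b_def)
  have fd: "f differentiable_on unit_cube" using uc by (simp add: weakly_up_concave_def)
  have ai: "a $ i \<le> ?A" for i
    using component_le_infnorm_cart[of a i] by simp
  have w_comp: "w z $ i = (1 - z / 2) * a $ i + (z / 2) * x $ i" for z i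
    by (simp add: w_def b_def algebra_simps)
  have wz: "w z \<in> unit_cube" if "z \<in> {0..1}" for z
  proof -
    have "w z = (1 - z / 2) *\<^sub>R a + (z / 2) *\<^sub>R x" by (simp add: vec_eq_iff w_comp)
    then show ?thesis using convexD_alt[OF convex_box(1) a x, of "z/2"] that by simp
  qed
  have A1: "?A \<le> 1"
    unfolding infnorm_cart using a by (intro cSup_least) (auto simp: unit_cube_iff)
  have lower: "(1 - z / 2) * (1 - ?A) * f u - 2 * f (w z) - 2 * (1 - z / 2) * (?G (w z) \<bullet> b) \<le> ?G (w z) \<bullet> (u - x)"
    if z: "z \<in> {0..1}" for z
  proof -
    note w = wz[OF z]
    have "f (vec_max (w z) u) - f (w z) \<le> 1 / 1 * (?G (w z) \<bullet> (vec_max (w z) u - w z))"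
      using uc w vec_max_min(4)[OF w u] vec_max_min(1)[of "w z" u] unfolding weakly_up_concave_def by blast
    moreover have "1 * (?G (w z) \<bullet> (w z - vec_min (w z) u)) \<le> f (w z) - f (vec_min (w z) u)"
      using uc w vec_max_min(5)[OF w u] vec_max_min(3)[of "w z" u] unfolding weakly_up_concave_def by blast
    moreover have "0 \<le> f (vec_min (w z) u)" by (rule nonneg[OF vec_max_min(5)[OF w u]])
    moreover have "(1 - z / 2) * (1 - ?A) * f u \<le> f (vec_max (w z) u)"
    proof -
      have "(1 - ((1 - z / 2) * ?A + z / 2)) * f u \<le> f (vec_max (w z) u)"
      proof (rule up_concave_max_ge[OF nonneg uc w u])
        fix i
        have "x $ i \<le> 1" using x by (simp add: unit_cube_iff)
        then show "w z $ i \<le> (1 - z / 2) * ?A + z / 2"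
          unfolding w_comp using z ai[of i]
          by (intro add_mono mult_left_mono) (auto simp: mult_left_le)
      next
        show "0 \<le> (1 - z / 2) * ?A + z / 2" using z infnorm_pos_le[of a] by simp
        show "(1 - z / 2) * ?A + z / 2 \<le> 1"
        proof -
          have "(1 - z / 2) * ?A \<le> (1 - z / 2) * 1" using A1 z by (intro mult_left_mono) auto
          then show ?thesis by simp
        qed
      qed
      moreover have "1 - ((1 - z / 2) * ?A + z / 2) = (1 - z / 2) * (1 - ?A)"
        by (simp add: field_simps)
      ultimately show ?thesis by (simp only:)
    qed
    moreover have "?G (w z) \<bullet> (u - x) = ?G (w z) \<bullet> (vec_max (w z) u - w z)
        - ?G (w z) \<bullet> (w z - vec_min (w z) u) - 2 * (1 - z / 2) * (?G (w z) \<bullet> b)"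
    proof -
      have "u - x = (vec_max (w z) u - w z) - (w z - vec_min (w z) u) - (2 * (1 - z / 2)) *\<^sub>R b"
        by (simp add: vec_eq_iff vec_max_def vec_min_def w_def b_def max_def min_def field_simps)
      then show ?thesis by (simp only: inner_diff_right inner_scaleR_right)
    qed
    ultimately show ?thesis by linarith
  qed
  define q where "q z = 1 - z / 2" for z :: real
  have q0: "0 < q z" if "z \<in> {0..1}" for z using that by (simp add: q_def)
  define Q where "Q z = 1 / 3 * (2 * (1 - ?A) * f u * (1 / q z) - 2 * ((1 / q z)\<^sup>2 * f (w z)))" for z
  define Q' where "Q' z = 1 / (3 * q z ^ 3) *
    (q z * (1 - ?A) * f u - 2 * f (w z) - 2 * q z * (?G (w z) \<bullet> b))" for z
  have "Q 1 - Q 0 \<le> (\<integral>z. (1 / (3 * (1 - z / 2) ^ 3) * indicator {0..1} z) *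
       (?G (w z) \<bullet> (u - x)) \<partial>lborel)"
  proof (rule integral_density_ge)
    show "continuous_on {0..1} (\<lambda>z. 1 / (3 * (1 - z / 2) ^ 3) :: real)"
      by (intro continuous_intros) auto
    have "continuous_on {0..1} (?G \<circ> w)"
      using wz unfolding w_def by (intro continuous_on_compose continuous_intros
        continuous_on_subset[OF lipschitz_on_continuous_on[OF L]]) auto
    then show "continuous_on {0..1} (\<lambda>z. ?G (w z) \<bullet> (u - x))"
      by (intro continuous_intros) (simp add: o_def)
  next
    fix z :: real assume z: "z \<in> {0..1}"
    have df: "((\<lambda>s. f (w s)) has_real_derivative ?G (w z) \<bullet> b) (at z within {0..1})"
      unfolding w_def by (rule derivative_along_line[OF fd _ z]) (use wz w_def in simp)
    have dq: "((\<lambda>s. 1 / q s) has_real_derivative 1 / 2 * (1 / q z)\<^sup>2) (at z within {0..1})"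
      using q0[OF z] unfolding q_def
      by (auto intro!: derivative_eq_intros simp: field_simps power2_eq_square)
    have "(Q has_real_derivative 1 / 3 * (2 * (1 - ?A) * f u * (1 / 2 * (1 / q z)\<^sup>2) -
        2 * (2 * (1 / q z) * (1 / 2 * (1 / q z)\<^sup>2) * f (w z) + (1 / q z)\<^sup>2 * (?G (w z) \<bullet> b)))) (at z within {0..1})"
      unfolding Q_def by (rule derivative_eq_intros dq df refl | simp)+
    moreover have "1 / 3 * (2 * (1 - ?A) * f u * (1 / 2 * (1 / q z)\<^sup>2) -
        2 * (2 * (1 / q z) * (1 / 2 * (1 / q z)\<^sup>2) * f (w z) + (1 / q z)\<^sup>2 * (?G (w z) \<bullet> b))) = Q' z"
      using q0[OF z] unfolding Q'_def by (simp add: field_simps power2_eq_square power3_eq_cube)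
    ultimately show "(Q has_real_derivative Q' z) (at z within {0..1})" by simp
    show "Q' z \<le> 1 / (3 * (1 - z / 2) ^ 3) * (?G (w z) \<bullet> (u - x))"
      unfolding Q'_def using lower[OF z] q0[OF z] unfolding q_def
      by (intro mult_left_mono) auto
  qed
  moreover have "8 / 3 * ((1 - ?A) / 4 * f u - f (w 1)) \<le> Q 1 - Q 0"
  proof -
    have "0 \<le> f (w 0)" by (rule nonneg[OF wz]) simp
    then show ?thesis by (simp add: Q_def q_def power2_eq_square field_simps)
  qed
  moreover have "w 1 = (1/2) *\<^sub>R (x + a)"
    by (simp add: vec_eq_iff w_comp algebra_simps)
  ultimately show ?thesis unfolding w_eq by simp
qed

section \<open>The iteration along one sample path\<close>

lemma network_facts:
  assumes "network E (A :: real^'n^'n) lam"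
  shows "0 \<le> A $ i $ j" "transpose A = A" "(\<Sum>j\<in>UNIV. A $ i $ j) = 1" "(\<Sum>i\<in>UNIV. A $ i $ j) = 1"
    "second_eigenvalue A = lam"
    "(\<Sum>j\<in>neighbors E i. A $ i $ j *\<^sub>R X j) = (\<Sum>j\<in>UNIV. A $ i $ j *\<^sub>R (X j :: real^'d))"
proof -
  show "0 \<le> A $ i $ j" "transpose A = A" "(\<Sum>j\<in>UNIV. A $ i $ j) = 1" "(\<Sum>i\<in>UNIV. A $ i $ j) = 1"
    "second_eigenvalue A = lam"
    using assms by (simp_all add: network_def)
  have "A $ i $ j = 0" if "j \<notin> neighbors E i" for j
  proof -
    have "\<not> 0 < A $ i $ j" "0 \<le> A $ i $ j"
      using assms that unfolding network_def neighbors_def by blast+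
    then show ?thesis by simp
  qed
  then show "(\<Sum>j\<in>neighbors E i. A $ i $ j *\<^sub>R X j) = (\<Sum>j\<in>UNIV. A $ i $ j *\<^sub>R X j)"
    by (intro sum.mono_neutral_left) auto
qed

lemma norm_convex_sum_le:
  fixes X :: "'n::finite \<Rightarrow> 'a::real_normed_vector"
  assumes "\<And>j. 0 \<le> a j" "(\<Sum>j\<in>UNIV. a j) = 1" "\<And>j. norm (X j) \<le> B"
  shows "norm (\<Sum>j\<in>UNIV. a j *\<^sub>R X j) \<le> B"
proof -
  have "norm (\<Sum>j\<in>UNIV. a j *\<^sub>R X j) \<le> (\<Sum>j\<in>UNIV. a j * B)"
    using assms by (intro order_trans[OF norm_sum] sum_mono) (simp add: mult_left_mono)
  also have "\<dots> = B" using assms(2) by (simp flip: sum_distrib_right)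
  finally show ?thesis .
qed

text \<open>Jensen's inequality; the difference of the two sides is a weighted variance.\<close>

lemma norm_sq_convex_sum_le:
  fixes X :: "'n::finite \<Rightarrow> 'a::real_inner"
  assumes a: "\<And>j. 0 \<le> a j" "(\<Sum>j\<in>UNIV. a j) = 1"
  shows "(norm (\<Sum>j\<in>UNIV. a j *\<^sub>R X j))\<^sup>2 \<le> (\<Sum>j\<in>UNIV. a j * (norm (X j))\<^sup>2)"
proof -
  let ?s = "\<Sum>j\<in>UNIV. a j *\<^sub>R X j"
  have "0 \<le> (\<Sum>j\<in>UNIV. a j * (norm (X j - ?s))\<^sup>2)"
    using a by (intro sum_nonneg) simp
  also have "\<dots> = (\<Sum>j\<in>UNIV. a j * (norm (X j))\<^sup>2 - 2 * ((a j *\<^sub>R X j) \<bullet> ?s) + a j * (?s \<bullet> ?s))"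
    by (intro sum.cong refl) (simp add: power2_norm_eq_inner inner_diff inner_commute algebra_simps)
  also have "\<dots> = (\<Sum>j\<in>UNIV. a j * (norm (X j))\<^sup>2) - 2 * (?s \<bullet> ?s) + ?s \<bullet> ?s"
    by (simp only: sum.distrib sum_subtractf flip: sum_distrib_left sum_distrib_right inner_sum_left) (simp add: a)
  finally show ?thesis by (simp add: power2_norm_eq_inner)
qed

definition consensus_const :: "nat \<Rightarrow> nat \<Rightarrow> real \<Rightarrow> real \<Rightarrow> real" where
  "consensus_const n k lam B0 = 2 * real n * (4 + real k * B0) / (1 - lam)"

text \<open>One sample path: directions and responses are arbitrary bounded families, and nothing in this
  locale is random. The number of blocks is \<open>M\<close>.\<close>

locale gossip_run =
  fixes E :: "('n::finite \<times> 'n) set" and A :: "real^'n^'n" and lam :: real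
    and S :: "(real^'d) set" and c :: "real^'d" and R \<epsilon> \<eta> \<delta> B0 :: real and k b M :: nat
    and L :: "real^'d \<Rightarrow> real^'d" and P :: "real^'d \<Rightarrow> real^'d \<Rightarrow> (real^'d) loo_proc"
    and v :: "nat \<Rightarrow> 'n \<Rightarrow> real^'d" and q :: "nat \<Rightarrow> 'n \<Rightarrow> real"
  assumes net: "network E A lam" and lam: "lam < 1"
    and S: "convex S" "c \<in> S" "\<And>x. x \<in> S \<Longrightarrow> norm x \<le> R"
    and pos: "0 < b" "0 < \<eta>" "0 < \<delta>" and eps: "\<epsilon> = (real b)\<^sup>2 * \<eta>\<^sup>2 / \<delta>\<^sup>2"
    and proj: "infeasible_projection R S \<epsilon> L P"
    and v: "\<And>t i. t \<in> {1..M * b} \<Longrightarrow> norm (v t i) \<le> 1"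
    and q: "\<And>t i. t \<in> {1..M * b} \<Longrightarrow> \<bar>q t i\<bar> \<le> B0"
    and M: "0 < M"
begin

text \<open>The points \<open>start\<close> and \<open>target\<close> are the two arguments of the projection after a block; \<open>err\<close> is the
  square root of \<open>\<epsilon>\<close>, in units of which all displacements are measured.\<close>

definition st where "st = agents E A c k b \<eta> \<delta> L P v q"

definition iter where "iter m i = iterate (st m i)"
definition auxi where "auxi m i = aux (st m i)"
definition grad where "grad m i = (\<Sum>t\<in>{m * b + 1..Suc m * b}. (real k / \<delta> * q t i) *\<^sub>R v t i)"
definition start where "start m i = (\<Sum>j\<in>UNIV. A $ i $ j *\<^sub>R iter m j)"
definition target where "target m i = (\<Sum>j\<in>UNIV. A $ i $ j *\<^sub>R auxi m j) + \<eta> *\<^sub>R grad m i"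
definition err where "err = real b * \<eta> / \<delta>"

lemma err_pos: "0 < err" using pos by (simp add: err_def)
lemma eps_err: "\<epsilon> = err\<^sup>2" by (simp add: eps err_def power_divide power_mult_distrib)

lemma B0_nonneg: "0 \<le> B0"
proof -
  have "\<bar>q 1 i\<bar> \<le> B0" for i using M pos by (intro q) (simp add: Suc_leI)
  then show ?thesis by (meson abs_ge_zero order_trans)
qed

lemma step:
  "iter (Suc m) i = fst (result L (P (start m i) (target m i)))"
  "auxi (Suc m) i = snd (result L (P (start m i) (target m i)))"
  "loo_count (st (Suc m) i) = loo_count (st m i) + calls L (P (start m i) (target m i))"
  "comm_count (st (Suc m) i) = comm_count (st m i) + 1"
  unfolding iter_def auxi_def start_def target_def grad_def st_def network_facts(6)[OF net, symmetric]
  by (simp_all add: Let_def)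

lemma start_0: "iter 0 i = c" "auxi 0 i = c" "loo_count (st 0 i) = 0" "comm_count (st 0 i) = 0"
  by (simp_all add: iter_def auxi_def st_def)

lemma comm_count: "comm_count (st m i) = m"
  by (induction m) (simp_all add: step start_0)

lemma start_in_if: "(\<And>j. iter m j \<in> S) \<Longrightarrow> start m i \<in> S"
  unfolding start_def using network_facts[OF net] by (intro convex_sum[OF _ S(1)]) auto

lemma projection_facts:
  assumes "start m i \<in> S"
  shows "iter (Suc m) i \<in> S" "(norm (iter (Suc m) i - auxi (Suc m) i))\<^sup>2 \<le> 3 * \<epsilon>"
    "z \<in> S \<Longrightarrow> (norm (auxi (Suc m) i - z))\<^sup>2 \<le> (norm (target m i - z))\<^sup>2"
    "real (calls L (P (start m i) (target m i))) \<le> real (nat \<lceil>27 * R\<^sup>2 / \<epsilon> - 2\<rceil>) *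
       max 1 ((norm (start m i - target m i))\<^sup>2 * ((norm (start m i - target m i))\<^sup>2 - \<epsilon>) / (4 * \<epsilon>\<^sup>2) + 1)"
  using proj assms unfolding infeasible_projection_def step
  by (metis prod.collapse)+

lemma iter_in: "iter m i \<in> S"
proof (induction m arbitrary: i)
  case 0 then show ?case using S by (simp add: start_0)
next
  case (Suc m) then show ?case using start_in_if projection_facts(1) by blast
qed

lemma start_in: "start m i \<in> S"
  by (rule start_in_if[OF iter_in])

lemma iter_auxi: "norm (iter m i - auxi m i) \<le> 2 * err"
proof (cases m)
  case 0 then show ?thesis using err_pos by (simp add: start_0)
next
  case (Suc l)
  have "(norm (iter m i - auxi m i))\<^sup>2 \<le> 3 * err\<^sup>2"
    using projection_facts(2)[OF start_in] by (simp add: Suc eps_err)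
  also have "\<dots> \<le> (2 * err)\<^sup>2" by (simp add: power_mult_distrib)
  finally show ?thesis by (rule power2_le_imp_le) (use err_pos in simp)
qed

definition grad_max where "grad_max = real b * real k * B0 / \<delta>"

lemma grad_bound:
  assumes "m < M"
  shows "norm (grad m i) \<le> grad_max"
proof -
  have "norm (grad m i) \<le> (\<Sum>t\<in>{m * b + 1..Suc m * b}. real k / \<delta> * B0)"
    unfolding grad_def
  proof (intro order_trans[OF norm_sum] sum_mono)
    fix t assume t: "t \<in> {m * b + 1..Suc m * b}"
    have "Suc m * b \<le> M * b" using assms by (intro mult_right_mono) auto
    then have t': "t \<in> {1..M * b}" using t by auto
    have "norm ((real k / \<delta> * q t i) *\<^sub>R v t i) = real k / \<delta> * (\<bar>q t i\<bar> * norm (v t i))"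
      using pos by (simp add: abs_mult)
    also have "\<dots> \<le> real k / \<delta> * (B0 * 1)"
      using q[OF t'] v[OF t'] pos B0_nonneg by (intro mult_left_mono mult_mono) auto
    finally show "norm ((real k / \<delta> * q t i) *\<^sub>R v t i) \<le> real k / \<delta> * B0" by simp
  qed
  also have "\<dots> = grad_max" by (simp add: grad_max_def field_simps)
  finally show ?thesis .
qed

lemma grad_max_nonneg: "0 \<le> grad_max" using pos B0_nonneg by (simp add: grad_max_def)

lemma eta_grad_max: "\<eta> * grad_max = real k * B0 * err" by (simp add: grad_max_def err_def)

text \<open>The choice of \<open>\<epsilon>\<close> enters here: a block gradient step has length at most \<open>\<eta> grad_max = k B0 err\<close>,
  which is of the same order as the distance between the two points that an agent maintains.\<close>

lemma target_start:
  assumes "m < M"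
  shows "norm (target m i - start m i) \<le> (2 + real k * B0) * err"
proof -
  have "target m i - start m i = (\<Sum>j\<in>UNIV. A $ i $ j *\<^sub>R (auxi m j - iter m j)) + \<eta> *\<^sub>R grad m i"
    by (simp add: target_def start_def scaleR_diff_right sum_subtractf)
  also have "norm \<dots> \<le> 2 * err + \<eta> * grad_max"
  proof (rule norm_triangle_mono)
    show "norm (\<Sum>j\<in>UNIV. A $ i $ j *\<^sub>R (auxi m j - iter m j)) \<le> 2 * err"
      using network_facts[OF net] iter_auxi by (intro norm_convex_sum_le) (auto simp: norm_minus_commute)
    show "norm (\<eta> *\<^sub>R grad m i) \<le> \<eta> * grad_max"
      using grad_bound[OF assms, of i] pos by simp
  qed
  finally show ?thesis by (simp add: eta_grad_max algebra_simps)
qed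

text \<open>The start of the projection lies in \<open>S\<close>, so the auxiliary output is no farther from it than the
  target, and the feasible output is close to the auxiliary one.\<close>

lemma iter_step:
  assumes "m < M"
  shows "norm (iter (Suc m) i - (\<Sum>j\<in>UNIV. A $ i $ j *\<^sub>R iter m j)) \<le> (4 + real k * B0) * err"
proof -
  have "(norm (auxi (Suc m) i - start m i))\<^sup>2 \<le> (norm (target m i - start m i))\<^sup>2"
    by (rule projection_facts(3)[OF start_in start_in])
  then have "norm (auxi (Suc m) i - start m i) \<le> norm (target m i - start m i)"
    by (rule power2_le_imp_le) simp
  then have "norm (auxi (Suc m) i - start m i) \<le> (2 + real k * B0) * err"
    using target_start[OF assms, of i] by linarith
  moreover have "norm (iter (Suc m) i - start m i) \<le>
      norm (iter (Suc m) i - auxi (Suc m) i) + norm (auxi (Suc m) i - start m i)"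
    using norm_triangle_ineq[of "iter (Suc m) i - auxi (Suc m) i" "auxi (Suc m) i - start m i"] by simp
  ultimately show ?thesis
    using iter_auxi[of "Suc m" i] unfolding start_def by (simp add: algebra_simps)
qed

definition Cc where "Cc = consensus_const CARD('n) k lam B0"

lemma Cc_nonneg: "0 \<le> Cc" using lam B0_nonneg by (simp add: Cc_def consensus_const_def)

lemma iter_consensus:
  assumes "m \<le> M"
  shows "norm (iter m i - iter m j) \<le> Cc * err"
proof -
  have "norm (iter m i - iter m j) \<le> 2 * real CARD('n) * ((4 + real k * B0) * err) / (1 - second_eigenvalue A)"
    by (rule consensus[where X=iter and c=c and M=M])
       (use network_facts[OF net] lam start_0 iter_step assms B0_nonneg err_pos in auto)
  then show ?thesis by (simp add: Cc_def consensus_const_def network_facts(5)[OF net] mult.assoc)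
qed

text \<open>The squared distance of the two arguments of the projection is at most a multiple of \<open>\<epsilon>\<close>, so the
  second factor of the assumed number of calls is bounded by a constant.\<close>

lemma calls_bound:
  assumes "m < M"
  shows "real (calls L (P (start m i) (target m i))) \<le> 27 * R\<^sup>2 / \<epsilon> * ((2 + real k * B0)^4 / 4 + 1)"
proof -
  let ?a = "(norm (start m i - target m i))\<^sup>2"
  have ep: "0 < \<epsilon>" using err_pos by (simp add: eps_err)
  have "norm (start m i - target m i) \<le> (2 + real k * B0) * err"
    using target_start[OF assms, of i] by (simp add: norm_minus_commute)
  then have "?a \<le> ((2 + real k * B0) * err)\<^sup>2" by (rule power_mono) simp
  then have a: "?a \<le> (2 + real k * B0)\<^sup>2 * \<epsilon>" by (simp add: eps_err power_mult_distrib)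
  have "?a * (?a - \<epsilon>) \<le> ?a * ?a" using ep by (intro mult_left_mono) auto
  also have "\<dots> \<le> ((2 + real k * B0)\<^sup>2 * \<epsilon>) * ((2 + real k * B0)\<^sup>2 * \<epsilon>)"
    using a less_imp_le[OF ep] by (intro mult_mono) auto
  also have "\<dots> = (2 + real k * B0)^4 / 4 * (4 * \<epsilon>\<^sup>2)"
    by (simp add: power2_eq_square power4_eq_xxxx)
  finally have "?a * (?a - \<epsilon>) / (4 * \<epsilon>\<^sup>2) \<le> (2 + real k * B0)^4 / 4"
    using ep by (simp add: pos_divide_le_eq)
  then have m: "max 1 (?a * (?a - \<epsilon>) / (4 * \<epsilon>\<^sup>2) + 1) \<le> (2 + real k * B0)^4 / 4 + 1"
    by simp
  have n: "real (nat \<lceil>27 * R\<^sup>2 / \<epsilon> - 2\<rceil>) \<le> 27 * R\<^sup>2 / \<epsilon>"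
  proof -
    have "0 \<le> 27 * R\<^sup>2 / \<epsilon>" using ep by simp
    then show ?thesis using ceiling_correct[of "27 * R\<^sup>2 / \<epsilon> - 2"] by linarith
  qed
  show ?thesis
    by (rule order_trans[OF projection_facts(4)[OF start_in] mult_mono[OF n m]]) (use ep in auto)
qed

lemma loo_bound:
  assumes "m \<le> M"
  shows "real (loo_count (st m i)) \<le> real m * (27 * R\<^sup>2 / \<epsilon> * ((2 + real k * B0)^4 / 4 + 1))"
  using assms
proof (induction m)
  case (Suc m)
  let ?Y = "27 * R\<^sup>2 / \<epsilon> * ((2 + real k * B0)^4 / 4 + 1)"
  have "real (loo_count (st (Suc m) i)) \<le> real m * ?Y + ?Y"
    unfolding step(3) of_nat_add using Suc calls_bound[of m i] by (intro add_mono) auto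
  also have "\<dots> = real (Suc m) * ?Y" by (simp only: of_nat_Suc distrib_right)
  finally show ?case .
qed (simp add: start_0)

text \<open>The one-step inequality of projected gradient descent, summed over the network. Projecting does not
  increase the distance to \<open>z\<close>, and by Jensen's inequality and double stochasticity averaging does
  not increase the sum of the squared distances. Every block gradient must be paired with the iterate at
  which it was sampled instead of the average of the auxiliary points; these are at most
  \<open>(2 + Cc) err\<close> apart.\<close>

lemma energy_step:
  assumes "m < M" and z: "z \<in> S"
  shows "(\<Sum>i\<in>UNIV. (norm (auxi (Suc m) i - z))\<^sup>2) \<le>
    (\<Sum>i\<in>UNIV. (norm (auxi m i - z))\<^sup>2) -
    2 * \<eta> * (\<Sum>i\<in>UNIV. grad m i \<bullet> (z - iter m i)) +
    real CARD('n) * (2 * (\<eta> * grad_max * (2 + Cc) * err) + (\<eta> * grad_max)\<^sup>2)"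
proof -
  define y where "y i = (\<Sum>j\<in>UNIV. A $ i $ j *\<^sub>R auxi m j)" for i
  note nf = network_facts[OF net]
  have ind: "(norm (auxi (Suc m) i - z))\<^sup>2 \<le> (\<Sum>j\<in>UNIV. A $ i $ j * (norm (auxi m j - z))\<^sup>2)
      - 2 * \<eta> * (grad m i \<bullet> (z - iter m i)) + (2 * (\<eta> * grad_max * (2 + Cc) * err) + (\<eta> * grad_max)\<^sup>2)" for i
  proof -
    have g: "norm (grad m i) \<le> grad_max" by (rule grad_bound[OF assms(1)])
    have "(norm (auxi (Suc m) i - z))\<^sup>2 \<le> (norm ((y i - z) + \<eta> *\<^sub>R grad m i))\<^sup>2"
      using projection_facts(3)[OF start_in z, of m i] by (simp add: target_def y_def algebra_simps)
    also have "\<dots> = (norm (y i - z))\<^sup>2 + 2 * \<eta> * (grad m i \<bullet> (y i - z)) + (\<eta> * norm (grad m i))\<^sup>2"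
      unfolding power_mult_distrib power2_norm_eq_inner
      by (simp add: inner_add inner_commute power2_eq_square)
    also have "(norm (y i - z))\<^sup>2 \<le> (\<Sum>j\<in>UNIV. A $ i $ j * (norm (auxi m j - z))\<^sup>2)"
    proof -
      have "y i - z = (\<Sum>j\<in>UNIV. A $ i $ j *\<^sub>R (auxi m j - z))"
        by (simp add: y_def scaleR_diff_right sum_subtractf nf(3) flip: scaleR_sum_left)
      then show ?thesis using norm_sq_convex_sum_le[of "\<lambda>j. A $ i $ j" "\<lambda>j. auxi m j - z"] nf by simp
    qed
    also have "(\<eta> * norm (grad m i))\<^sup>2 \<le> (\<eta> * grad_max)\<^sup>2"
      using g pos by (intro power_mono mult_left_mono) auto
    also have "2 * \<eta> * (grad m i \<bullet> (y i - z)) \<le> - 2 * \<eta> * (grad m i \<bullet> (z - iter m i)) + 2 * (\<eta> * grad_max * (2 + Cc) * err)"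
    proof -
      have "y i - iter m i = (\<Sum>j\<in>UNIV. A $ i $ j *\<^sub>R (auxi m j - iter m i))"
        by (simp add: y_def scaleR_diff_right sum_subtractf nf(3) flip: scaleR_sum_left)
      also have "norm \<dots> \<le> (2 + Cc) * err"
      proof (intro norm_convex_sum_le nf)
        fix j
        have "norm (auxi m j - iter m i) \<le> norm (iter m j - auxi m j) + norm (iter m j - iter m i)"
          using norm_triangle_ineq4[of "iter m j - iter m i" "iter m j - auxi m j"] by simp
        then show "norm (auxi m j - iter m i) \<le> (2 + Cc) * err"
          using iter_auxi[of m j] iter_consensus[of m j i] assms(1) by (simp add: distrib_right)
      qed
      finally have "norm (y i - iter m i) \<le> (2 + Cc) * err" .
      then have "grad m i \<bullet> (y i - iter m i) \<le> grad_max * ((2 + Cc) * err)"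
        using g grad_max_nonneg by (intro order_trans[OF norm_cauchy_schwarz mult_mono]) auto
      then have "\<eta> * (grad m i \<bullet> (y i - iter m i)) \<le> \<eta> * (grad_max * ((2 + Cc) * err))"
        using pos by (intro mult_left_mono) auto
      then show ?thesis by (simp add: inner_diff_right algebra_simps)
    qed
    finally show ?thesis by simp
  qed
  have "(\<Sum>i\<in>UNIV. (norm (auxi (Suc m) i - z))\<^sup>2) \<le> (\<Sum>i\<in>UNIV. (\<Sum>j\<in>UNIV. A $ i $ j * (norm (auxi m j - z))\<^sup>2)
      - 2 * \<eta> * (grad m i \<bullet> (z - iter m i)) + (2 * (\<eta> * grad_max * (2 + Cc) * err) + (\<eta> * grad_max)\<^sup>2))"
    by (intro sum_mono ind)
  also have "\<dots> = (\<Sum>i\<in>UNIV. \<Sum>j\<in>UNIV. A $ i $ j * (norm (auxi m j - z))\<^sup>2)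
      - 2 * \<eta> * (\<Sum>i\<in>UNIV. grad m i \<bullet> (z - iter m i)) + real CARD('n) * (2 * (\<eta> * grad_max * (2 + Cc) * err) + (\<eta> * grad_max)\<^sup>2)"
    by (simp only: sum.distrib sum_subtractf sum_distrib_left sum_constant distrib_left)
  also have "(\<Sum>i\<in>UNIV. \<Sum>j\<in>UNIV. A $ i $ j * (norm (auxi m j - z))\<^sup>2) = (\<Sum>j\<in>UNIV. (norm (auxi m j - z))\<^sup>2)"
    by (subst sum.swap) (simp add: nf(4) flip: sum_distrib_right)
  finally show ?thesis .
qed

lemma linear_regret:
  assumes z: "z \<in> S"
  shows "(\<Sum>m<M. \<Sum>i\<in>UNIV. grad m i \<bullet> (z - iter m i)) \<le>
    real CARD('n) * (2 * R\<^sup>2 / \<eta> + real M * (grad_max * (2 + Cc) * err + \<eta> * grad_max\<^sup>2 / 2))"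
proof -
  define X where "X = 2 * (\<eta> * grad_max * (2 + Cc) * err) + (\<eta> * grad_max)\<^sup>2"
  have "(\<Sum>i\<in>UNIV. (norm (auxi n i - z))\<^sup>2) + 2 * \<eta> * (\<Sum>m<n. \<Sum>i\<in>UNIV. grad m i \<bullet> (z - iter m i))
      \<le> (\<Sum>i\<in>(UNIV::'n set). (norm (c - z))\<^sup>2) + real n * (real CARD('n) * X)" if "n \<le> M" for n
    using that
  proof (induction n)
    case (Suc n)
    then show ?case using energy_step[of n z] z by (simp add: X_def distrib_left distrib_right)
  qed (simp add: start_0)
  from this[of M]
  have 1: "(\<Sum>i\<in>UNIV. (norm (auxi M i - z))\<^sup>2) + 2 * \<eta> * (\<Sum>m<M. \<Sum>i\<in>UNIV. grad m i \<bullet> (z - iter m i))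
      \<le> real CARD('n) * (norm (c - z))\<^sup>2 + real M * (real CARD('n) * X)" by simp
  have "0 \<le> (\<Sum>i\<in>UNIV. (norm (auxi M i - z))\<^sup>2)" by (intro sum_nonneg) simp
  moreover have "(norm (c - z))\<^sup>2 \<le> (2 * R)\<^sup>2"
    using norm_triangle_ineq4[of c z] S(3)[OF S(2)] S(3)[OF z] by (intro power_mono) auto
  then have "real CARD('n) * (norm (c - z))\<^sup>2 \<le> real CARD('n) * (2 * R)\<^sup>2" by (intro mult_left_mono) auto
  ultimately have "2 * \<eta> * (\<Sum>m<M. \<Sum>i\<in>UNIV. grad m i \<bullet> (z - iter m i))
      \<le> real CARD('n) * (2 * R)\<^sup>2 + real M * (real CARD('n) * X)" using 1 by linarith
  also have "\<dots> = 2 * \<eta> * (real CARD('n) * (2 * R\<^sup>2 / \<eta> + real M * (grad_max * (2 + Cc) * err + \<eta> * grad_max\<^sup>2 / 2)))"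
    using pos by (simp add: X_def field_simps power2_eq_square)
  finally show ?thesis using pos by simp
qed

end

section \<open>One round of zeroth-order feedback\<close>

lemma bounded_continuous_integrable:
  fixes H :: "'a::{second_countable_topology,t2_space} \<Rightarrow> real"
  assumes M: "finite_measure M" and Y: "Y \<in> borel_measurable M" "\<And>\<omega>. \<omega> \<in> space M \<Longrightarrow> Y \<omega> \<in> C"
    and C: "compact C" and H: "continuous_on UNIV H"
  shows "integrable M (\<lambda>\<omega>. H (Y \<omega>))"
proof -
  have "bounded (H ` C)"
    using C H by (intro compact_imp_bounded compact_continuous_image) (auto intro: continuous_on_subset)
  then obtain B where B: "\<And>y. y \<in> C \<Longrightarrow> norm (H y) \<le> B"
    unfolding bounded_iff by blast
  have [measurable]: "H \<in> borel_measurable borel" by (rule borel_measurable_continuous_onI[OF H])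
  show ?thesis
    using Y B by (intro finite_measure.integrable_const_bound[OF M, where B=B]) (auto intro!: AE_I2)
qed

lemma (in prob_space) independent_pair_law:
  assumes X: "X \<in> measurable M S" and Y: "Y \<in> measurable M T"
    and ind: "indep_set {X -` B \<inter> space M |B. B \<in> sets S} {Y -` B \<inter> space M |B. B \<in> sets T}"
  shows "distr M S X \<Otimes>\<^sub>M distr M T Y = distr M (S \<Otimes>\<^sub>M T) (\<lambda>\<omega>. (X \<omega>, Y \<omega>))"
proof (rule pair_measure_eqI)
  interpret X: prob_space "distr M S X" by (rule prob_space_distr[OF X])
  interpret Y: prob_space "distr M T Y" by (rule prob_space_distr[OF Y])
  show "sigma_finite_measure (distr M S X)" "sigma_finite_measure (distr M T Y)" by unfold_locales
  show "sets (distr M S X \<Otimes>\<^sub>M distr M T Y) = sets (distr M (S \<Otimes>\<^sub>M T) (\<lambda>\<omega>. (X \<omega>, Y \<omega>)))"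
    by (simp cong: sets_pair_measure_cong)
  fix A B assume "A \<in> sets (distr M S X)" "B \<in> sets (distr M T Y)"
  then have A: "A \<in> sets S" and B: "B \<in> sets T" by simp_all
  have XY: "(\<lambda>\<omega>. (X \<omega>, Y \<omega>)) \<in> M \<rightarrow>\<^sub>M S \<Otimes>\<^sub>M T" using X Y by (rule measurable_Pair)
  have "prob ((X -` A \<inter> space M) \<inter> (Y -` B \<inter> space M)) = prob (X -` A \<inter> space M) * prob (Y -` B \<inter> space M)"
    by (rule indep_setD[OF ind]) (use A B in blast)+
  moreover have "(\<lambda>\<omega>. (X \<omega>, Y \<omega>)) -` (A \<times> B) \<inter> space M = (X -` A \<inter> space M) \<inter> (Y -` B \<inter> space M)"
    by auto
  ultimately show "emeasure (distr M S X) A * emeasure (distr M T Y) B =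
      emeasure (distr M (S \<Otimes>\<^sub>M T) (\<lambda>\<omega>. (X \<omega>, Y \<omega>))) (A \<times> B)"
    using A B X Y XY by (simp add: emeasure_distr emeasure_eq_measure ennreal_mult)
qed

lemma (in prob_space) fresh_sample_law:
  fixes X :: "'a \<Rightarrow> real^'d" and V :: "'a \<Rightarrow> real^'d" and Z :: "'a \<Rightarrow> real"
  assumes sub: "subalgebra M F" and X: "X \<in> borel_measurable F"
    and V: "V \<in> borel_measurable M" and Z: "Z \<in> borel_measurable M"
    and ind: "indep_set (sets F) {(\<lambda>\<omega>. (V \<omega>, Z \<omega>)) -` B \<inter> space M |B. B \<in> sets borel}"
    and ind2: "indep_set {V -` B \<inter> space M |B. B \<in> sets borel} {Z -` B \<inter> space M |B. B \<in> sets borel}"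
  shows "distr M (borel \<Otimes>\<^sub>M (borel \<Otimes>\<^sub>M borel)) (\<lambda>\<omega>. (X \<omega>, V \<omega>, Z \<omega>)) =
    distr M borel X \<Otimes>\<^sub>M (distr M borel V \<Otimes>\<^sub>M distr M borel Z)"
proof -
  have XF: "{X -` B \<inter> space M |B. B \<in> sets borel} \<subseteq> sets F"
    using measurable_sets[OF X] sub by (auto simp: subalgebra_def)
  have "indep_set {X -` B \<inter> space M |B. B \<in> sets borel}
      {(\<lambda>\<omega>. (V \<omega>, Z \<omega>)) -` B \<inter> space M |B. B \<in> sets borel}"
  proof (rule indep_setI)
    show "{X -` B \<inter> space M |B. B \<in> sets borel} \<subseteq> events"
      using XF indep_setD_ev1[OF ind] by (rule order_trans)
    show "prob (a \<inter> b) = prob a * prob b"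
      if "a \<in> {X -` B \<inter> space M |B. B \<in> sets borel}"
        "b \<in> {(\<lambda>\<omega>. (V \<omega>, Z \<omega>)) -` B \<inter> space M |B. B \<in> sets borel}" for a b
      using subsetD[OF XF that(1)] that(2) by (rule indep_setD[OF ind])
  qed (rule indep_setD_ev2[OF ind])
  then have "distr M borel X \<Otimes>\<^sub>M distr M borel (\<lambda>\<omega>. (V \<omega>, Z \<omega>)) = distr M (borel \<Otimes>\<^sub>M borel) (\<lambda>\<omega>. (X \<omega>, V \<omega>, Z \<omega>))"
    by (intro independent_pair_law measurable_from_subalg[OF sub X] borel_measurable_Pair V Z)
  then show ?thesis
    unfolding independent_pair_law[OF V Z ind2] by (simp add: borel_prod)
qed

text \<open>The number \<open>\<phi>\<close> stands for the value at the unperturbed query point, which is cancelled by the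
  vanishing mean of \<open>v\<close>.\<close>

lemma sphere_estimator_mean:
  assumes V: "subspace V" "uniform_on_sphere V \<mu>" and y: "y \<in> V"
  shows "(\<integral>v. (\<phi> + real (dim V) * (g \<bullet> v)) * (y \<bullet> v) \<partial>\<mu>) = g \<bullet> y"
proof -
  have "(\<integral>v. (\<phi> + real (dim V) * (g \<bullet> v)) * (y \<bullet> v) \<partial>\<mu>) =
      (\<integral>v. \<phi> * (y \<bullet> v) + real (dim V) * ((g \<bullet> v) * (y \<bullet> v)) \<partial>\<mu>)"
    by (simp add: algebra_simps)
  also have "\<dots> = \<phi> * (\<integral>v. y \<bullet> v \<partial>\<mu>) + real (dim V) * (\<integral>v. (g \<bullet> v) * (y \<bullet> v) \<partial>\<mu>)"
    using sphere_linear_integrable[OF V, of y] sphere_quadratic_integrable[OF V, of g y] by simp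
  finally show ?thesis
    by (simp add: sphere_first_moment[OF V] sphere_second_moment[OF V y])
qed

text \<open>\<open>H\<close> is the first-order model of the one-point estimate paired with \<open>Y\<close>. The past, the direction
  and \<open>z\<close> have a product law, so the direction can be integrated out first, then \<open>z\<close>.\<close>

lemma (in prob_space) fresh_estimator_mean:
  fixes X :: "'a \<Rightarrow> real^'d" and V :: "'a \<Rightarrow> real^'d" and Z :: "'a \<Rightarrow> real"
    and \<phi> :: "(real^'d) \<times> real \<Rightarrow> real" and g :: "(real^'d) \<times> real \<Rightarrow> real^'d"
  assumes sub: "subalgebra M F" and X: "X \<in> borel_measurable F" "\<And>\<omega>. \<omega> \<in> space M \<Longrightarrow> X \<omega> \<in> K" "compact K"
    and V: "V \<in> borel_measurable M" "\<And>\<omega>. \<omega> \<in> space M \<Longrightarrow> norm (V \<omega>) = 1"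
    and Z: "Z \<in> borel_measurable M" "\<And>\<omega>. \<omega> \<in> space M \<Longrightarrow> Z \<omega> \<in> {0..1}"
    and ind: "indep_set (sets F) {(\<lambda>\<omega>. (V \<omega>, Z \<omega>)) -` B \<inter> space M |B. B \<in> sets borel}"
    and ind2: "indep_set {V -` B \<inter> space M |B. B \<in> sets borel} {Z -` B \<inter> space M |B. B \<in> sets borel}"
    and W: "subspace W" "uniform_on_sphere W (distr M borel V)"
    and \<rho>: "\<rho> \<in> borel_measurable borel" "\<And>x. 0 \<le> \<rho> x" "distributed M lborel Z (\<lambda>x. ennreal (\<rho> x))"
    and \<phi>: "continuous_on UNIV \<phi>" and g: "continuous_on UNIV g"
    and Y: "continuous_on UNIV Y" "\<And>x. x \<in> K \<Longrightarrow> Y x \<in> W"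
  defines "H \<equiv> \<lambda>\<omega>. (\<phi> (X \<omega>, Z \<omega>) + real (dim W) * (g (X \<omega>, Z \<omega>) \<bullet> V \<omega>)) * (Y (X \<omega>) \<bullet> V \<omega>)"
  defines "\<Psi> \<equiv> \<lambda>\<omega>. \<integral>z. \<rho> z * (g (X \<omega>, z) \<bullet> Y (X \<omega>)) \<partial>lborel"
  shows "integrable M H" "integrable M \<Psi>" "expectation H = expectation \<Psi>"
proof -
  have [measurable]: "X \<in> borel_measurable M" "V \<in> borel_measurable M" "Z \<in> borel_measurable M"
    using measurable_from_subalg[OF sub X(1)] V Z by auto
  have [measurable]: "\<phi> \<in> borel_measurable borel" "g \<in> borel_measurable borel" "Y \<in> borel_measurable borel"
    using \<phi> g Y(1) by (auto intro: borel_measurable_continuous_onI)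
  have [measurable]: "\<phi> \<in> borel_measurable (borel \<Otimes>\<^sub>M borel)" "g \<in> borel_measurable (borel \<Otimes>\<^sub>M borel)"
    unfolding borel_prod by measurable
  define h where "h = (\<lambda>(x, v, z). (\<phi> (x, z) + real (dim W) * (g (x, z) \<bullet> v)) * (Y x \<bullet> v))"
  let ?PX = "distr M borel X" and ?PV = "distr M borel V" and ?PZ = "distr M borel Z"
  interpret PX: prob_space ?PX by (rule prob_space_distr) measurable
  interpret PV: prob_space ?PV by (rule prob_space_distr) measurable
  interpret PZ: prob_space ?PZ by (rule prob_space_distr) measurable
  interpret VZ: pair_prob_space ?PV ?PZ ..
  interpret XVZ: pair_prob_space ?PX "?PV \<Otimes>\<^sub>M ?PZ" ..
  have hcont: "continuous_on UNIV h"
    unfolding h_def split_beta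
    by (intro continuous_intros continuous_on_compose2[OF \<phi>] continuous_on_compose2[OF g]
        continuous_on_compose2[OF Y(1)]) auto
  have hH: "H \<omega> = h (X \<omega>, V \<omega>, Z \<omega>)" for \<omega> by (simp add: H_def h_def)
  show int_H: "integrable M H"
    unfolding hH
    by (rule bounded_continuous_integrable[OF finite_measure_axioms _ _ _ hcont, where C="K \<times> sphere 0 1 \<times> {0..1}"])
       (use X V Z in \<open>auto intro!: compact_Times borel_measurable_Pair\<close>)
  have [measurable]: "h \<in> borel_measurable (borel \<Otimes>\<^sub>M (borel \<Otimes>\<^sub>M borel))"
    using borel_measurable_continuous_onI[OF hcont] by (simp add: borel_prod)
  note law = fresh_sample_law[OF sub X(1) V(1) Z(1) ind ind2]
  have mXVZ: "(\<lambda>\<omega>. (X \<omega>, V \<omega>, Z \<omega>)) \<in> M \<rightarrow>\<^sub>M borel \<Otimes>\<^sub>M (borel \<Otimes>\<^sub>M borel)" by measurable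
  have int_h: "integrable (?PX \<Otimes>\<^sub>M (?PV \<Otimes>\<^sub>M ?PZ)) h"
    unfolding law[symmetric] using int_H hH mXVZ by (subst integrable_distr_eq) (auto simp: hH[abs_def])
  define \<psi> where "\<psi> x = (\<integral>z. g (x, z) \<bullet> Y x \<partial>?PZ)" for x
  have [measurable]: "\<psi> \<in> borel_measurable borel"
  proof -
    have "(\<lambda>(x, z). g (x, z) \<bullet> Y x) \<in> borel_measurable (borel \<Otimes>\<^sub>M borel)" by measurable
    then have "(\<lambda>(x, z). g (x, z) \<bullet> Y x) \<in> borel_measurable (borel \<Otimes>\<^sub>M ?PZ)"
      by (subst measurable_cong_sets[OF sets_pair_measure_cong refl]) auto
    then show ?thesis
      unfolding \<psi>_def by (rule PZ.borel_measurable_lebesgue_integral)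
  qed
  have inner: "AE x in ?PX. (\<integral>vz. h (x, vz) \<partial>(?PV \<Otimes>\<^sub>M ?PZ)) = \<psi> x"
  proof -
    have "AE x in ?PX. x \<in> K"
      using X compact_imp_closed[OF X(3)] by (subst AE_distr_iff) (auto intro!: AE_I2)
    then show ?thesis using XVZ.AE_integrable_fst'[OF int_h]
    proof eventually_elim
      case (elim x)
      then have i: "integrable (?PV \<Otimes>\<^sub>M ?PZ) (\<lambda>(v, z). h (x, v, z))"
        by (subst case_prod_unfold) simp
      have eq: "(\<lambda>(v, z). h (x, v, z)) = (\<lambda>vz. h (x, vz))" by auto
      have "(\<integral>vz. h (x, vz) \<partial>(?PV \<Otimes>\<^sub>M ?PZ)) = (\<integral>z. (\<integral>v. h (x, v, z) \<partial>?PV) \<partial>?PZ)"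
        using VZ.integral_snd[OF i] unfolding eq by simp
      also have "\<dots> = \<psi> x"
        unfolding \<psi>_def h_def using sphere_estimator_mean[OF W Y(2)[OF elim(1)]] by simp
      finally show ?case .
    qed
  qed
  have \<psi>\<Psi>: "\<psi> (X \<omega>) = \<Psi> \<omega>" for \<omega>
  proof -
    have "\<psi> (X \<omega>) = (\<integral>z. g (X \<omega>, z) \<bullet> Y (X \<omega>) \<partial>density lborel (\<lambda>x. ennreal (\<rho> x)))"
      unfolding \<psi>_def using distributed_distr_eq_density[OF \<rho>(3)] by (simp cong: distr_cong)
    also have "\<dots> = \<Psi> \<omega>"
      unfolding \<Psi>_def using \<rho> by (subst integral_density) auto
    finally show ?thesis .
  qed
  have "integrable ?PX (\<lambda>x. \<integral>vz. h (x, vz) \<partial>(?PV \<Otimes>\<^sub>M ?PZ))"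
    by (rule XVZ.integrable_fst'[OF int_h])
  then have "integrable ?PX \<psi>"
    using inner by (subst integrable_cong_AE[symmetric]) auto
  then have "integrable M (\<lambda>\<omega>. \<psi> (X \<omega>))" by (subst (asm) integrable_distr_eq) auto
  then show "integrable M \<Psi>" by (simp add: \<psi>\<Psi>)
  have "expectation H = integral\<^sup>L (?PX \<Otimes>\<^sub>M (?PV \<Otimes>\<^sub>M ?PZ)) h"
    unfolding law[symmetric] using mXVZ by (subst integral_distr) (simp_all add: hH[abs_def])
  also have "\<dots> = (\<integral>x. (\<integral>vz. h (x, vz) \<partial>(?PV \<Otimes>\<^sub>M ?PZ)) \<partial>?PX)"
    by (rule XVZ.integral_fst'[OF int_h, symmetric])
  also have "\<dots> = (\<integral>x. \<psi> x \<partial>?PX)"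
    using borel_measurable_integrable[OF XVZ.integrable_fst'[OF int_h]]
    by (intro integral_cong_AE inner) auto
  also have "\<dots> = expectation (\<lambda>\<omega>. \<psi> (X \<omega>))" by (rule integral_distr) auto
  finally show "expectation H = expectation \<Psi>" by (simp add: \<psi>\<Psi>)
qed

text \<open>The objective at the perturbed query point is seen only through the conditional mean of the
  response, which is compared with the first-order model \<open>\<phi> + \<delta> (g \<bullet> V)\<close>. The model is continuous on
  the whole space, whereas a convex domain of the objective may fail to be a Borel set.\<close>

lemma (in prob_space) one_round_estimate:
  fixes X :: "'a \<Rightarrow> real^'d" and V :: "'a \<Rightarrow> real^'d" and Z q :: "'a \<Rightarrow> real"
    and \<phi> :: "(real^'d) \<times> real \<Rightarrow> real" and g :: "(real^'d) \<times> real \<Rightarrow> real^'d"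
  assumes sub: "subalgebra M F" and X: "X \<in> borel_measurable F" "\<And>\<omega>. \<omega> \<in> space M \<Longrightarrow> X \<omega> \<in> K" "compact K"
    and subG: "subalgebra M N" "subalgebra N F"
    and V: "V \<in> borel_measurable N" "\<And>\<omega>. \<omega> \<in> space M \<Longrightarrow> norm (V \<omega>) = 1"
    and Z: "Z \<in> borel_measurable N" "\<And>\<omega>. \<omega> \<in> space M \<Longrightarrow> Z \<omega> \<in> {0..1}"
    and ind: "indep_set (sets F) {(\<lambda>\<omega>. (V \<omega>, Z \<omega>)) -` B \<inter> space M |B. B \<in> sets borel}"
    and ind2: "indep_set {V -` B \<inter> space M |B. B \<in> sets borel} {Z -` B \<inter> space M |B. B \<in> sets borel}"
    and W: "subspace W" "uniform_on_sphere W (distr M borel V)"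
    and \<rho>: "\<rho> \<in> borel_measurable borel" "\<And>x. 0 \<le> \<rho> x" "distributed M lborel Z (\<lambda>x. ennreal (\<rho> x))"
    and \<phi>: "continuous_on UNIV \<phi>" and g: "continuous_on UNIV g"
    and Y: "continuous_on UNIV Y" "\<And>x. x \<in> K \<Longrightarrow> Y x \<in> W" "\<And>x. x \<in> K \<Longrightarrow> norm (Y x) \<le> B"
    and q: "q \<in> borel_measurable M" "\<And>\<omega>. \<omega> \<in> space M \<Longrightarrow> \<bar>q \<omega>\<bar> \<le> B0"
    and \<delta>: "0 < \<delta>"
    and mean: "AE \<omega> in M. \<bar>real_cond_exp M N q \<omega> - \<phi> (X \<omega>, Z \<omega>) - \<delta> * (g (X \<omega>, Z \<omega>) \<bullet> V \<omega>)\<bar> \<le> e"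
  defines "\<Psi> \<equiv> \<lambda>\<omega>. \<integral>z. \<rho> z * (g (X \<omega>, z) \<bullet> Y (X \<omega>)) \<partial>lborel"
  defines "Q \<equiv> \<lambda>\<omega>. ((real (dim W) / \<delta> * q \<omega>) *\<^sub>R V \<omega>) \<bullet> Y (X \<omega>)"
  shows "integrable M Q" "integrable M \<Psi>" "expectation \<Psi> \<le> expectation Q + real (dim W) / \<delta> * e * B"
proof -
  let ?k = "real (dim W)"
  have VM: "V \<in> borel_measurable M" and ZM: "Z \<in> borel_measurable M"
    using measurable_from_subalg[OF subG(1)] V Z by auto
  have XN: "X \<in> borel_measurable N" by (rule measurable_from_subalg[OF subG(2) X(1)])
  have [measurable]: "X \<in> borel_measurable M" "V \<in> borel_measurable M" "Z \<in> borel_measurable M" "q \<in> borel_measurable M"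
    using measurable_from_subalg[OF sub X(1)] VM ZM q by auto
  have [measurable]: "Y \<in> borel_measurable borel"
    using Y(1) by (rule borel_measurable_continuous_onI)
  have "continuous_on UNIV (\<lambda>x. ?k / \<delta> * \<phi> x)" using \<phi> by (intro continuous_intros)
  note est = fresh_estimator_mean[OF sub X VM V(2) ZM Z(2) ind ind2 W \<rho> this g Y(1,2)]
  interpret sigma_finite_subalgebra M N
    by (rule finite_measure_subalgebra_is_sigma_finite)
       (simp add: finite_measure_subalgebra_def finite_measure_axioms finite_measure_subalgebra_axioms_def subG(1))
  define a where "a \<omega> = ?k / \<delta> * (Y (X \<omega>) \<bullet> V \<omega>)" for \<omega>
  have aN: "a \<in> borel_measurable N" unfolding a_def using V(1) XN by measurable
  have Qa: "Q \<omega> = a \<omega> * q \<omega>" for \<omega> by (simp add: Q_def a_def inner_commute)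
  have a_bound: "\<bar>a \<omega>\<bar> \<le> ?k / \<delta> * B" if "\<omega> \<in> space M" for \<omega>
  proof -
    have "\<bar>Y (X \<omega>) \<bullet> V \<omega>\<bar> \<le> norm (Y (X \<omega>)) * norm (V \<omega>)" by (rule Cauchy_Schwarz_ineq2)
    also have "\<dots> \<le> B" using Y(3)[OF X(2)[OF that]] V(2)[OF that] by simp
    finally have "?k / \<delta> * \<bar>Y (X \<omega>) \<bullet> V \<omega>\<bar> \<le> ?k / \<delta> * B"
      by (rule mult_left_mono) (use \<delta> in simp)
    then show ?thesis using \<delta> by (simp add: a_def abs_mult)
  qed
  have B0: "0 \<le> B0" using q(2) not_empty by (meson abs_ge_zero all_not_in_conv order_trans)
  show int_Q: "integrable M Q"
  proof (rule integrable_const_bound[where B="?k / \<delta> * B * B0"])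
    show "AE \<omega> in M. norm (Q \<omega>) \<le> ?k / \<delta> * B * B0"
    proof (rule AE_I2)
      fix \<omega> assume \<omega>: "\<omega> \<in> space M"
      show "norm (Q \<omega>) \<le> ?k / \<delta> * B * B0"
        unfolding Qa real_norm_def abs_mult
        using a_bound[OF \<omega>] q(2)[OF \<omega>] abs_ge_zero[of "a \<omega>"] by (intro mult_mono) linarith+
    qed
  qed (simp add: Q_def)
  show "integrable M \<Psi>" using est(2) unfolding \<Psi>_def .
  have ce: "integrable M (\<lambda>\<omega>. a \<omega> * real_cond_exp M N q \<omega>)"
    "(\<integral>\<omega>. a \<omega> * real_cond_exp M N q \<omega> \<partial>M) = expectation Q"
    using real_cond_exp_intg[of a q, OF _ aN q(1)] int_Q by (simp_all add: Qa[abs_def])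
  let ?H = "\<lambda>\<omega>. (?k / \<delta> * \<phi> (X \<omega>, Z \<omega>) + ?k * (g (X \<omega>, Z \<omega>) \<bullet> V \<omega>)) * (Y (X \<omega>) \<bullet> V \<omega>)"
  have "expectation \<Psi> = expectation ?H" using est(3) unfolding \<Psi>_def by simp
  also have "\<dots> \<le> (\<integral>\<omega>. a \<omega> * real_cond_exp M N q \<omega> + ?k / \<delta> * e * B \<partial>M)"
  proof (rule integral_mono_AE)
    show "integrable M ?H" by (rule est(1))
    show "integrable M (\<lambda>\<omega>. a \<omega> * real_cond_exp M N q \<omega> + ?k / \<delta> * e * B)" using ce(1) by simp
    show "AE \<omega> in M. ?H \<omega> \<le> a \<omega> * real_cond_exp M N q \<omega> + ?k / \<delta> * e * B"
      using mean AE_space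
    proof eventually_elim
      case (elim \<omega>)
      let ?err = "real_cond_exp M N q \<omega> - \<phi> (X \<omega>, Z \<omega>) - \<delta> * (g (X \<omega>, Z \<omega>) \<bullet> V \<omega>)"
      have "?H \<omega> = a \<omega> * real_cond_exp M N q \<omega> - a \<omega> * ?err"
        using \<delta> by (simp add: a_def field_simps)
      moreover have "\<bar>a \<omega> * ?err\<bar> \<le> (?k / \<delta> * B) * e"
        unfolding abs_mult using a_bound[OF elim(2)] elim(1) abs_ge_zero[of "a \<omega>"]
        by (intro mult_mono) linarith+
      moreover have "(?k / \<delta> * B) * e = ?k / \<delta> * e * B" by simp
      ultimately show ?case by linarith
    qed
  qed
  also have "\<dots> = expectation Q + ?k / \<delta> * e * B"
    using ce by (simp add: prob_space)
  finally show "expectation \<Psi> \<le> expectation Q + ?k / \<delta> * e * B" .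
qed

section \<open>Feasible set, the two cases, and parameter tuning\<close>

lemma feasible_set_facts:
  assumes K: "feasible_set K c r R k" and \<delta>: "0 < \<delta>" "\<delta> < r"
  shows "compact K" "K \<subseteq> unit_cube" "c \<in> K" "\<And>x. x \<in> K \<Longrightarrow> norm x \<le> R" "0 \<le> R"
    "convex (shrunk K c r \<delta>)" "c \<in> shrunk K c r \<delta>" "shrunk K c r \<delta> \<subseteq> K"
    "subspace (direction_space K)" "dim (direction_space K) = k"
    "\<And>x y. x \<in> K \<Longrightarrow> y \<in> K \<Longrightarrow> y - x \<in> direction_space K"
proof -
  have cK: "convex K" and comp: "compact K" and c: "c \<in> K" and R: "R = (SUP x\<in>K. norm x)"
    using K rel_interior_subset unfolding feasible_set_def by blast+
  show "compact K" "K \<subseteq> unit_cube" "c \<in> K" "dim (direction_space K) = k"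
    using K c unfolding feasible_set_def by auto
  have bdd: "bdd_above (norm ` K)"
    using compact_imp_bounded[OF comp] by (auto simp: bounded_iff bdd_above_def)
  show nR: "norm x \<le> R" if "x \<in> K" for x
    unfolding R by (rule cSUP_upper[OF that bdd])
  show "0 \<le> R" using nR[OF c] norm_ge_zero order_trans by blast
  have \<delta>r: "0 \<le> \<delta> / r" "\<delta> / r \<le> 1" using \<delta> by auto
  have "shrunk K c r \<delta> = (\<lambda>x. (\<delta> / r) *\<^sub>R c + (1 - \<delta> / r) *\<^sub>R x) ` K"
    by (simp add: shrunk_def add.commute)
  then show "convex (shrunk K c r \<delta>)" using convex_affinity[OF cK] by simp
  show "c \<in> shrunk K c r \<delta>"
    unfolding shrunk_def using c by (intro image_eqI[of _ _ c]) (simp_all flip: scaleR_add_left)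
  show "shrunk K c r \<delta> \<subseteq> K"
    unfolding shrunk_def using convexD_alt[OF cK _ c \<delta>r] by auto
  have "direction_space K = (+) (- c) ` (affine hull K)"
  proof (intro equalityI subsetI)
    fix d assume "d \<in> direction_space K"
    then obtain x y where d: "d = y - x" and y: "y \<in> affine hull K" and x: "x \<in> affine hull K"
      by (auto simp: direction_space_def hull_inc)
    have "c + 1 *\<^sub>R (y - x) \<in> affine hull K"
      by (rule mem_affine_3_minus[OF affine_affine_hull hull_inc[OF c] y x])
    then show "d \<in> (+) (- c) ` (affine hull K)" by (intro image_eqI[of _ _ "c + (y - x)"]) (simp_all add: d)
  qed (use c in \<open>auto simp: direction_space_def\<close>)
  then show "subspace (direction_space K)"
    using affine_diffs_subspace[OF affine_affine_hull hull_inc[OF c]] by simp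
  show "y - x \<in> direction_space K" if "x \<in> K" "y \<in> K" for x y
    unfolding direction_space_def using that hull_inc[of y K] by blast
qed

lemma lipschitz_gradient_on_cube:
  assumes reg: "regular_objectives D L1 L2 T f" and t: "t \<in> {1..T}"
  shows "L1-lipschitz_on unit_cube (f t i)" "L2-lipschitz_on unit_cube (gradient_on unit_cube (f t i))"
    "x \<in> unit_cube \<Longrightarrow> y \<in> D \<Longrightarrow>
      \<bar>f t i y - f t i x - gradient_on unit_cube (f t i) x \<bullet> (y - x)\<bar> \<le> L2 * (norm (y - x))\<^sup>2"
proof -
  have D: "convex D" "unit_cube \<subseteq> D" and d: "f t i differentiable_on D"
    and L1: "L1-lipschitz_on D (f t i)" and L2: "L2-lipschitz_on D (gradient_on D (f t i))"
    using reg t unfolding regular_objectives_def by blast+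
  note eq = gradient_on_cube[OF d D(2)]
  show "L1-lipschitz_on unit_cube (f t i)" using L1 D(2) by (rule lipschitz_on_subset)
  show "L2-lipschitz_on unit_cube (gradient_on unit_cube (f t i))"
    by (rule lipschitz_on_transform[OF lipschitz_on_subset[OF L2 D(2)]]) (simp add: eq)
  show "\<bar>f t i y - f t i x - gradient_on unit_cube (f t i) x \<bullet> (y - x)\<bar> \<le> L2 * (norm (y - x))\<^sup>2"
    if "x \<in> unit_cube" "y \<in> D"
    unfolding eq[OF that(1)] by (rule lipschitz_gradient_taylor[OF D(1) d L2 _ that(2)]) (use that D(2) in auto)
qed

text \<open>What the rest of the argument has to know about the two cases. The factor \<open>\<beta>\<close> is
  \<open>(1 - exp (- \<gamma>)) / \<gamma>\<close> in the monotone case and \<open>3 / 8\<close> in the other.\<close>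

lemma case_linearization:
  fixes K :: "(real^'d) set" and f :: "nat \<Rightarrow> 'n \<Rightarrow> real^'d \<Rightarrow> real"
  assumes two_cases: "monotone_case \<gamma> K T f \<alpha> h p w \<or> (\<exists>u. nonmonotone_case u K T f \<alpha> h p w)"
    and K: "convex K" "K \<subseteq> unit_cube" and reg: "regular_objectives D L1 L2 T f"
  obtains \<beta> where "0 \<le> \<beta>" "\<beta> \<le> 1" "0 \<le> \<alpha>" "\<alpha> \<le> 1" "\<And>x. x \<in> K \<Longrightarrow> h x \<in> K"
    "\<And>x y. norm (h x - h y) \<le> norm (x - y)" "continuous_on UNIV h"
    "\<And>x z. x \<in> K \<Longrightarrow> z \<in> {0..1} \<Longrightarrow> w x z \<in> K" "continuous_on UNIV (\<lambda>(x, z). w x z)"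
    "(\<lambda>z. p z * indicator {0..1} z) \<in> borel_measurable borel" "\<And>z. 0 \<le> p z * indicator {0..1} z"
    "\<And>t i x u. t \<in> {1..T} \<Longrightarrow> x \<in> K \<Longrightarrow> u \<in> K \<Longrightarrow> \<alpha> * f t i u - f t i (h x) \<le>
       \<beta> * (\<integral>z. (p z * indicator {0..1} z) * (gradient_on unit_cube (f t i) (w x z) \<bullet> (u - x)) \<partial>lborel)"
  using two_cases
proof (elim disjE exE)
  assume A: "monotone_case \<gamma> K T f \<alpha> h p w"
  then have \<gamma>: "0 < \<gamma>" "\<gamma> \<le> 1" and 0: "0 \<in> K" and \<alpha>: "\<alpha> = 1 - exp (- \<gamma>)" and h: "h = (\<lambda>x. x)"
    and p: "p = (\<lambda>s. \<gamma> * exp (\<gamma> * (s - 1)) / (1 - exp (- \<gamma>)))" and w: "w = (\<lambda>x z. z *\<^sub>R x)"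
    by (simp_all add: monotone_case_def)
  show thesis
  proof (rule that[of "(1 - exp (- \<gamma>)) / \<gamma>"])
    show "0 \<le> (1 - exp (- \<gamma>)) / \<gamma>" using \<gamma> by simp
    show "(1 - exp (- \<gamma>)) / \<gamma> \<le> 1" using \<gamma> exp_ge_add_one_self[of "- \<gamma>"] by (simp add: field_simps)
    show "0 \<le> \<alpha>" "\<alpha> \<le> 1" using \<gamma> by (simp_all add: \<alpha>)
    show "w x z \<in> K" if "x \<in> K" "z \<in> {0..1}" for x z
      using convexD_alt[OF K(1) 0 that(1), of z] that(2) by (simp add: w)
    show "(\<lambda>z. p z * indicator {0..1} z) \<in> borel_measurable borel" unfolding p by measurable
    show "0 \<le> p z * indicator {0..1} z" for z using \<gamma> by (simp add: p indicator_def)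
    show "\<alpha> * f t i u - f t i (h x) \<le> (1 - exp (- \<gamma>)) / \<gamma> *
       (\<integral>z. (p z * indicator {0..1} z) * (gradient_on unit_cube (f t i) (w x z) \<bullet> (u - x)) \<partial>lborel)"
      if t: "t \<in> {1..T}" and xu: "x \<in> K" "u \<in> K" for t i x u
      unfolding \<alpha> h p w
      by (rule monotone_linearization[OF \<gamma>(1) _ _ _ lipschitz_gradient_on_cube(2)[OF reg t]])
        (use A t xu K(2) in \<open>auto simp: monotone_case_def\<close>)
  qed (auto simp: h w split_beta intro!: continuous_intros)
next
  fix a assume A: "nonmonotone_case a K T f \<alpha> h p w"
  then have a: "a \<in> K" and \<alpha>: "\<alpha> = (1 - infnorm a) / 4" and h: "h = (\<lambda>x. (1/2) *\<^sub>R (x + a))"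
    and p: "p = (\<lambda>s. 1 / (3 * (1 - s / 2) ^ 3))" and w: "w = (\<lambda>x z. (z / 2) *\<^sub>R (x - a) + a)"
    by (simp_all add: nonmonotone_case_def)
  have wK: "(z / 2) *\<^sub>R (x - a) + a \<in> K" if "x \<in> K" "z \<in> {0..1}" for x z
    using convexD_alt[OF K(1) a that(1), of "z / 2"] that(2) by (simp add: algebra_simps)
  show thesis
  proof (rule that[of "3 / 8"])
    have "infnorm a \<le> 1"
      unfolding infnorm_cart using a K(2) by (intro cSup_least) (auto simp: unit_cube_iff subset_iff)
    then show "0 \<le> \<alpha>" "\<alpha> \<le> 1" using infnorm_pos_le[of a] by (simp_all add: \<alpha>)
    show "h x \<in> K" if "x \<in> K" for x
      using convexD_alt[OF K(1) a that, of "1 / 2"] by (simp add: h algebra_simps)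
    show "norm (h x - h y) \<le> norm (x - y)" for x y
      by (simp add: h flip: scaleR_diff_right)
    show "w x z \<in> K" if "x \<in> K" "z \<in> {0..1}" for x z
      unfolding w by (rule wK[OF that])
    show "(\<lambda>z. p z * indicator {0..1} z) \<in> borel_measurable borel" unfolding p by measurable
    show "0 \<le> p z * indicator {0..1} z" for z by (simp add: p indicator_def)
    show "\<alpha> * f t i u - f t i (h x) \<le> 3 / 8 *
       (\<integral>z. (p z * indicator {0..1} z) * (gradient_on unit_cube (f t i) (w x z) \<bullet> (u - x)) \<partial>lborel)"
      if t: "t \<in> {1..T}" and xu: "x \<in> K" "u \<in> K" for t i x u
      unfolding \<alpha> h p w
      by (rule nonmonotone_linearization[OF _ _ lipschitz_gradient_on_cube(2)[OF reg t]])
        (use A a t xu K(2) in \<open>auto simp: nonmonotone_case_def\<close>)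
  qed (auto simp: h w split_beta intro!: continuous_intros)
qed

lemma tuning:
  assumes T: "0 < (T::nat)" and b: "real b = real T powr (1 - \<theta>)" and \<delta>: "\<delta> = real T powr (- \<theta> / 4)"
    and \<eta>: "\<eta> = \<delta> / sqrt (real b * real T)" and \<epsilon>: "\<epsilon> = (real b)\<^sup>2 * \<eta>\<^sup>2 / \<delta>\<^sup>2"
  shows "1 / \<eta> = real T powr (1 - \<theta> / 4)" "\<eta> * real T * real b / \<delta>\<^sup>2 = real T powr (1 - \<theta> / 4)"
    "\<delta> * real T = real T powr (1 - \<theta> / 4)" "real T / (\<epsilon> * real b) = real T powr (2 * \<theta>)"
    "real T / real b = real T powr \<theta>"
proof -
  let ?T = "real T"
  have T1: "?T = ?T powr 1" and Tp: "0 < ?T" using T by simp_all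
  have "real b * ?T = ?T powr (2 - \<theta>)"
    using powr_add[of ?T "1 - \<theta>" 1] T by (simp add: b)
  then have "sqrt (real b * ?T) = ?T powr (1 - \<theta> / 2)"
    using T by (simp add: powr_half_sqrt[symmetric] powr_powr diff_divide_distrib)
  then have \<eta>': "\<eta> = ?T powr (\<theta> / 4 - 1)"
    by (simp add: \<eta> \<delta> flip: powr_diff)
  show "1 / \<eta> = ?T powr (1 - \<theta> / 4)"
  proof -
    have "1 / \<eta> = ?T powr - (\<theta> / 4 - 1)"
      unfolding \<eta>' by (rule powr_minus_divide[symmetric])
    then show ?thesis by simp
  qed
  show "\<delta> * ?T = ?T powr (1 - \<theta> / 4)"
    using powr_add[of ?T "- \<theta> / 4" 1] T by (simp add: \<delta>)
  have \<delta>2: "\<delta>\<^sup>2 = ?T powr (- \<theta> / 2)" by (simp add: \<delta> power2_eq_square flip: powr_add)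
  have \<eta>2: "\<eta>\<^sup>2 = ?T powr (\<theta> / 2 - 2)" by (simp add: \<eta>' power2_eq_square flip: powr_add)
  have b2: "(real b)\<^sup>2 = ?T powr (2 - 2 * \<theta>)" by (simp add: b power2_eq_square flip: powr_add)
  have "\<eta> * ?T * real b / \<delta>\<^sup>2 = ?T powr (\<theta> / 4 - 1) * ?T powr 1 * ?T powr (1 - \<theta>) / ?T powr (- \<theta> / 2)"
    using T by (simp add: \<eta>' b \<delta>2)
  also have "\<dots> = ?T powr (1 - \<theta> / 4)"
    by (simp only: powr_add[symmetric] powr_diff[symmetric]) (simp add: field_simps)
  finally show "\<eta> * ?T * real b / \<delta>\<^sup>2 = ?T powr (1 - \<theta> / 4)" .
  have "?T / (\<epsilon> * real b) = ?T powr 1 / (?T powr (2 - 2 * \<theta>) * ?T powr (\<theta> / 2 - 2) / ?T powr (- \<theta> / 2) * ?T powr (1 - \<theta>))"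
    unfolding \<epsilon> unfolding b2 \<eta>2 \<delta>2 unfolding b using T by simp
  also have "\<dots> = ?T powr (2 * \<theta>)"
    by (simp only: powr_add[symmetric] powr_diff[symmetric]) (simp add: field_simps)
  finally show "?T / (\<epsilon> * real b) = ?T powr (2 * \<theta>)" .
  show "?T / real b = ?T powr \<theta>"
    using powr_diff[of ?T 1 "1 - \<theta>"] T by (simp add: b)
qed

lemma sum_over_blocks:
  fixes \<phi> :: "nat \<Rightarrow> 'a::comm_monoid_add"
  shows "(\<Sum>t=1..M * b. \<phi> t) = (\<Sum>m<M. \<Sum>t\<in>{m * b + 1..Suc m * b}. \<phi> t)"
proof (induction M)
  case (Suc M)
  have "{1..Suc M * b} = {1..M * b} \<union> {M * b + 1..Suc M * b}" by auto
  then have "(\<Sum>t=1..Suc M * b. \<phi> t) = (\<Sum>t=1..M * b. \<phi> t) + (\<Sum>t\<in>{M * b + 1..Suc M * b}. \<phi> t)"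
    by (simp only:) (rule sum.union_disjoint, auto)
  then show ?case using Suc by simp
qed simp

lemma block_of_round:
  assumes "t \<in> {m * b + 1..Suc m * b}"
  shows "(t - 1) div b = m"
  using assms by (intro div_nat_eqI) (auto simp: mult.commute)

section \<open>Expected regret of the algorithm\<close>

text \<open>The three summands are the coefficients of \<open>1 / \<eta>\<close>, \<open>\<eta> T b / \<delta>\<^sup>2\<close> and \<open>\<delta> T\<close>.\<close>

definition regret_const :: "nat \<Rightarrow> nat \<Rightarrow> real \<Rightarrow> real \<Rightarrow> real \<Rightarrow> real \<Rightarrow> real \<Rightarrow> real \<Rightarrow> real" where
  "regret_const n k lam R r L1 L2 B0 = 2 * R\<^sup>2 +
    (real k * B0 * (2 + consensus_const n k lam B0) + (real k * B0)\<^sup>2 / 2 + L1 * consensus_const n k lam B0 * r) +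
    (2 * real k * L2 * R + 2 * L1 * R / r)"

definition loo_const :: "nat \<Rightarrow> real \<Rightarrow> real \<Rightarrow> real" where
  "loo_const k R B0 = 27 * R\<^sup>2 * ((2 + real k * B0)^4 / 4 + 1)"

locale bandit_run =
  fixes \<gamma> R r lam L1 L2 B0 :: real and k :: nat
    and K :: "(real^'d) set" and c :: "real^'d" and D :: "(real^'d) set"
    and E :: "('n::finite \<times> 'n) set" and A :: "real^'n^'n" and T b :: nat and \<eta> \<delta> \<epsilon> :: real
    and f :: "nat \<Rightarrow> 'n \<Rightarrow> real^'d \<Rightarrow> real" and \<alpha> :: real and h :: "real^'d \<Rightarrow> real^'d"
    and p :: "real \<Rightarrow> real" and w :: "real^'d \<Rightarrow> real \<Rightarrow> real^'d"
    and L :: "real^'d \<Rightarrow> real^'d" and P :: "real^'d \<Rightarrow> real^'d \<Rightarrow> (real^'d) loo_proc"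
    and M :: "'w measure" and F N :: "nat \<Rightarrow> 'w measure"
    and v :: "nat \<Rightarrow> 'n \<Rightarrow> 'w \<Rightarrow> real^'d" and z q :: "nat \<Rightarrow> 'n \<Rightarrow> 'w \<Rightarrow> real"
    and s :: "nat \<Rightarrow> 'n \<Rightarrow> 'w \<Rightarrow> (real^'d) agent"
  assumes lam: "lam < 1" and feas: "feasible_set K c r R k" and net: "network E A lam"
    and reg: "regular_objectives D L1 L2 T f"
    and two_cases: "monotone_case \<gamma> K T f \<alpha> h p w \<or> (\<exists>u. nonmonotone_case u K T f \<alpha> h p w)"
    and pos: "0 < T" "0 < b" "b dvd T" "0 < \<eta>" "0 < \<delta>" "\<delta> < r"
    and eps: "\<epsilon> = (real b)\<^sup>2 * \<eta>\<^sup>2 / \<delta>\<^sup>2"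
    and queries: "\<forall>x\<in>shrunk K c r \<delta>. \<forall>y\<in>{0..1}. \<forall>d\<in>sphere 0 1 \<inter> direction_space K. w x y + \<delta> *\<^sub>R d \<in> D"
    and proj: "infeasible_projection R (shrunk K c r \<delta>) \<epsilon> L P"
    and s: "s = (\<lambda>m i \<omega>. agents E A c k b \<eta> \<delta> L P (\<lambda>t j. v t j \<omega>) (\<lambda>t j. q t j \<omega>) m i)"
    and run: "stochastic_run M F N T b \<delta> B0 (direction_space K) p w f s v z q"
begin

lemmas feasible = feasible_set_facts[OF feas pos(5,6)]

sublocale prob_space M
  using run by (simp add: stochastic_run_def)

definition blocks where "blocks = T div b"

lemma T_blocks: "T = blocks * b"
  using pos by (simp add: blocks_def)

lemma real_blocks: "real blocks = real T / real b"
  using pos by (simp add: blocks_def real_of_nat_div)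

lemma sum_over_rounds:
  fixes \<phi> :: "nat \<Rightarrow> real"
  shows "(\<Sum>t=1..T. \<phi> t) = (\<Sum>m<blocks. \<Sum>t\<in>{m * b + 1..Suc m * b}. \<phi> t)"
  using sum_over_blocks[of \<phi> blocks b] by (simp only: T_blocks[symmetric])

lemma blocks_pos: "0 < blocks"
  using pos T_blocks by (cases blocks) auto

lemma sample_facts:
  assumes t: "t \<in> {1..T}"
  shows "subalgebra M (F (t - 1))" "subalgebra M (N t)" "subalgebra (N t) (F (t - 1))"
    "indep_set (sets (F (t - 1))) {(\<lambda>\<omega>. (v t i \<omega>, z t i \<omega>)) -` B \<inter> space M |B. B \<in> sets borel}"
    "iterate \<circ> s ((t - 1) div b) i \<in> borel_measurable (F (t - 1))"
    "v t i \<in> borel_measurable (N t)" "\<And>\<omega>. \<omega> \<in> space M \<Longrightarrow> v t i \<omega> \<in> sphere 0 1 \<inter> direction_space K"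
    "uniform_on_sphere (direction_space K) (distr M borel (v t i))"
    "z t i \<in> borel_measurable (N t)" "\<And>\<omega>. \<omega> \<in> space M \<Longrightarrow> z t i \<omega> \<in> {0..1}"
    "distributed M lborel (z t i) (\<lambda>x. ennreal (p x * indicator {0..1} x))"
    "indep_set {v t i -` B \<inter> space M |B. B \<in> sets borel} {z t i -` B \<inter> space M |B. B \<in> sets borel}"
    "q t i \<in> borel_measurable M" "\<And>\<omega>. \<omega> \<in> space M \<Longrightarrow> \<bar>q t i \<omega>\<bar> \<le> B0"
    "AE \<omega> in M. real_cond_exp M (N t) (q t i) \<omega> =
       f t i (w (iterate (s ((t - 1) div b) i \<omega>)) (z t i \<omega>) + \<delta> *\<^sub>R v t i \<omega>)"
proof -
  note run' = run[unfolded stochastic_run_def]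
  have sub: "subalgebra M (F t)" for t using run' by blast
  then show "subalgebra M (F (t - 1))" .
  have 1: "subalgebra (N t) (F (t - 1))" "subalgebra (F t) (N t)"
    and ind: "indep_sets (case_option (sets (F (t - 1)))
             (\<lambda>i. {(\<lambda>\<omega>. (v t i \<omega>, z t i \<omega>)) -` B \<inter> space M |B. B \<in> sets borel})) UNIV"
    using run' t by blast+
  then show "subalgebra (N t) (F (t - 1))" "subalgebra M (N t)"
    using sub[of t] by (auto simp: subalgebra_def)
  have ev: "sets (F (t - 1)) \<subseteq> events" "{(\<lambda>\<omega>. (v t i \<omega>, z t i \<omega>)) -` B \<inter> space M |B. B \<in> sets borel} \<subseteq> events"
    using bspec[OF conjunct1[OF ind[unfolded indep_sets_def]], of None]
      bspec[OF conjunct1[OF ind[unfolded indep_sets_def]], of "Some i"] by simp_all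
  show "indep_set (sets (F (t - 1))) {(\<lambda>\<omega>. (v t i \<omega>, z t i \<omega>)) -` B \<inter> space M |B. B \<in> sets borel}"
  proof (rule indep_setI[OF ev])
    fix a d assume a: "a \<in> sets (F (t - 1))"
      and d: "d \<in> {(\<lambda>\<omega>. (v t i \<omega>, z t i \<omega>)) -` B \<inter> space M |B. B \<in> sets borel}"
    have "prob (\<Inter>j\<in>{None, Some i}. case_option a (\<lambda>_. d) j) = (\<Prod>j\<in>{None, Some i}. prob (case_option a (\<lambda>_. d) j))"
      by (rule indep_setsD[OF ind]) (use a d in auto)
    then show "prob (a \<inter> d) = prob a * prob d" by simp
  qed
  show "q t i \<in> borel_measurable M"
    by (rule measurable_from_subalg[OF sub[of t]]) (use run' t in blast)
qed (use run t in \<open>unfold stochastic_run_def, blast+\<close>)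

lemma gossip_run_pathwise:
  assumes "\<omega> \<in> space M"
  shows "gossip_run E A lam (shrunk K c r \<delta>) c R \<epsilon> \<eta> \<delta> B0 b blocks L P (\<lambda>t j. v t j \<omega>) (\<lambda>t j. q t j \<omega>)"
proof
  show "norm (v t i \<omega>) \<le> 1" if "t \<in> {1..blocks * b}" for t i
    using sample_facts(7)[of t \<omega> i] that assms by (simp add: T_blocks[symmetric])
  show "\<bar>q t i \<omega>\<bar> \<le> B0" if "t \<in> {1..blocks * b}" for t i
    using sample_facts(14)[of t \<omega> i] that assms by (simp add: T_blocks[symmetric])
qed (use lam net feasible pos eps proj blocks_pos in auto)

abbreviation x where "x m i \<omega> \<equiv> iterate (s m i \<omega>)"

definition bias where "bias = 2 * real k * L2 * R * \<delta>"

definition Cc where "Cc = consensus_const CARD('n) k lam B0"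

definition err where "err = real b * \<eta> / \<delta>"

lemma x_in: "\<omega> \<in> space M \<Longrightarrow> x m i \<omega> \<in> shrunk K c r \<delta>"
  using gossip_run.iter_in[OF gossip_run_pathwise, of \<omega> k m i]
  by (simp add: gossip_run.iter_def[OF gossip_run_pathwise] gossip_run.st_def[OF gossip_run_pathwise] s)

lemma x_in_K: "\<omega> \<in> space M \<Longrightarrow> x m i \<omega> \<in> K"
  using x_in feasible(8) by blast

lemma L_nonneg: "0 \<le> L1" "0 \<le> L2"
  using pos by (auto intro!: lipschitz_on_nonneg[OF lipschitz_gradient_on_cube(1)[OF reg, of 1]]
    lipschitz_on_nonneg[OF lipschitz_gradient_on_cube(2)[OF reg, of 1]])

lemma B0_nonneg: "0 \<le> B0"
  using not_empty gossip_run.B0_nonneg[OF gossip_run_pathwise] by blast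

text \<open>Composing an objective with the projection \<open>clamp\<close> onto the cube gives a continuous function on the
  whole space with the same values at the actions played.\<close>

lemma played_value_integrable:
  assumes t: "t \<in> {1..T}" and h: "continuous_on UNIV h" "\<And>y. y \<in> K \<Longrightarrow> h y \<in> K"
    and m: "m < blocks"
  shows "integrable M (\<lambda>\<omega>. f t j (h (x m i \<omega>)))"
proof -
  have t0: "m * b + 1 \<in> {1..T}"
  proof -
    have "Suc m * b \<le> blocks * b" using m by (intro mult_right_mono) auto
    then show ?thesis using pos T_blocks by auto
  qed
  have "continuous_on unit_cube (f t j)"
    using lipschitz_gradient_on_cube(1)[OF reg t] by (rule lipschitz_on_continuous_on)
  then have cont: "continuous_on UNIV (\<lambda>y. f t j (clamp 0 1 (h y)))"
    by (intro continuous_on_compose2[OF clamp_continuous_on h(1)]) auto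
  have "integrable M (\<lambda>\<omega>. f t j (clamp 0 1 (h (x m i \<omega>))))"
  proof (rule bounded_continuous_integrable[OF finite_measure_axioms _ _ feasible(1) cont])
    have "iterate \<circ> s ((m * b + 1 - 1) div b) i \<in> borel_measurable M"
      by (rule measurable_from_subalg[OF sample_facts(1,5)[OF t0]])
    then show "(\<lambda>\<omega>. x m i \<omega>) \<in> borel_measurable M" using pos by (simp add: o_def)
  qed (rule x_in_K)
  moreover have "clamp 0 1 (h (x m i \<omega>)) = h (x m i \<omega>)" if "\<omega> \<in> space M" for \<omega>
    using h(2)[OF x_in_K[OF that]] feasible(2) by (intro clamp_cancel_cbox) auto
  ultimately show ?thesis by (simp cong: Bochner_Integration.integrable_cong)
qed

text \<open>Combines the linearization of the gap with \<open>one_round_estimate\<close> for \<open>Y y = u - y\<close>; the error of the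
  first-order model is the Taylor remainder \<open>L2 \<delta>\<^sup>2\<close>, and the factor \<open>2 R\<close> in \<open>bias\<close> bounds
  \<open>norm (u - y)\<close>.\<close>

lemma linearized_round:
  assumes t: "t \<in> {1..T}" and u: "u \<in> K"
    and \<beta>: "0 \<le> \<beta>" and w: "\<And>y \<zeta>. y \<in> K \<Longrightarrow> \<zeta> \<in> {0..1} \<Longrightarrow> w y \<zeta> \<in> K" "continuous_on UNIV (\<lambda>(y, \<zeta>). w y \<zeta>)"
    and h: "continuous_on UNIV h" "\<And>y. y \<in> K \<Longrightarrow> h y \<in> K"
    and p: "(\<lambda>\<zeta>. p \<zeta> * indicator {0..1} \<zeta>) \<in> borel_measurable borel" "\<And>\<zeta>. 0 \<le> p \<zeta> * indicator {0..1} \<zeta>"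
    and lin: "\<And>y. y \<in> K \<Longrightarrow> \<alpha> * f t i u - f t i (h y) \<le>
       \<beta> * (\<integral>\<zeta>. (p \<zeta> * indicator {0..1} \<zeta>) * (gradient_on unit_cube (f t i) (w y \<zeta>) \<bullet> (u - y)) \<partial>lborel)"
  defines "Q \<equiv> \<lambda>\<omega>. ((real k / \<delta> * q t i \<omega>) *\<^sub>R v t i \<omega>) \<bullet> (u - x ((t - 1) div b) i \<omega>)"
  shows "integrable M Q"
    "expectation (\<lambda>\<omega>. \<alpha> * f t i u - f t i (h (x ((t - 1) div b) i \<omega>))) \<le> \<beta> * (expectation Q + bias)"
proof -
  let ?m = "(t - 1) div b" and ?G = "gradient_on unit_cube (f t i)"
  let ?\<phi> = "\<lambda>(y, \<zeta>). f t i (clamp 0 1 (w y \<zeta>))" and ?g = "\<lambda>(y, \<zeta>). ?G (clamp 0 1 (w y \<zeta>))"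
  let ?X = "iterate \<circ> s ?m i"
  note lip = lipschitz_gradient_on_cube[OF reg t, where i=i]
  note sf = sample_facts[OF t]
  note sf7 = sf(7)[where i=i] and sf10 = sf(10)[where i=i]
  have cl: "clamp 0 1 y = y" if "y \<in> K" for y
    using that feasible(2) by (intro clamp_cancel_cbox) auto
  have c1: "continuous_on UNIV ?\<phi>"
    unfolding split_beta using lip(1) w(2)
    by (intro continuous_on_compose2[OF clamp_continuous_on[OF lipschitz_on_continuous_on]]) (auto simp: split_beta)
  have c2: "continuous_on UNIV ?g"
    unfolding split_beta using lip(2) w(2)
    by (intro continuous_on_compose2[OF clamp_continuous_on[OF lipschitz_on_continuous_on]]) (auto simp: split_beta)
  have mean: "AE \<omega> in M. \<bar>real_cond_exp M (N t) (q t i) \<omega> - ?\<phi> (?X \<omega>, z t i \<omega>) -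
      \<delta> * (?g (?X \<omega>, z t i \<omega>) \<bullet> v t i \<omega>)\<bar> \<le> L2 * \<delta>\<^sup>2"
    using sf(15)[of i] AE_space
  proof eventually_elim
    case (elim \<omega>)
    have xS: "x ?m i \<omega> \<in> shrunk K c r \<delta>" and xK: "x ?m i \<omega> \<in> K" using x_in x_in_K elim by auto
    have wK: "w (x ?m i \<omega>) (z t i \<omega>) \<in> K" by (rule w(1)[OF xK sf10[OF elim(2)]])
    have "w (x ?m i \<omega>) (z t i \<omega>) + \<delta> *\<^sub>R v t i \<omega> \<in> D"
      using queries xS sf10[OF elim(2)] sf7[OF elim(2)] by blast
    then have "\<bar>f t i (w (x ?m i \<omega>) (z t i \<omega>) + \<delta> *\<^sub>R v t i \<omega>) - f t i (w (x ?m i \<omega>) (z t i \<omega>)) -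
        ?G (w (x ?m i \<omega>) (z t i \<omega>)) \<bullet> (\<delta> *\<^sub>R v t i \<omega>)\<bar> \<le> L2 * (norm (\<delta> *\<^sub>R v t i \<omega>))\<^sup>2"
      using lip(3)[of "w (x ?m i \<omega>) (z t i \<omega>)" "w (x ?m i \<omega>) (z t i \<omega>) + \<delta> *\<^sub>R v t i \<omega>"] wK feasible(2) by auto
    moreover have "norm (\<delta> *\<^sub>R v t i \<omega>) = \<delta>" using sf7[OF elim(2)] pos by simp
    ultimately show ?case using elim(1) cl[OF wK] by simp
  qed
  have n: "norm (u - y) \<le> 2 * R" if "y \<in> K" for y
    using norm_triangle_ineq4[of u y] feasible(4)[OF u] feasible(4)[OF that] by simp
  have XK: "?X \<omega> \<in> K" and V1: "norm (v t i \<omega>) = 1" if "\<omega> \<in> space M" for \<omega>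
    using x_in_K[OF that] sf7[OF that] by simp_all
  have Yc: "continuous_on UNIV (\<lambda>y. u - y)" by (intro continuous_intros)
  note est = one_round_estimate[where Y="\<lambda>y. u - y" and \<phi>="?\<phi>" and g="?g" and X="?X" and V="v t i" and Z="z t i" and q="q t i"
      and \<rho>="\<lambda>\<zeta>. p \<zeta> * indicator {0..1} \<zeta>" and W="direction_space K",
      OF sf(1,5) XK feasible(1) sf(2,3,6) V1 sf(9) sf10 sf(4,12) feasible(9) sf(8) p sf(11) c1 c2 Yc feasible(11)[OF _ u] n
      sf(13,14) pos(5) mean, unfolded feasible(10)]
  let ?\<Psi> = "\<lambda>\<omega>. \<integral>\<zeta>. (p \<zeta> * indicator {0..1} \<zeta>) * (?g (?X \<omega>, \<zeta>) \<bullet> (u - ?X \<omega>)) \<partial>lborel"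
  have Q: "Q = (\<lambda>\<omega>. ((real k / \<delta> * q t i \<omega>) *\<^sub>R v t i \<omega>) \<bullet> (u - ?X \<omega>))"
    by (simp only: Q_def o_def)
  show "integrable M Q" unfolding Q by (rule est(1))
  have est2: "integrable M ?\<Psi>" by (rule est(2))
  have est3: "expectation ?\<Psi> \<le> expectation Q + real k / \<delta> * (L2 * \<delta>\<^sup>2) * (2 * R)"
    unfolding Q by (rule est(3))
  have "expectation (\<lambda>\<omega>. \<alpha> * f t i u - f t i (h (x ?m i \<omega>))) \<le> expectation (\<lambda>\<omega>. \<beta> * ?\<Psi> \<omega>)"
  proof (rule integral_mono)
    have "?m < blocks" using t pos T_blocks by (intro div_less_iff_less_mult[THEN iffD2]) auto
    then show "integrable M (\<lambda>\<omega>. \<alpha> * f t i u - f t i (h (x ?m i \<omega>)))"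
      using played_value_integrable[OF t h] by simp
    show "integrable M (\<lambda>\<omega>. \<beta> * ?\<Psi> \<omega>)" using est2 by simp
    fix \<omega> assume \<omega>: "\<omega> \<in> space M"
    note xK = x_in_K[OF \<omega>, of ?m i]
    have "?\<Psi> \<omega> = (\<integral>\<zeta>. (p \<zeta> * indicator {0..1} \<zeta>) * (?G (w (x ?m i \<omega>) \<zeta>) \<bullet> (u - x ?m i \<omega>)) \<partial>lborel)"
    proof (rule Bochner_Integration.integral_cong[OF refl])
      fix \<zeta> :: real
      show "p \<zeta> * indicator {0..1} \<zeta> * (?g (?X \<omega>, \<zeta>) \<bullet> (u - ?X \<omega>)) =
          p \<zeta> * indicator {0..1} \<zeta> * (?G (w (x ?m i \<omega>) \<zeta>) \<bullet> (u - x ?m i \<omega>))"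
      proof (cases "\<zeta> \<in> {0..1}")
        case True
        then show ?thesis using cl[OF w(1)[OF xK True]] by simp
      qed simp
    qed
    then show "\<alpha> * f t i u - f t i (h (x ?m i \<omega>)) \<le> \<beta> * ?\<Psi> \<omega>"
      using lin[OF xK] by simp
  qed
  also have "\<dots> = \<beta> * expectation ?\<Psi>" by simp
  also have "\<dots> \<le> \<beta> * (expectation Q + bias)"
  proof (rule mult_left_mono[OF _ \<beta>])
    have "real k / \<delta> * (L2 * \<delta>\<^sup>2) * (2 * R) = bias" using pos by (simp add: bias_def power2_eq_square)
    then show "expectation ?\<Psi> \<le> expectation Q + bias" using est3 by simp
  qed
  finally show "expectation (\<lambda>\<omega>. \<alpha> * f t i u - f t i (h (x ?m i \<omega>))) \<le> \<beta> * (expectation Q + bias)" .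
qed


definition rate where "rate = 1 / \<eta> + \<eta> * real T * real b / \<delta>\<^sup>2 + \<delta> * real T"

lemma Cc_nonneg: "0 \<le> Cc" using lam B0_nonneg by (simp add: Cc_def consensus_const_def)

lemma linear_regret_pathwise:
  assumes \<omega>: "\<omega> \<in> space M" and u: "u \<in> shrunk K c r \<delta>"
  shows "(\<Sum>t=1..T. \<Sum>j\<in>UNIV. ((real k / \<delta> * q t j \<omega>) *\<^sub>R v t j \<omega>) \<bullet> (u - x ((t - 1) div b) j \<omega>)) \<le>
    real CARD('n) * (2 * R\<^sup>2 / \<eta> + \<eta> * real T * real b / \<delta>\<^sup>2 * (real k * B0 * (2 + Cc) + (real k * B0)\<^sup>2 / 2))"
proof -
  interpret g: gossip_run E A lam "shrunk K c r \<delta>" c R \<epsilon> \<eta> \<delta> B0 k b blocks L P "\<lambda>t j. v t j \<omega>" "\<lambda>t j. q t j \<omega>"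
    by (rule gossip_run_pathwise[OF \<omega>])
  have iter: "g.iter m j = x m j \<omega>" for m j by (simp add: g.iter_def g.st_def s)
  have "(\<Sum>t=1..T. \<Sum>j\<in>UNIV. ((real k / \<delta> * q t j \<omega>) *\<^sub>R v t j \<omega>) \<bullet> (u - x ((t - 1) div b) j \<omega>)) =
      (\<Sum>m<blocks. \<Sum>j\<in>UNIV. g.grad m j \<bullet> (u - g.iter m j))"
    unfolding sum_over_rounds
  proof (rule sum.cong[OF refl])
    fix m assume "m \<in> {..<blocks}"
    have "(\<Sum>t\<in>{m * b + 1..Suc m * b}. \<Sum>j\<in>UNIV. ((real k / \<delta> * q t j \<omega>) *\<^sub>R v t j \<omega>) \<bullet> (u - x ((t - 1) div b) j \<omega>)) =
        (\<Sum>t\<in>{m * b + 1..Suc m * b}. \<Sum>j\<in>UNIV. ((real k / \<delta> * q t j \<omega>) *\<^sub>R v t j \<omega>) \<bullet> (u - g.iter m j))"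
    proof (rule sum.cong[OF refl])
      fix t assume "t \<in> {m * b + 1..Suc m * b}"
      then have "(t - 1) div b = m" by (rule block_of_round)
      then show "(\<Sum>j\<in>UNIV. ((real k / \<delta> * q t j \<omega>) *\<^sub>R v t j \<omega>) \<bullet> (u - x ((t - 1) div b) j \<omega>)) =
          (\<Sum>j\<in>UNIV. ((real k / \<delta> * q t j \<omega>) *\<^sub>R v t j \<omega>) \<bullet> (u - g.iter m j))"
        by (simp only: iter)
    qed
    also have "\<dots> = (\<Sum>j\<in>UNIV. g.grad m j \<bullet> (u - g.iter m j))"
      unfolding g.grad_def inner_sum_left by (rule sum.swap)
    finally show "(\<Sum>t\<in>{m * b + 1..Suc m * b}. \<Sum>j\<in>UNIV. ((real k / \<delta> * q t j \<omega>) *\<^sub>R v t j \<omega>) \<bullet> (u - x ((t - 1) div b) j \<omega>)) =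
      (\<Sum>j\<in>UNIV. g.grad m j \<bullet> (u - g.iter m j))" .
  qed
  also have "\<dots> \<le> real CARD('n) * (2 * R\<^sup>2 / \<eta> + real blocks * (g.grad_max * (2 + g.Cc) * g.err + \<eta> * g.grad_max\<^sup>2 / 2))"
    by (rule g.linear_regret[OF u])
  also have "real blocks * (g.grad_max * (2 + g.Cc) * g.err + \<eta> * g.grad_max\<^sup>2 / 2) =
      \<eta> * real T * real b / \<delta>\<^sup>2 * (real k * B0 * (2 + Cc) + (real k * B0)\<^sup>2 / 2)"
  proof -
    have b0: "real b \<noteq> 0" using pos by simp
    have "g.Cc = Cc" by (simp add: g.Cc_def Cc_def consensus_const_def)
    moreover have "real T / real b * (real b * real k * B0 / \<delta> * C2 * (real b * \<eta> / \<delta>) + \<eta> * (real b * real k * B0 / \<delta>)\<^sup>2 / 2) =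
      \<eta> * real T * real b / \<delta>\<^sup>2 * (real k * B0 * C2 + (real k * B0)\<^sup>2 / 2)" for C2
      using b0 pos(5) by (simp add: field_simps power2_eq_square)
    ultimately show ?thesis by (simp only: g.grad_max_def g.err_def real_blocks)
  qed
  finally show ?thesis .
qed

lemma consensus_pathwise:
  assumes \<omega>: "\<omega> \<in> space M" and m: "m \<le> blocks"
  shows "norm (x m i \<omega> - x m j \<omega>) \<le> Cc * err"
proof -
  interpret g: gossip_run E A lam "shrunk K c r \<delta>" c R \<epsilon> \<eta> \<delta> B0 k b blocks L P "\<lambda>t j. v t j \<omega>" "\<lambda>t j. q t j \<omega>"
    by (rule gossip_run_pathwise[OF \<omega>])
  show ?thesis
    using g.iter_consensus[OF m, of i j] by (simp add: g.iter_def g.st_def g.Cc_def g.err_def Cc_def consensus_const_def err_def s)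
qed

lemma counts_pathwise:
  assumes \<omega>: "\<omega> \<in> space M"
  shows "real (loo_count (s blocks i \<omega>)) \<le> loo_const k R B0 * (real T / (\<epsilon> * real b))"
    "real (\<Sum>j\<in>UNIV. comm_count (s blocks j \<omega>)) = real CARD('n) * (real T / real b)"
proof -
  interpret g: gossip_run E A lam "shrunk K c r \<delta>" c R \<epsilon> \<eta> \<delta> B0 k b blocks L P "\<lambda>t j. v t j \<omega>" "\<lambda>t j. q t j \<omega>"
    by (rule gossip_run_pathwise[OF \<omega>])
  have st: "g.st m j = s m j \<omega>" for m j by (simp add: g.st_def s)
  show "real (loo_count (s blocks i \<omega>)) \<le> loo_const k R B0 * (real T / (\<epsilon> * real b))"
    using g.loo_bound[of blocks i] by (simp add: st real_blocks loo_const_def mult_ac)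
  show "real (\<Sum>j\<in>UNIV. comm_count (s blocks j \<omega>)) = real CARD('n) * (real T / real b)"
    using g.comm_count[of blocks] by (simp add: st real_blocks)
qed

text \<open>The best fixed action \<open>us\<close> may lie outside the shrunk set; \<open>u\<close> is its image under the
  contraction that defines this set.\<close>

lemma comparator:
  obtains us u where "us \<in> K" "u \<in> shrunk K c r \<delta>" "norm (us - u) \<le> 2 * R * \<delta> / r"
    "(SUP u\<in>K. 1 / real CARD('n) * (\<Sum>t=1..T. \<Sum>j\<in>UNIV. f t j u)) = 1 / real CARD('n) * (\<Sum>t=1..T. \<Sum>j\<in>UNIV. f t j us)"
proof -
  let ?F = "\<lambda>u. 1 / real CARD('n) * (\<Sum>t=1..T. \<Sum>j\<in>UNIV. f t j u)"
  have "continuous_on K (f t j)" if "t \<in> {1..T}" for t j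
    using lipschitz_on_continuous_on[OF lipschitz_gradient_on_cube(1)[OF reg that]] feasible(2)
    by (rule continuous_on_subset)
  then have "continuous_on K ?F" by (intro continuous_intros) auto
  then have "\<exists>us\<in>K. \<forall>y\<in>K. ?F y \<le> ?F us"
    using feasible(1,3) by (intro continuous_attains_sup) auto
  then obtain us where us: "us \<in> K" "\<And>y. y \<in> K \<Longrightarrow> ?F y \<le> ?F us" by blast
  have sup: "(SUP u\<in>K. ?F u) = ?F us"
    using us by (intro cSup_eq_maximum) auto
  let ?u = "(1 - \<delta> / r) *\<^sub>R us + (\<delta> / r) *\<^sub>R c"
  have u: "?u \<in> shrunk K c r \<delta>" using us(1) by (auto simp: shrunk_def)
  have "us - ?u = (\<delta> / r) *\<^sub>R (us - c)" by (simp add: algebra_simps)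
  then have "norm (us - ?u) = \<delta> / r * norm (us - c)" using pos by simp
  also have "\<dots> \<le> \<delta> / r * (2 * R)"
    using norm_triangle_ineq4[of us c] feasible(4)[OF us(1)] feasible(4)[OF feasible(3)] pos
    by (intro mult_left_mono) auto
  finally have "norm (us - ?u) \<le> 2 * R * \<delta> / r" by (simp add: mult_ac)
  then show thesis using sup by (rule that[OF us(1) u])
qed

text \<open>Replace the best fixed action by its shrunk copy and the action of agent \<open>i\<close> by that of agent \<open>j\<close>,
  at the cost \<open>slack\<close> per round by Lipschitz continuity. What is left is linearized round by round and
  summed up by the pathwise bound.\<close>

lemma regret_bound:
  defines "rg \<equiv> \<lambda>i \<omega>. regret \<alpha> K T f (\<lambda>t. h (x ((t - 1) div b) i \<omega>))"
  shows "integrable M (rg i)" "expectation (rg i) \<le> regret_const CARD('n) k lam R r L1 L2 B0 * rate"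
proof -
  have convK: "convex K" using feas by (simp add: feasible_set_def)
  obtain \<beta> where \<beta>: "0 \<le> \<beta>" "\<beta> \<le> 1" and \<alpha>: "0 \<le> \<alpha>" "\<alpha> \<le> 1" and hK: "\<And>y. y \<in> K \<Longrightarrow> h y \<in> K"
    and hL: "\<And>x y. norm (h x - h y) \<le> norm (x - y)" and hc: "continuous_on UNIV h"
    and wK: "\<And>y \<zeta>. y \<in> K \<Longrightarrow> \<zeta> \<in> {0..1} \<Longrightarrow> w y \<zeta> \<in> K" and wc: "continuous_on UNIV (\<lambda>(y, \<zeta>). w y \<zeta>)"
    and p: "(\<lambda>\<zeta>. p \<zeta> * indicator {0..1} \<zeta>) \<in> borel_measurable borel" "\<And>\<zeta>. 0 \<le> p \<zeta> * indicator {0..1} \<zeta>"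
    and lin: "\<And>t i y u. t \<in> {1..T} \<Longrightarrow> y \<in> K \<Longrightarrow> u \<in> K \<Longrightarrow> \<alpha> * f t i u - f t i (h y) \<le>
       \<beta> * (\<integral>\<zeta>. (p \<zeta> * indicator {0..1} \<zeta>) * (gradient_on unit_cube (f t i) (w y \<zeta>) \<bullet> (u - y)) \<partial>lborel)"
    by (rule case_linearization[OF two_cases convK feasible(2) reg]) (rule that; assumption)
  obtain us u where us: "us \<in> K" and u: "u \<in> shrunk K c r \<delta>" and usu: "norm (us - u) \<le> 2 * R * \<delta> / r"
    and sup: "(SUP u\<in>K. 1 / real CARD('n) * (\<Sum>t=1..T. \<Sum>j\<in>UNIV. f t j u)) = 1 / real CARD('n) * (\<Sum>t=1..T. \<Sum>j\<in>UNIV. f t j us)"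
    by (rule comparator)
  have uK: "u \<in> K" using u feasible(8) by blast
  let ?n = "real CARD('n)" and ?m = "\<lambda>t. (t - 1) div b"
  define Q where "Q t j \<omega> = ((real k / \<delta> * q t j \<omega>) *\<^sub>R v t j \<omega>) \<bullet> (u - x (?m t) j \<omega>)" for t j \<omega>
  define U where "U t j \<omega> = \<alpha> * f t j u - f t j (h (x (?m t) j \<omega>))" for t j \<omega>
  define slack where "slack = L1 * (2 * R * \<delta> / r) + L1 * (Cc * err)"
  have m: "?m t < blocks" if "t \<in> {1..T}" for t
    using that pos T_blocks by (intro div_less_iff_less_mult[THEN iffD2]) auto
  have fint: "integrable M (\<lambda>\<omega>. f t j (h (x (?m t) i \<omega>)))" if "t \<in> {1..T}" for t i j
    by (rule played_value_integrable[OF that hc hK m[OF that]])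
  have rg: "rg i \<omega> = 1 / ?n * (\<Sum>t=1..T. \<Sum>j\<in>UNIV. \<alpha> * f t j us - f t j (h (x (?m t) i \<omega>)))" for \<omega>
    unfolding rg_def regret_def sup by (simp add: sum_subtractf sum_distrib_left right_diff_distrib mult_ac)
  show rint: "integrable M (rg i)"
    unfolding rg[abs_def]
    by (intro integrable_mult_right Bochner_Integration.integrable_sum Bochner_Integration.integrable_diff
        integrable_const fint)
  have Uint: "integrable M (U t j)" if "t \<in> {1..T}" for t j
    unfolding U_def by (intro Bochner_Integration.integrable_diff integrable_const fint that)
  have Qint: "integrable M (Q t j)" and EU: "expectation (U t j) \<le> \<beta> * (expectation (Q t j) + bias)"
    if "t \<in> {1..T}" for t j
    unfolding Q_def U_def
    by (rule linearized_round[OF that uK \<beta>(1) wK wc hc hK p lin[OF that _ uK]]; assumption)+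
  have pw: "rg i \<omega> \<le> 1 / ?n * (\<Sum>t=1..T. \<Sum>j\<in>UNIV. U t j \<omega> + slack)" if \<omega>: "\<omega> \<in> space M" for \<omega>
    unfolding rg
  proof (intro mult_left_mono sum_mono)
    fix t j assume t: "t \<in> {1..T}"
    have lip: "\<bar>f t j y - f t j y'\<bar> \<le> L1 * norm (y - y')" if "y \<in> K" "y' \<in> K" for y y'
      using lipschitz_onD[OF lipschitz_gradient_on_cube(1)[OF reg t, of j], of y y'] that feasible(2)
      by (auto simp: dist_norm)
    have "\<bar>f t j us - f t j u\<bar> \<le> L1 * (2 * R * \<delta> / r)"
      by (rule order_trans[OF lip[OF us uK] mult_left_mono[OF usu L_nonneg(1)]])
    then have "\<alpha> * (f t j us - f t j u) \<le> 1 * (L1 * (2 * R * \<delta> / r))"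
      using \<alpha> L_nonneg feasible(5) pos by (intro order_trans[OF mult_left_mono mult_right_mono]) auto
    moreover have "\<bar>f t j (h (x (?m t) i \<omega>)) - f t j (h (x (?m t) j \<omega>))\<bar> \<le> L1 * (Cc * err)"
      using hL[of "x (?m t) i \<omega>" "x (?m t) j \<omega>"] consensus_pathwise[OF \<omega>, of "?m t" i j] m[OF t]
      by (intro order_trans[OF lip[OF hK[OF x_in_K[OF \<omega>]] hK[OF x_in_K[OF \<omega>]]]] mult_left_mono L_nonneg) linarith
    ultimately show "\<alpha> * f t j us - f t j (h (x (?m t) i \<omega>)) \<le> U t j \<omega> + slack"
      unfolding U_def slack_def by (simp add: right_diff_distrib abs_le_iff)
  qed simp
  have bound: "expectation (\<lambda>\<omega>. \<Sum>t=1..T. \<Sum>j\<in>UNIV. Q t j \<omega>) \<le>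
      ?n * (2 * R\<^sup>2 / \<eta> + \<eta> * real T * real b / \<delta>\<^sup>2 * (real k * B0 * (2 + Cc) + (real k * B0)\<^sup>2 / 2))" (is "_ \<le> ?n * ?B")
  proof -
    have "expectation (\<lambda>\<omega>. \<Sum>t=1..T. \<Sum>j\<in>UNIV. Q t j \<omega>) \<le> expectation (\<lambda>_. ?n * ?B)"
      unfolding Q_def
      by (intro integral_mono linear_regret_pathwise u Bochner_Integration.integrable_sum integrable_const
          Qint[unfolded Q_def])
    then show ?thesis by (simp add: prob_space)
  qed
  have B_nonneg: "0 \<le> ?B"
    using pos B0_nonneg Cc_nonneg by (intro add_nonneg_nonneg mult_nonneg_nonneg divide_nonneg_nonneg) auto
  have bias_nonneg: "0 \<le> bias" using L_nonneg feasible(5) pos by (simp add: bias_def)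
  have "expectation (rg i) \<le> expectation (\<lambda>\<omega>. 1 / ?n * (\<Sum>t=1..T. \<Sum>j\<in>UNIV. U t j \<omega> + slack))"
    by (intro integral_mono rint pw integrable_mult_right Bochner_Integration.integrable_sum
        Bochner_Integration.integrable_add integrable_const Uint)
  also have "\<dots> = 1 / ?n * (\<Sum>t=1..T. \<Sum>j\<in>UNIV. expectation (U t j) + slack)"
    using Uint by (simp add: prob_space)
  also have "\<dots> \<le> 1 / ?n * (\<Sum>t=1..T. \<Sum>j\<in>UNIV. \<beta> * (expectation (Q t j) + bias) + slack)"
    using EU by (intro mult_left_mono sum_mono) auto
  also have "(\<Sum>t=1..T. \<Sum>j\<in>(UNIV::'n set). \<beta> * (expectation (Q t j) + bias) + slack) =
      \<beta> * expectation (\<lambda>\<omega>. \<Sum>t=1..T. \<Sum>j\<in>UNIV. Q t j \<omega>) + real T * ?n * (\<beta> * bias + slack)"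
    using Qint by (simp add: sum.distrib sum_distrib_left[symmetric] distrib_left mult_ac)
  also have "\<dots> \<le> \<beta> * (?n * ?B) + real T * ?n * (\<beta> * bias + slack)"
    using bound \<beta> by (intro add_right_mono mult_left_mono) auto
  also have "\<dots> \<le> 1 * (?n * ?B) + real T * ?n * (1 * bias + slack)"
    using \<beta> B_nonneg bias_nonneg by (intro add_mono mult_left_mono mult_right_mono) auto
  finally have "expectation (rg i) \<le> 1 / ?n * (1 * (?n * ?B) + real T * ?n * (1 * bias + slack))"
    by (simp add: divide_right_mono)
  also have "\<dots> = ?B + real T * (bias + slack)"
    by (simp add: field_simps)
  also have "real T * (bias + slack) = \<delta> * real T * (2 * real k * L2 * R + 2 * L1 * R / r) + L1 * Cc * (real T * err)"
    by (simp add: bias_def slack_def algebra_simps)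
  (* The consensus error is absorbed by the second term of the rate, because \<delta> < r. *)
  also have "real T * err = \<eta> * real T * real b / \<delta>\<^sup>2 * \<delta>"
    using pos by (simp add: err_def power2_eq_square)
  also have "L1 * Cc * (\<eta> * real T * real b / \<delta>\<^sup>2 * \<delta>) \<le> L1 * Cc * (\<eta> * real T * real b / \<delta>\<^sup>2 * r)"
    using pos L_nonneg Cc_nonneg by (intro mult_left_mono) auto
  finally have "expectation (rg i) \<le> 1 / \<eta> * (2 * R\<^sup>2) +
      \<eta> * real T * real b / \<delta>\<^sup>2 * (real k * B0 * (2 + Cc) + (real k * B0)\<^sup>2 / 2 + L1 * Cc * r) +
      \<delta> * real T * (2 * real k * L2 * R + 2 * L1 * R / r)"
    by (simp add: distrib_left mult_ac)
  also have "\<dots> \<le> (1 / \<eta>) * regret_const CARD('n) k lam R r L1 L2 B0 + \<eta> * real T * real b / \<delta>\<^sup>2 * regret_const CARD('n) k lam R r L1 L2 B0 + \<delta> * real T * regret_const CARD('n) k lam R r L1 L2 B0"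
  proof -
    have nn: "0 \<le> real k * B0 * (2 + Cc) + (real k * B0)\<^sup>2 / 2 + L1 * Cc * r"
        "0 \<le> 2 * real k * L2 * R + 2 * L1 * R / r" "0 \<le> 2 * R\<^sup>2"
      using pos L_nonneg Cc_nonneg B0_nonneg feasible(5) by auto
    show ?thesis
      using pos nn by (intro add_mono mult_left_mono) (auto simp: regret_const_def Cc_def[symmetric])
  qed
  also have "\<dots> = regret_const CARD('n) k lam R r L1 L2 B0 * rate" by (simp add: rate_def algebra_simps)
  finally show "expectation (rg i) \<le> regret_const CARD('n) k lam R r L1 L2 B0 * rate" .
qed

lemma const_nonneg: "0 \<le> regret_const CARD('n) k lam R r L1 L2 B0" "0 \<le> loo_const k R B0" "0 \<le> rate"
  using pos L_nonneg Cc_nonneg B0_nonneg feasible(5) by (auto simp: regret_const_def loo_const_def Cc_def[symmetric] rate_def)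

end

theorem theorem5:
  fixes \<gamma> R r lam L1 L2 B0 :: real and k :: nat
  assumes "lam < 1"
  shows "\<exists>C. \<forall>(K :: (real^'d) set) c D (E :: ('n::finite \<times> 'n) set) A T b \<eta> \<delta> \<epsilon> f \<alpha> h p w L P
            (M :: 'w measure) F G v z q s.
     feasible_set K c r R k \<longrightarrow>
     network E A lam \<longrightarrow>
     regular_objectives D L1 L2 T f \<longrightarrow>
     monotone_case \<gamma> K T f \<alpha> h p w \<or> (\<exists>u. nonmonotone_case u K T f \<alpha> h p w) \<longrightarrow>
     0 < T \<longrightarrow> 0 < b \<longrightarrow> b dvd T \<longrightarrow> 0 < \<eta> \<longrightarrow> 0 < \<delta> \<longrightarrow> \<delta> < r \<longrightarrow>
     \<epsilon> = (real b)\<^sup>2 * \<eta>\<^sup>2 / \<delta>\<^sup>2 \<longrightarrow>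
     (\<forall>x\<in>shrunk K c r \<delta>. \<forall>y\<in>{0..1}. \<forall>d\<in>sphere 0 1 \<inter> direction_space K. w x y + \<delta> *\<^sub>R d \<in> D) \<longrightarrow>
     is_LOO (shrunk K c r \<delta>) L \<longrightarrow>
     infeasible_projection R (shrunk K c r \<delta>) \<epsilon> L P \<longrightarrow>
     s = (\<lambda>m i \<omega>. agents E A c k b \<eta> \<delta> L P (\<lambda>t j. v t j \<omega>) (\<lambda>t j. q t j \<omega>) m i) \<longrightarrow>
     stochastic_run M F G T b \<delta> B0 (direction_space K) p w f s v z q \<longrightarrow>
     (\<forall>i. let reg = (\<lambda>\<omega>. regret \<alpha> K T f (\<lambda>t. h (iterate (s ((t - 1) div b) i \<omega>))));
              loo = (\<lambda>\<omega>. real (loo_count (s (T div b) i \<omega>)));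
              comm = (\<lambda>\<omega>. real (\<Sum>j\<in>UNIV. comm_count (s (T div b) j \<omega>)))
          in integrable M reg \<and>
             integral\<^sup>L M reg \<le> C * (1 / \<eta> + \<eta> * real T * real b / \<delta>\<^sup>2 + \<delta> * real T) \<and>
             (\<forall>\<omega>\<in>space M. loo \<omega> \<le> C * (real T / (\<epsilon> * real b)) \<and>
                           comm \<omega> \<le> C * (real T / real b)) \<and>
             (\<forall>\<theta>\<in>{0..1}.
                real b = real T powr (1 - \<theta>) \<longrightarrow>
                \<delta> = real T powr (- \<theta> / 4) \<longrightarrow>
                \<eta> = \<delta> / sqrt (real b * real T) \<longrightarrow>
                  integral\<^sup>L M reg \<le> C * real T powr (1 - \<theta> / 4) \<and>
                  (\<forall>\<omega>\<in>space M. loo \<omega> \<le> C * real T powr (2 * \<theta>) \<and>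
                                comm \<omega> \<le> C * real T powr \<theta>)))"
proof -
  define C1 where "C1 = regret_const CARD('n) k lam R r L1 L2 B0"
  define C2 where "C2 = loo_const k R B0"
  show ?thesis
  proof (intro exI[of _ "3 * C1 + C2 + real CARD('n)"] allI impI)
    fix K :: "(real^'d) set" and c D and E :: "('n \<times> 'n) set" and A and T b :: nat and \<eta> \<delta> \<epsilon>
      and f :: "nat \<Rightarrow> 'n \<Rightarrow> real^'d \<Rightarrow> real" and \<alpha> h p w L P and M :: "'w measure" and F G v z q s
      and i :: 'n
    assume hyps: "feasible_set K c r R k" "network E A lam" "regular_objectives D L1 L2 T f"
      "monotone_case \<gamma> K T f \<alpha> h p w \<or> (\<exists>u. nonmonotone_case u K T f \<alpha> h p w)"
      "0 < T" "0 < b" "b dvd T" "0 < \<eta>" "0 < \<delta>" "\<delta> < r" "\<epsilon> = (real b)\<^sup>2 * \<eta>\<^sup>2 / \<delta>\<^sup>2"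
      "\<forall>x\<in>shrunk K c r \<delta>. \<forall>y\<in>{0..1}. \<forall>d\<in>sphere 0 1 \<inter> direction_space K. w x y + \<delta> *\<^sub>R d \<in> D"
      "infeasible_projection R (shrunk K c r \<delta>) \<epsilon> L P"
      "s = (\<lambda>m i \<omega>. agents E A c k b \<eta> \<delta> L P (\<lambda>t j. v t j \<omega>) (\<lambda>t j. q t j \<omega>) m i)"
      "stochastic_run M F G T b \<delta> B0 (direction_space K) p w f s v z q"
    interpret bandit_run \<gamma> R r lam L1 L2 B0 k K c D E A T b \<eta> \<delta> \<epsilon> f \<alpha> h p w L P M F G v z q s
      by unfold_locales (fact assms hyps)+
    (* The factor 3 is used for the tuned parameters, with which the three terms of the rate coincide. *)
    let ?C = "3 * C1 + C2 + real CARD('n)"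
    let ?reg = "\<lambda>\<omega>. regret \<alpha> K T f (\<lambda>t. h (iterate (s ((t - 1) div b) i \<omega>)))"
    have C: "0 \<le> C1" "0 \<le> C2" and rate0: "0 \<le> rate"
      using const_nonneg by (simp_all add: C1_def C2_def)
    have reg: "integrable M ?reg" "integral\<^sup>L M ?reg \<le> C1 * rate"
      using regret_bound[of i] unfolding C1_def by blast+
    have weaken: "C1 * y \<le> ?C * y" "C1 * (3 * y) \<le> ?C * y" "C2 * y \<le> ?C * y" "real CARD('n) * y \<le> ?C * y"
      if "0 \<le> y" for y
    proof -
      have "a * y \<le> ?C * y" if "a \<le> ?C" for a using that \<open>0 \<le> y\<close> by (rule mult_right_mono)
      from this[of C1] this[of "3 * C1"] this[of C2] this[of "real CARD('n)"] C
      show "C1 * y \<le> ?C * y" "C1 * (3 * y) \<le> ?C * y" "C2 * y \<le> ?C * y" "real CARD('n) * y \<le> ?C * y"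
        by (simp_all add: mult_ac)
    qed
    have loo: "real (loo_count (s (T div b) i \<omega>)) \<le> C2 * (real T / (\<epsilon> * real b))"
      and comm: "real (\<Sum>j\<in>UNIV. comm_count (s (T div b) j \<omega>)) = real CARD('n) * (real T / real b)"
      if "\<omega> \<in> space M" for \<omega>
      using counts_pathwise[OF that] unfolding blocks_def C2_def by blast+
    have nonneg: "0 \<le> real T / (\<epsilon> * real b)" "0 \<le> real T / real b"
      using hyps(11) by simp_all
    have general: "integral\<^sup>L M ?reg \<le> ?C * (1 / \<eta> + \<eta> * real T * real b / \<delta>\<^sup>2 + \<delta> * real T)"
      using reg(2) weaken(1)[OF rate0] unfolding rate_def by linarith
    have counts: "real (loo_count (s (T div b) i \<omega>)) \<le> ?C * (real T / (\<epsilon> * real b))"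
      "real (\<Sum>j\<in>UNIV. comm_count (s (T div b) j \<omega>)) \<le> ?C * (real T / real b)" if "\<omega> \<in> space M" for \<omega>
      using loo[OF that] comm[OF that] weaken(3)[OF nonneg(1)] weaken(4)[OF nonneg(2)] by linarith+
    have tuned: "integral\<^sup>L M ?reg \<le> ?C * real T powr (1 - \<theta> / 4)"
      "real T / (\<epsilon> * real b) = real T powr (2 * \<theta>)" "real T / real b = real T powr \<theta>"
      if "real b = real T powr (1 - \<theta>)" "\<delta> = real T powr (- \<theta> / 4)" "\<eta> = \<delta> / sqrt (real b * real T)" for \<theta>
    proof -
      note tun = tuning[OF hyps(5) that hyps(11)]
      have "rate = 3 * real T powr (1 - \<theta> / 4)"
        unfolding rate_def tun by simp
      then show "integral\<^sup>L M ?reg \<le> ?C * real T powr (1 - \<theta> / 4)"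
        using reg(2) weaken(2)[of "real T powr (1 - \<theta> / 4)"] by simp
    qed (rule tuning[OF hyps(5) that hyps(11)])+
    show "let reg = ?reg; loo = (\<lambda>\<omega>. real (loo_count (s (T div b) i \<omega>)));
              comm = (\<lambda>\<omega>. real (\<Sum>j\<in>UNIV. comm_count (s (T div b) j \<omega>)))
          in integrable M reg \<and>
             integral\<^sup>L M reg \<le> ?C * (1 / \<eta> + \<eta> * real T * real b / \<delta>\<^sup>2 + \<delta> * real T) \<and>
             (\<forall>\<omega>\<in>space M. loo \<omega> \<le> ?C * (real T / (\<epsilon> * real b)) \<and>
                           comm \<omega> \<le> ?C * (real T / real b)) \<and>
             (\<forall>\<theta>\<in>{0..1}.
                real b = real T powr (1 - \<theta>) \<longrightarrow>
                \<delta> = real T powr (- \<theta> / 4) \<longrightarrow>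
                \<eta> = \<delta> / sqrt (real b * real T) \<longrightarrow>
                  integral\<^sup>L M reg \<le> ?C * real T powr (1 - \<theta> / 4) \<and>
                  (\<forall>\<omega>\<in>space M. loo \<omega> \<le> ?C * real T powr (2 * \<theta>) \<and>
                                comm \<omega> \<le> ?C * real T powr \<theta>))"
      unfolding Let_def
    proof (intro conjI ballI impI)
      show "integrable M ?reg" by (rule reg(1))
      show "integral\<^sup>L M ?reg \<le> ?C * (1 / \<eta> + \<eta> * real T * real b / \<delta>\<^sup>2 + \<delta> * real T)" by (rule general)
    next
      fix \<theta> :: real
      assume \<theta>: "real b = real T powr (1 - \<theta>)" "\<delta> = real T powr (- \<theta> / 4)" "\<eta> = \<delta> / sqrt (real b * real T)"
      show "integral\<^sup>L M ?reg \<le> ?C * real T powr (1 - \<theta> / 4)" by (rule tuned(1)[OF \<theta>])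
      fix \<omega> assume "\<omega> \<in> space M"
      from counts[OF this, unfolded tuned(2,3)[OF \<theta>]]
      show "real (loo_count (s (T div b) i \<omega>)) \<le> ?C * real T powr (2 * \<theta>)"
        "real (\<Sum>j\<in>UNIV. comm_count (s (T div b) j \<omega>)) \<le> ?C * real T powr \<theta>" .
    qed (rule counts; assumption)+
  qed
qed

end
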